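(* Let $f:\mathbb{R}\to\mathbb{C}$ be a non-degenerate complex Gaussian stationary process with covariance kernel $r$ normalized by $r(0)=1$, whose spectral measure $\rho$ satisfies $\int_{\mathbb{R}}\lambda^2\log^{1+\alpha}(1+|\lambda|)\,d\rho(\lambda)<\infty$ for some $\alpha>0$. Let $\Delta(T)$ be the winding of $f$ in $[0,T]$. If $\rho$ has no atoms, then $$\lim_{T\to\infty}\frac{\mathrm{var}[\Delta(T)]}{T^2}=0.$$
   Context: A standard complex Gaussian $\mathcal{N}_{\mathbb{C}}(0,1)$ is a $\mathbb{C}$-valued random variable with density $\frac1\pi e^{-|z|^2}$ with respect to Lebesgue measure. A complex Gaussian vector is a random vector in $\mathbb{C}^n$ equal in distribution to $A\mathbf{v}$, with $A$ a (deterministic) complex $n\times m$ matrix and $\mathbf{v}\in\mathbb{C}^m$ having i.i.d. $\mathcal{N}_{\mathbb{C}}(0,1)$ components (everything is centred). A complex Gaussian process $f:\mathbb{R}\to\mathbb{C}$ is one all of whose finite marginals are complex Gaussian vectors; it is stationary if its finite-dimensional distributions are invariant under all real shifts. Its covariance kernel is $r(t)=\mathbb{E}[f(t)\overline{f(0)}]$, assumed continuous and normalized by $r(0)=1$. Its spectral measure is the probability measure $\rho$ on $\mathbb{R}$ with $r(t)=\int_{\mathbb{R}}e^{-it\lambda}\,d\rho(\lambda)$. The process is degenerate if $\rho$ consists of exactly one atom. The logarithmic moment condition on $\rho$ ensures that $f$ is a.s. continuously differentiable and that $r$ is twice continuously differentiable. The winding of $f$ in $[0,T]$ is $$\Delta(T)=\frac{1}{2i}\int_0^T\left[\frac{f'(t)}{f(t)}-\overline{\left(\frac{f'(t)}{f(t)}\right)}\right]dt$$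 (almost surely $f$ does not vanish on $[0,T]$). *)

theory Defs
  imports "HOL-Probability.Probability"
begin

definition std_complex_normal :: "complex measure" where
  "std_complex_normal = density lborel (\<lambda>z. ennreal (exp (- (cmod z)\<^sup>2) / pi))"

text \<open>A family \<open>X\<close> indexed by a finite set \<open>I\<close> is a complex Gaussian vector if it has the law
  of \<open>A v\<close>, where the \<open>m\<close> components of \<open>v\<close> are i.i.d. standard complex Gaussian (their joint law
  is the product measure) and \<open>A\<close> is a matrix with rows indexed by \<open>I\<close>.\<close>

definition complex_gaussian_vector :: "'a measure \<Rightarrow> 'i set \<Rightarrow> ('i \<Rightarrow> 'a \<Rightarrow> complex) \<Rightarrow> bool" where
  "complex_gaussian_vector M I X \<longleftrightarrow>
     (\<forall>i\<in>I. X i \<in> borel_measurable M) \<and>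
     (\<exists>(m::nat) (A :: 'i \<Rightarrow> nat \<Rightarrow> complex).
        distr M (Pi\<^sub>M I (\<lambda>_. borel)) (\<lambda>\<omega>. \<lambda>i\<in>I. X i \<omega>) =
        distr (Pi\<^sub>M {..<m} (\<lambda>_. std_complex_normal)) (Pi\<^sub>M I (\<lambda>_. borel))
          (\<lambda>v. \<lambda>i\<in>I. \<Sum>j<m. A i j * v j))"

definition complex_gaussian_process :: "'a measure \<Rightarrow> (real \<Rightarrow> 'a \<Rightarrow> complex) \<Rightarrow> bool" where
  "complex_gaussian_process M f \<longleftrightarrow>
     prob_space M \<and> (\<forall>I. finite I \<longrightarrow> complex_gaussian_vector M I f)"

definition stationary_process :: "'a measure \<Rightarrow> (real \<Rightarrow> 'a \<Rightarrow> complex) \<Rightarrow> bool" where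
  "stationary_process M f \<longleftrightarrow>
     (\<forall>I s. finite I \<longrightarrow>
        distr M (Pi\<^sub>M I (\<lambda>_. borel)) (\<lambda>\<omega>. \<lambda>t\<in>I. f (t + s) \<omega>) =
        distr M (Pi\<^sub>M I (\<lambda>_. borel)) (\<lambda>\<omega>. \<lambda>t\<in>I. f t \<omega>))"

definition covariance_kernel :: "'a measure \<Rightarrow> (real \<Rightarrow> 'a \<Rightarrow> complex) \<Rightarrow> real \<Rightarrow> complex" where
  "covariance_kernel M f t = (\<integral>\<omega>. f t \<omega> * cnj (f 0 \<omega>) \<partial>M)"

definition spectral_measure :: "real measure \<Rightarrow> (real \<Rightarrow> complex) \<Rightarrow> bool" where
  "spectral_measure \<rho> r \<longleftrightarrow>
     real_distribution \<rho> \<and>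
     (\<forall>t. r t = (\<integral>l. exp (- \<i> * complex_of_real t * complex_of_real l) \<partial>\<rho>))"

definition degenerate :: "real measure \<Rightarrow> bool" where
  "degenerate \<rho> \<longleftrightarrow> (\<exists>x. \<rho> = return borel x)"

definition has_no_atoms :: "real measure \<Rightarrow> bool" where
  "has_no_atoms \<rho> \<longleftrightarrow> (\<forall>x. measure \<rho> {x} = 0)"

text \<open>Winding of a path on \<open>[0, T]\<close>. It is written as a complex number, but the integrand is purely
  imaginary, so the value is always real.\<close>

definition winding :: "(real \<Rightarrow> complex) \<Rightarrow> real \<Rightarrow> complex" where
  "winding g T =
     1 / (2 * \<i>) *
     (LBINT t:{0..T}. vector_derivative g (at t) / g t - cnj (vector_derivative g (at t) / g t))"

text \<open>The winding of a process is only defined almost surely, so it is treated as a family of random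
  variables that almost surely equal the pathwise winding. (On a space that is not complete, the
  pathwise expression itself could fail to be measurable on a null set.)\<close>

definition winding_of_process ::
    "'a measure \<Rightarrow> (real \<Rightarrow> 'a \<Rightarrow> complex) \<Rightarrow> (real \<Rightarrow> 'a \<Rightarrow> real) \<Rightarrow> bool" where
  "winding_of_process M f \<Delta> \<longleftrightarrow>
     (\<forall>T>0. \<Delta> T \<in> borel_measurable M \<and>
        (AE \<omega> in M. complex_of_real (\<Delta> T \<omega>) = winding (\<lambda>t. f t \<omega>) T))"

end

theory Submission
  imports Defs
begin

text \<open>The winding is \<open>\<integral>\<^sub>0\<^sup>T Im (\<xi> t / F t) dt\<close>, where \<open>\<xi>\<close> is the mean-square derivative
  of the process; the logarithmic moment makes \<open>\<Sum>n. 2\<^sup>n \<integral>\<bar>\<xi> (t + u) - \<xi> t\<bar>\<^sup>2 du\<close> over \<open>\<bar>u\<bar> \<le> 2\<^sup>-\<^sup>n\<close>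
  almost surely finite, so almost every point is a Lebesgue point and the path has derivative \<open>\<xi> t\<close> there.
  Subtracting the mean frequency replaces \<open>\<xi> t\<close> by a variable \<open>\<zeta> t\<close> independent of \<open>F t\<close>, and the
  variance is at most the second moment of \<open>\<integral> Im (\<zeta> t / F t) dt\<close>. Negative moments of correlated Gaussian
  pairs give \<open>E \<bar>\<zeta> t \<zeta> s / (F t F s)\<bar> \<le> C (1 - \<bar>r (t - s)\<bar>\<^sup>2) powr (-3/8)\<close>, an integrable singularity at
  \<open>t = s\<close>. When \<open>\<bar>r (t - s)\<bar> \<le> 1/2\<close>, regression on \<open>(F t, F s)\<close> bounds the correlation of the two rates by
  covariances of the process and its derivative, which vanish on average by Wiener's lemma as there
  are no atoms. Cutting \<open>[0, T]\<close> into short blocks and using Cauchy--Schwarz on the block pairs with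
  \<open>\<bar>r\<bar> \<ge> 1/4\<close> combines the two estimates.\<close>

section \<open>Characteristic functions on Euclidean spaces\<close>

text \<open>The rate at a single time has no second moment, because |z|^(-2) is not locally
  integrable in the plane; the variance is therefore reached through the double time integral, where
  only pairs of distinct times count. Estimating the inverse product by E |F t F s|^(-3/2), of order
  (1 - |r|^2)^(-3/4), would give a singularity lag^(-3/2), which is not integrable in time. Young's
  inequality interpolates with one-point moments and halves the exponent, leaving lag^(-3/4). The
  moment exponent 3/2 lies between 1 and 2 and splits into 3/4 for each real coordinate. The lower
  bound on 1 - |r|^2 is uniform only for bounded lags: even without atoms |r| may come back close to
  1 at large lags, where no uniform bound on the kernel is at hand. Hence the blocks: Cauchy-Schwarz
  needs only the second moment of one short block, and that bound is the same wherever the block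
  lies. Laws are handled through characteristic functions: a random variable is matched with a
  function in L2(\<rho>), and orthogonality there becomes independence.\<close>

lemma finite_measure_char_unique:
  fixes \<mu> \<nu> :: "real measure"
  assumes fin: "finite_measure \<mu>" "finite_measure \<nu>"
    and sets: "sets \<mu> = sets borel" "sets \<nu> = sets borel"
    and eq: "\<And>s. (\<integral>x. iexp (s * x) \<partial>\<mu>) = (\<integral>x. iexp (s * x) \<partial>\<nu>)"
  shows "\<mu> = \<nu>"
proof -
  interpret m: finite_measure \<mu> by fact
  interpret n: finite_measure \<nu> by fact
  have [measurable_cong]: "sets \<mu> = sets borel" "sets \<nu> = sets borel" by fact+
  have sp: "space \<mu> = UNIV" "space \<nu> = UNIV" using sets by (auto dest: sets_eq_imp_space_eq)
  define c where "c = measure \<mu> UNIV"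
  \<comment> \<open>At frequency 0 the two integrals are the total masses, so one constant
    normalises both measures.\<close>
  have c: "measure \<nu> UNIV = c"
    using eq[of 0] by (simp add: sp c_def flip: of_real_def)
  show ?thesis
  proof (cases "c = 0")
    case True
    have "emeasure \<mu> A = 0" "emeasure \<nu> A = 0" for A
      using True c sp m.emeasure_eq_measure[of "UNIV"] n.emeasure_eq_measure[of "UNIV"]
        emeasure_space[of \<mu> A] emeasure_space[of \<nu> A] by (auto simp: c_def)
    then show ?thesis using sets by (intro measure_eqI) auto
  next
    case False
    then have cp: "c > 0" using c_def measure_nonneg[of \<mu> UNIV] by linarith
    define M1 where "M1 = density \<mu> (\<lambda>_. ennreal (1/c))"
    define M2 where "M2 = density \<nu> (\<lambda>_. ennreal (1/c))"
    have "real_distribution M1"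
      unfolding real_distribution_def real_distribution_axioms_def M1_def
      using cp m.emeasure_eq_measure[of "UNIV"]
      by (auto simp: sets sp emeasure_density nn_integral_cmult c_def[symmetric] simp flip: ennreal_mult intro!: prob_spaceI)
    moreover have "real_distribution M2"
      unfolding real_distribution_def real_distribution_axioms_def M2_def
      using cp n.emeasure_eq_measure[of "UNIV"]
      by (auto simp: sets sp emeasure_density nn_integral_cmult c simp flip: ennreal_mult intro!: prob_spaceI)
    moreover have "char M1 = char M2"
      unfolding char_def M1_def M2_def fun_eq_iff using cp
      by (auto simp: integral_density scaleR_conv_of_real simp del: of_real_mult intro!: arg_cong2[where f=times] eq)
    ultimately have *: "M1 = M2" by (rule Levy_uniqueness)
    have "emeasure \<mu> A = emeasure \<nu> A" if "A \<in> sets borel" for A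
    proof -
      have "ennreal (1/c) * emeasure \<mu> A = ennreal (1/c) * emeasure \<nu> A"
        using arg_cong[OF *, of "\<lambda>M. emeasure M A"] that
        by (simp add: M1_def M2_def emeasure_density nn_integral_cmult sets)
      then have "ennreal c * (ennreal (1/c) * emeasure \<mu> A) = ennreal c * (ennreal (1/c) * emeasure \<nu> A)"
        by simp
      then show ?thesis using cp by (simp add: mult.assoc[symmetric] flip: ennreal_mult)
    qed
    then show ?thesis using sets by (intro measure_eqI) auto
  qed
qed

text \<open>A density has to be nonnegative, so a character cannot serve as a weight directly. It is
  a complex combination of the nonnegative weights \<open>1 + cos (y + t)\<close> with shifts 0,
  -pi/2 and pi; the last bracket is the constant 2 and removes the additive constants.\<close>

lemma iexp_eq_cos: "iexp y = complex_of_real (1 + cos y) + \<i> * complex_of_real (1 + cos (y - pi/2))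
    - (1 + \<i>) / 2 * (complex_of_real (1 + cos y) + complex_of_real (1 + cos (y + pi)))"
  by (simp add: complex_eq_iff Re_exp Im_exp cos_diff)

lemma cos_eq_iexp: "complex_of_real (1 + cos (y + t)) = 1 + (iexp t * iexp y + iexp (-t) * iexp (-y)) / 2"
proof -
  have "iexp t * iexp y = iexp (y + t)" "iexp (-t) * iexp (-y) = iexp (- (y + t))"
    by (simp_all add: exp_add[symmetric] algebra_simps)
  then show ?thesis by (simp add: complex_eq_iff Re_exp Im_exp del: minus_add_distrib)
qed

text \<open>Induction over coordinates: those in \<open>B\<close> are already tested by indicators,
  while the character \<open>u\<close> still tests all of them. Weighting by
  \<open>h x * (1 + cos (u \<bullet> x + t))\<close> and projecting to a new coordinate gives finite
  measures on the line. The induction hypothesis makes their characteristic functions agree, so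
  one-dimensional uniqueness puts an indicator in that coordinate.\<close>

lemma char_eq_boxes:
  fixes \<mu> \<nu> :: "'a::euclidean_space measure"
  assumes prob: "prob_space \<mu>" "prob_space \<nu>"
    and sets: "sets \<mu> = sets borel" "sets \<nu> = sets borel"
    and eq: "\<And>u. (\<integral>x. iexp (u \<bullet> x) \<partial>\<mu>) = (\<integral>x. iexp (u \<bullet> x) \<partial>\<nu>)"
    and A: "\<And>b. A b \<in> sets borel" and B: "finite B"
  shows "(\<integral>x. complex_of_real (\<Prod>b\<in>B. indicator (A b) (x \<bullet> b)) * iexp (u \<bullet> x) \<partial>\<mu>) =
         (\<integral>x. complex_of_real (\<Prod>b\<in>B. indicator (A b) (x \<bullet> b)) * iexp (u \<bullet> x) \<partial>\<nu>)"
  using B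
proof (induction B arbitrary: u)
  case empty
  then show ?case using eq by simp
next
  case (insert b B)
  have [measurable]: "A b \<in> sets borel" for b by fact
  define h :: "'a \<Rightarrow> real" where "h x = (\<Prod>b\<in>B. indicator (A b) (x \<bullet> b))" for x
  have h[measurable]: "h \<in> borel_measurable borel" unfolding h_def by measurable
  have h0: "0 \<le> h x" and centered_freq: "h x \<le> 1" for x
    unfolding h_def by (auto intro!: prod_nonneg prod_le_1)
  define g where "g t x = h x * (1 + cos (u \<bullet> x + t))" for t x
  have g[measurable]: "g t \<in> borel_measurable borel" for t unfolding g_def by measurable
  have cos0: "0 \<le> 1 + cos y" for y :: real using cos_ge_minus_one[of y] by linarith
  have g0: "0 \<le> g t x" for t x unfolding g_def using h0 cos0 by simp
  have g2: "g t x \<le> 2" for t x unfolding g_def 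
    using mult_mono[of "h x" 1 "1 + cos (u \<bullet> x + t)" 2] centered_freq cos0 by auto
  define P where "P \<kappa> \<longleftrightarrow> prob_space \<kappa> \<and> sets \<kappa> = sets borel" for \<kappa> :: "'a measure"
  have IH: "(\<integral>x. complex_of_real (h x) * iexp (v \<bullet> x) \<partial>\<mu>) = (\<integral>x. complex_of_real (h x) * iexp (v \<bullet> x) \<partial>\<nu>)" for v
    using insert.IH unfolding h_def by simp
  have int_h: "integrable \<kappa> (\<lambda>x. complex_of_real (h x) * iexp (k x))"
    if "P \<kappa>" "k \<in> borel_measurable borel" for \<kappa> k
  proof -
    interpret prob_space \<kappa> using that by (simp add: P_def)
    have [measurable_cong]: "sets \<kappa> = sets borel" using that by (simp add: P_def)
    note that(2)[measurable]
    show ?thesis using h0 centered_freq by (intro integrable_const_bound[where B=1]) (auto simp: norm_mult)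
  qed
  \<comment> \<open>The characteristic function of the projected weighted measure becomes three
    integrals against \<open>h\<close>, at the frequencies s b, u + s b and s b - u, all covered by
    the induction hypothesis.\<close>
  have expand: "(\<integral>x. complex_of_real (g t x) * iexp (s * (x \<bullet> b)) \<partial>\<kappa>) =
     (\<integral>x. complex_of_real (h x) * iexp ((s *\<^sub>R b) \<bullet> x) \<partial>\<kappa>)
     + iexp t / 2 * (\<integral>x. complex_of_real (h x) * iexp ((u + s *\<^sub>R b) \<bullet> x) \<partial>\<kappa>)
     + iexp (- t) / 2 * (\<integral>x. complex_of_real (h x) * iexp ((s *\<^sub>R b - u) \<bullet> x) \<partial>\<kappa>)"
    if "P \<kappa>" for \<kappa> t s
  proof -
    have "complex_of_real (g t x) * iexp (s * (x \<bullet> b)) = 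
       complex_of_real (h x) * iexp ((s *\<^sub>R b) \<bullet> x)
       + iexp t / 2 * (complex_of_real (h x) * iexp ((u + s *\<^sub>R b) \<bullet> x))
       + iexp (- t) / 2 * (complex_of_real (h x) * iexp ((s *\<^sub>R b - u) \<bullet> x))" for x
    proof -
      have 1: "iexp ((s *\<^sub>R b) \<bullet> x) = iexp (s * (x \<bullet> b))"
        by (simp add: inner_commute)
      have 2: "iexp ((u + s *\<^sub>R b) \<bullet> x) = iexp (u \<bullet> x) * iexp (s * (x \<bullet> b))"
        by (simp add: inner_add_left inner_commute[of b] exp_add[symmetric] distrib_left)
      have 3: "iexp ((s *\<^sub>R b - u) \<bullet> x) = iexp (- (u \<bullet> x)) * iexp (s * (x \<bullet> b))"
        by (simp add: inner_diff_left inner_commute[of b] exp_add[symmetric] right_diff_distrib)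
      show ?thesis
        unfolding g_def of_real_mult[of "h x"] cos_eq_iexp 1 2 3 by (simp only: ring_distribs times_divide_eq_left times_divide_eq_right add_divide_distrib mult_1_left mult_1_right ac_simps)
    qed
    moreover have gen: "(\<integral>x. a x + c1 * a' x + c2 * a'' x \<partial>\<kappa>) = (\<integral>x. a x \<partial>\<kappa>) + c1 * (\<integral>x. a' x \<partial>\<kappa>) + c2 * (\<integral>x. a'' x \<partial>\<kappa>)"
      if "integrable \<kappa> a" "integrable \<kappa> a'" "integrable \<kappa> a''" for a a' a'' :: "'a \<Rightarrow> complex" and c1 c2
      using that by simp
    have [measurable]: "(\<lambda>x. v \<bullet> x) \<in> borel_measurable borel" for v :: 'a by simp
    ultimately show ?thesis
      using that by (simp only:) (intro gen int_h, simp_all)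
  qed
  define D where "D \<kappa> t = distr (density \<kappa> (\<lambda>x. ennreal (g t x))) borel (\<lambda>x. x \<bullet> b)" for \<kappa> t
  have D_fin: "finite_measure (D \<kappa> t)" if "P \<kappa>" for \<kappa> t
  proof -
    interpret prob_space \<kappa> using that by (simp add: P_def)
    have [measurable_cong]: "sets \<kappa> = sets borel" using that by (simp add: P_def)
    have "(\<integral>\<^sup>+x. ennreal (g t x) \<partial>\<kappa>) \<le> (\<integral>\<^sup>+x. 2 \<partial>\<kappa>)"
      using g2 g0 by (intro nn_integral_mono) (metis ennreal_leI ennreal_numeral zero_le_numeral)
    also have "\<dots> < \<infinity>" by (simp add: emeasure_space_1)
    finally show ?thesis unfolding D_def
      by (intro finite_measure.finite_measure_distr finite_measureI) (auto simp: emeasure_density cong: nn_integral_cong_simp)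
  qed
  have D_int: "(\<integral>x. k x \<partial>D \<kappa> t) = (\<integral>x. complex_of_real (g t x) * k (x \<bullet> b) \<partial>\<kappa>)"
    if "P \<kappa>" "k \<in> borel_measurable borel" for \<kappa> t and k :: "real \<Rightarrow> complex"
  proof -
    have [measurable_cong]: "sets \<kappa> = sets borel" using that by (simp add: P_def)
    note that(2)[measurable]
    show ?thesis unfolding D_def using g0 by (simp add: integral_distr integral_density scaleR_conv_of_real)
  qed
  have P: "P \<mu>" "P \<nu>" using prob sets by (auto simp: P_def)
  have "D \<mu> t = D \<nu> t" for t
  proof (rule finite_measure_char_unique)
    show "(\<integral>x. iexp (s * x) \<partial>D \<mu> t) = (\<integral>x. iexp (s * x) \<partial>D \<nu> t)" for s
      using P by (simp add: D_int expand IH del: of_real_mult inner_scaleR_left)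
  qed (use P D_fin in \<open>auto simp: D_def\<close>)
  then have key: "(\<integral>x. complex_of_real (g t x) * indicator (A b) (x \<bullet> b) \<partial>\<mu>)
      = (\<integral>x. complex_of_real (g t x) * indicator (A b) (x \<bullet> b) \<partial>\<nu>)" for t
    using D_int[of \<mu> "indicator (A b)" t] D_int[of \<nu> "indicator (A b)" t] P by simp
  have int_g: "integrable \<kappa> (\<lambda>x. complex_of_real (g t x) * indicator (A b) (x \<bullet> b))"
    if "P \<kappa>" for \<kappa> t
  proof -
    interpret prob_space \<kappa> using that by (simp add: P_def)
    have [measurable_cong]: "sets \<kappa> = sets borel" using that by (simp add: P_def)
    show ?thesis using g0 g2 by (intro integrable_const_bound[where B=2]) (auto simp: norm_mult indicator_def)
  qed
  \<comment> \<open>The nonnegative weights are recombined into the character by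
    \<open>iexp_eq_cos\<close>.\<close>
  have "(\<integral>x. complex_of_real (\<Prod>b\<in>insert b B. indicator (A b) (x \<bullet> b)) * iexp (u \<bullet> x) \<partial>\<kappa>)
     = (\<integral>x. complex_of_real (g 0 x) * indicator (A b) (x \<bullet> b) \<partial>\<kappa>)
     + \<i> * (\<integral>x. complex_of_real (g (-pi/2) x) * indicator (A b) (x \<bullet> b) \<partial>\<kappa>)
     - (1 + \<i>) / 2 * ((\<integral>x. complex_of_real (g 0 x) * indicator (A b) (x \<bullet> b) \<partial>\<kappa>)
     + (\<integral>x. complex_of_real (g pi x) * indicator (A b) (x \<bullet> b) \<partial>\<kappa>))" if "P \<kappa>" for \<kappa>
  proof -
    have *: "complex_of_real (\<Prod>b\<in>insert b B. indicator (A b) (x \<bullet> b)) * iexp (u \<bullet> x) = 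
      complex_of_real (g 0 x) * indicator (A b) (x \<bullet> b) 
     + \<i> * (complex_of_real (g (-pi/2) x) * indicator (A b) (x \<bullet> b))
     - (1 + \<i>) / 2 * (complex_of_real (g 0 x) * indicator (A b) (x \<bullet> b) 
       + complex_of_real (g pi x) * indicator (A b) (x \<bullet> b))" for x
    proof -
      have 1: "complex_of_real (\<Prod>b\<in>insert b B. indicator (A b) (x \<bullet> b)) = complex_of_real (h x) * indicator (A b) (x \<bullet> b)"
        using insert.hyps by (simp add: h_def indicator_def)
      show ?thesis unfolding 1 iexp_eq_cos g_def by (simp add: algebra_simps) 
    qed
    show ?thesis unfolding * using that by (simp add: int_g)
  qed
  then show ?case using P key by simp
qed

text \<open>With every basis coordinate tested by an open interval and zero frequency,
  \<open>char_eq_boxes\<close> compares the measures of open boxes, an intersection-stable generator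
  of the Borel sets that exhausts the space.\<close>

lemma char_unique:
  fixes \<mu> \<nu> :: "'a::euclidean_space measure"
  assumes prob: "prob_space \<mu>" "prob_space \<nu>"
    and sets: "sets \<mu> = sets borel" "sets \<nu> = sets borel"
    and eq: "\<And>u. (\<integral>x. iexp (u \<bullet> x) \<partial>\<mu>) = (\<integral>x. iexp (u \<bullet> x) \<partial>\<nu>)"
  shows "\<mu> = \<nu>"
proof -
  interpret m: prob_space \<mu> by fact
  interpret n: prob_space \<nu> by fact
  have [measurable_cong]: "sets \<mu> = sets borel" "sets \<nu> = sets borel" by fact+
  have sp: "space \<mu> = UNIV" "space \<nu> = UNIV" using sets by (auto dest: sets_eq_imp_space_eq)
  have box: "emeasure \<mu> (box l u) = emeasure \<nu> (box l u)" for l u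
  proof -
    have ind: "(\<Prod>b\<in>Basis. indicator {l \<bullet> b<..<u \<bullet> b} (x \<bullet> b)) = (indicator (box l u) x :: real)" for x
      by (auto simp: indicator_def box_def prod_zero_iff intro!: prod_zero)
    have "complex_of_real (measure \<mu> (box l u)) = complex_of_real (measure \<nu> (box l u))"
      using char_eq_boxes[OF prob sets eq, of "\<lambda>b. {l \<bullet> b<..<u \<bullet> b}" Basis 0]
      by (simp add: ind sp)
    then show ?thesis by (simp add: m.emeasure_eq_measure n.emeasure_eq_measure)
  qed
  show ?thesis
  proof (rule measure_eqI_generator_eq)
    show "Int_stable (range (\<lambda>(a, b). box a b :: 'a set))"
      by (auto simp: Int_stable_def box_Int_box)
    show "emeasure \<mu> X = emeasure \<nu> X" if "X \<in> range (\<lambda>(a, b). box a b)" for X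
      using that box by auto
    show "range (\<lambda>(a, b). box a b) \<subseteq> Pow UNIV" by auto
    show "sets \<mu> = sigma_sets UNIV (range (\<lambda>(a, b). box a b))" "sets \<nu> = sigma_sets UNIV (range (\<lambda>(a, b). box a b))"
      by (auto simp: sets borel_eq_box)
    show "range (\<lambda>n. box (-(real n *\<^sub>R One)) (real n *\<^sub>R One)) \<subseteq> range (\<lambda>(a, b). box a b :: 'a set)"
      by auto
    show "(\<Union>i. box (-(real i *\<^sub>R One)) (real i *\<^sub>R One)) = (UNIV::'a set)"
      using UN_box_eq_UNIV by simp
  qed auto
qed

text \<open>Kac's criterion for independence: the factorised expression is the characteristic
  function of the product measure, so uniqueness identifies the joint law.\<close>

lemma (in prob_space) distr_pair_char:
  fixes U :: "'a \<Rightarrow> 'b::euclidean_space" and V :: "'a \<Rightarrow> 'c::euclidean_space"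
  assumes U[measurable]: "U \<in> borel_measurable M" and V[measurable]: "V \<in> borel_measurable M"
    and eq: "\<And>u v. expectation (\<lambda>x. iexp (u \<bullet> U x + v \<bullet> V x)) =
       expectation (\<lambda>x. iexp (u \<bullet> U x)) * expectation (\<lambda>x. iexp (v \<bullet> V x))"
  shows "distr M borel (\<lambda>x. (U x, V x)) = distr M borel U \<Otimes>\<^sub>M distr M borel V"
proof -
  interpret DU: prob_space "distr M borel U" by (rule prob_space_distr) simp
  interpret DV: prob_space "distr M borel V" by (rule prob_space_distr) simp
  interpret P: pair_prob_space "distr M borel U" "distr M borel V" ..
  show ?thesis
  proof (rule char_unique)
    show "prob_space (distr M borel (\<lambda>x. (U x, V x)))" by (rule prob_space_distr) simp
    show "prob_space (distr M borel U \<Otimes>\<^sub>M distr M borel V)" by (rule P.P.prob_space_axioms)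
    show "sets (distr M borel U \<Otimes>\<^sub>M distr M borel V) = sets borel"
      by (simp add: borel_prod[symmetric] cong: sets_pair_measure_cong)
    fix w :: "'b \<times> 'c"
    obtain u v where w: "w = (u, v)" by (cases w)
    have "(\<integral>x. iexp (w \<bullet> x) \<partial>(distr M borel U \<Otimes>\<^sub>M distr M borel V))
       = (\<integral>x. iexp (u \<bullet> fst x) * iexp (v \<bullet> snd x) \<partial>(distr M borel U \<Otimes>\<^sub>M distr M borel V))"
      by (intro Bochner_Integration.integral_cong) (auto simp: w inner_prod_def exp_add[symmetric] algebra_simps)
    also have "\<dots> = (\<integral>x. (\<integral>y. iexp (u \<bullet> x) * iexp (v \<bullet> y) \<partial>distr M borel V) \<partial>distr M borel U)"
      by (subst P.integral_fst'[symmetric])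
       (auto intro!: P.P.integrable_const_bound[where B=1] simp: norm_mult case_prod_beta' )
    also have "\<dots> = (\<integral>x. iexp (u \<bullet> x) \<partial>distr M borel U) * (\<integral>y. iexp (v \<bullet> y) \<partial>distr M borel V)"
      by simp
    also have "\<dots> = expectation (\<lambda>x. iexp (w \<bullet> (U x, V x)))"
      by (simp add: integral_distr eq[symmetric] w)
    finally show "(\<integral>x. iexp (w \<bullet> x) \<partial>distr M borel (\<lambda>x. (U x, V x))) =
         (\<integral>x. iexp (w \<bullet> x) \<partial>(distr M borel U \<Otimes>\<^sub>M distr M borel V))"
      by (simp add: integral_distr)
  qed simp
qed

section \<open>The standard complex Gaussian\<close>

lemma Complex_measurable[measurable]:
  "f \<in> borel_measurable M \<Longrightarrow> g \<in> borel_measurable M \<Longrightarrow> (\<lambda>x. Complex (f x) (g x)) \<in> borel_measurable M"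
  by (simp add: borel_measurable_complex_iff)


abbreviation std_normal_square :: "(real \<times> real) measure" where
  "std_normal_square \<equiv> std_normal_distribution \<Otimes>\<^sub>M std_normal_distribution"

text \<open>The density is the product of two centred normal densities of variance 1/2, hence the
  factors 1 / sqrt 2. This form gives access to the moments and the characteristic function of the
  real normal law.\<close>

lemma std_complex_normal_eq:
  "std_complex_normal = distr std_normal_square borel
     (\<lambda>(x, y). Complex (x / sqrt 2) (y / sqrt 2))"
proof -
  interpret N: prob_space std_normal_distribution by (rule prob_space_normal_density) simp
  interpret lborel_pair: pair_sigma_finite "lborel :: real measure" "lborel :: real measure" ..
  have Cm[measurable]: "(\<lambda>p. Complex (fst p) (snd p)) \<in> borel_measurable (borel \<Otimes>\<^sub>M borel)"
    unfolding borel_prod by (intro borel_measurable_continuous_onI continuous_intros)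
  have lb: "(lborel :: complex measure) = distr (lborel \<Otimes>\<^sub>M lborel) borel (\<lambda>p. Complex (fst p) (snd p))"
  proof (rule lborel_eqI)
    fix l u :: complex assume le: "\<And>b. b \<in> Basis \<Longrightarrow> l \<bullet> b \<le> u \<bullet> b"
    have le': "Re l \<le> Re u" "Im l \<le> Im u" using le[of 1] le[of \<i>] by (auto simp: Basis_complex_def)
    have "(\<lambda>p. Complex (fst p) (snd p)) -` box l u \<inter> space (lborel \<Otimes>\<^sub>M lborel) = {Re l<..<Re u} \<times> {Im l<..<Im u}"
      by (auto simp: box_def Basis_complex_def space_pair_measure)
    then show "emeasure (distr (lborel \<Otimes>\<^sub>M lborel) borel (\<lambda>p. Complex (fst p) (snd p))) (box l u) =
       ennreal (\<Prod>b\<in>Basis. (u - l) \<bullet> b)"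
      using le' by (simp add: emeasure_distr lborel.emeasure_pair_measure_Times ennreal_mult Basis_complex_def complex_eq_iff)
  qed simp
  \<comment> \<open>Rescaling by 1 / sqrt 2, applied once per coordinate, contributes the factor 1/2
    that turns 1/pi into 1/(2 pi).\<close>
  have sub: "(\<integral>\<^sup>+x. g x \<partial>lborel) = (\<integral>\<^sup>+x. ennreal (1 / sqrt 2) * g (x / sqrt 2) \<partial>lborel)"
    if [measurable]: "g \<in> borel_measurable borel" for g :: "real \<Rightarrow> ennreal"
    using nn_integral_real_affine[of g "1 / sqrt 2" 0] by (simp add: nn_integral_cmult)
  show ?thesis
  proof (rule measure_eqI)
    fix A assume "A \<in> sets std_complex_normal"
    then have A[measurable]: "A \<in> sets borel" by (simp add: std_complex_normal_def)
    define G where "G x y = ennreal (exp (- x\<^sup>2 - y\<^sup>2) / pi) * indicator A (Complex x y)" for x y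
    have [measurable]: "(\<lambda>(x, y). G x y) \<in> borel_measurable (borel \<Otimes>\<^sub>M borel)"
      unfolding G_def case_prod_beta' by measurable
    have [measurable]: "(\<lambda>x. G x y) \<in> borel_measurable borel" "(\<lambda>y. G x y) \<in> borel_measurable borel" for x y
      by measurable
    have "emeasure std_complex_normal A = (\<integral>\<^sup>+z. ennreal (exp (- (cmod z)\<^sup>2) / pi) * indicator A z \<partial>lborel)"
      by (simp add: std_complex_normal_def emeasure_density)
    also have "\<dots> = (\<integral>\<^sup>+p. G (fst p) (snd p) \<partial>(lborel \<Otimes>\<^sub>M lborel))"
      by (subst lb, subst nn_integral_distr) (simp_all add: G_def cmod_power2)
    also have "\<dots> = (\<integral>\<^sup>+x. \<integral>\<^sup>+y. G x y \<partial>lborel \<partial>lborel)"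
      by (subst lborel.nn_integral_fst[symmetric]) auto
    also have "\<dots> = (\<integral>\<^sup>+x. \<integral>\<^sup>+y. ennreal (1 / sqrt 2) * G x (y / sqrt 2) \<partial>lborel \<partial>lborel)"
      by (intro nn_integral_cong sub) simp
    also have "\<dots> = (\<integral>\<^sup>+x. ennreal (1 / sqrt 2) * (\<integral>\<^sup>+y. ennreal (1 / sqrt 2) * G (x / sqrt 2) (y / sqrt 2) \<partial>lborel) \<partial>lborel)"
      by (rule sub) measurable
    also have "\<dots> = (\<integral>\<^sup>+x. \<integral>\<^sup>+y. ennreal (std_normal_density x) * (ennreal (std_normal_density y) * indicator A (Complex (x / sqrt 2) (y / sqrt 2))) \<partial>lborel \<partial>lborel)"
    proof (intro nn_integral_cong)
      fix x :: real
      have "ennreal (1 / sqrt 2) * (\<integral>\<^sup>+y. ennreal (1 / sqrt 2) * G (x / sqrt 2) (y / sqrt 2) \<partial>lborel)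
        = (\<integral>\<^sup>+y. ennreal (1 / sqrt 2) * (ennreal (1 / sqrt 2) * G (x / sqrt 2) (y / sqrt 2)) \<partial>lborel)"
        by (subst nn_integral_cmult) auto
      also have "\<dots> = (\<integral>\<^sup>+y. ennreal (std_normal_density x) * (ennreal (std_normal_density y) * indicator A (Complex (x / sqrt 2) (y / sqrt 2))) \<partial>lborel)"
        by (intro nn_integral_cong)
          (auto simp: G_def indicator_def std_normal_density_def power_divide exp_add[symmetric] exp_diff exp_minus field_simps real_sqrt_mult simp flip: ennreal_mult intro!: arg_cong[where f=ennreal])
      finally show "ennreal (1 / sqrt 2) * (\<integral>\<^sup>+y. ennreal (1 / sqrt 2) * G (x / sqrt 2) (y / sqrt 2) \<partial>lborel) = \<dots>" .
    qed
    also have "\<dots> = (\<integral>\<^sup>+x. \<integral>\<^sup>+y. indicator A (Complex (x / sqrt 2) (y / sqrt 2)) \<partial>std_normal_distribution \<partial>std_normal_distribution)"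
    proof -
      have J: "(\<lambda>x. \<integral>\<^sup>+y. indicator A (Complex (x / sqrt 2) (y / sqrt 2)) \<partial>std_normal_distribution) \<in> borel_measurable lborel"
        by (rule N.borel_measurable_nn_integral) (simp add: case_prod_beta')
      show ?thesis
        by (subst nn_integral_density[OF _ J], simp, intro nn_integral_cong, subst nn_integral_density)
          (auto simp: nn_integral_cmult)
    qed
    also have "\<dots> = (\<integral>\<^sup>+p. indicator A (Complex (fst p / sqrt 2) (snd p / sqrt 2)) \<partial>std_normal_square)"
      by (subst N.nn_integral_fst[symmetric]) auto
    also have "\<dots> = emeasure (distr std_normal_square borel
     (\<lambda>(x, y). Complex (x / sqrt 2) (y / sqrt 2))) A"
      by (subst nn_integral_indicator[symmetric], simp, subst nn_integral_distr) (auto simp: case_prod_beta')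
    finally show "emeasure std_complex_normal A = \<dots>" .
  qed (simp add: std_complex_normal_def)
qed

lemma sets_std_complex_normal[simp, measurable_cong]: "sets std_complex_normal = sets borel"
  by (simp add: std_complex_normal_def)

lemma space_std_complex_normal[simp]: "space std_complex_normal = UNIV"
  by (simp add: std_complex_normal_def)

interpretation stdN: prob_space std_normal_distribution by (rule prob_space_normal_density) simp
interpretation stdNN: pair_prob_space std_normal_distribution std_normal_distribution ..

interpretation scn: prob_space std_complex_normal
  unfolding std_complex_normal_eq by (intro stdNN.P.prob_space_distr) (simp add: case_prod_beta')

lemma integrable_stdNN:
  fixes g :: "real \<Rightarrow> real"
  assumes g: "integrable std_normal_distribution g"
  shows "integrable std_normal_square (\<lambda>p. g (fst p))"
    "integrable std_normal_square (\<lambda>p. g (snd p))"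
proof -
  have [measurable]: "g \<in> borel_measurable borel" using borel_measurable_integrable[OF g] by simp
  show 1: "integrable std_normal_square (\<lambda>p. g (fst p))"
    using g by (intro stdNN.Fubini_integrable) auto
  show "integrable std_normal_square (\<lambda>p. g (snd p))"
    using stdNN.integrable_product_swap[OF 1] by (simp add: case_prod_beta')
qed

text \<open>The variance 1/2 of each real component accounts for the 4 in the exponent. All complex
  Gaussian laws below are identified through this formula.\<close>

lemma std_complex_normal_char:
  "(\<integral>z. iexp (Re (c * z)) \<partial>std_complex_normal) = complex_of_real (exp (- (cmod c)\<^sup>2 / 4))"
proof -
  have "(\<integral>z. iexp (Re (c * z)) \<partial>std_complex_normal) =
    (\<integral>p. iexp (Re c / sqrt 2 * fst p) * iexp (- Im c / sqrt 2 * snd p) \<partial>std_normal_square)"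
    unfolding std_complex_normal_eq
    by (subst integral_distr) (auto simp: case_prod_beta' exp_add[symmetric] field_simps intro!: Bochner_Integration.integral_cong)
  also have "\<dots> = (\<integral>x. (\<integral>y. iexp (Re c / sqrt 2 * x) * iexp (- Im c / sqrt 2 * y) \<partial>std_normal_distribution) \<partial>std_normal_distribution)"
    by (subst stdNN.integral_fst'[symmetric])
       (auto intro!: stdNN.P.integrable_const_bound[where B=1] simp: norm_mult case_prod_beta')
  also have "\<dots> = char std_normal_distribution (Re c / sqrt 2) * char std_normal_distribution (- Im c / sqrt 2)"
    unfolding char_def by simp
  also have "\<dots> = complex_of_real (exp (- (cmod c)\<^sup>2 / 4))"
    unfolding char_std_normal_distribution of_real_mult[symmetric] exp_add[symmetric]
    by (simp add: cmod_power2 power_divide field_simps)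
  finally show ?thesis .
qed

lemma std_complex_normal_rotate:
  assumes "cmod c = 1"
  shows "distr std_complex_normal borel (\<lambda>z. c * z) = std_complex_normal"
proof (rule char_unique)
  fix u
  show "(\<integral>x. iexp (u \<bullet> x) \<partial>distr std_complex_normal borel (\<lambda>z. c * z)) = (\<integral>x. iexp (u \<bullet> x) \<partial>std_complex_normal)"
    using std_complex_normal_char[of "cnj u * c"] std_complex_normal_char[of "cnj u"] assms
    by (simp add: integral_distr inner_complex_def norm_mult algebra_simps)
qed (auto intro!: scn.prob_space_distr scn.prob_space_axioms)

lemma integrable_std_complex_normal_moment: "integrable std_complex_normal (\<lambda>z. (cmod z) ^ (2 * k))"
proof -
  have sq: "integrable std_normal_square (\<lambda>p. fst p ^ (2 * k) + snd p ^ (2 * k))"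
    by (intro Bochner_Integration.integrable_add integrable_stdNN std_normal_distribution_even_moments)
  show ?thesis unfolding std_complex_normal_eq
  proof (subst integrable_distr_eq)
    show "integrable std_normal_square (\<lambda>p. cmod (case p of (x, y) \<Rightarrow> Complex (x / sqrt 2) (y / sqrt 2)) ^ (2 * k))"
    proof (rule Bochner_Integration.integrable_bound[OF sq])
      have "cmod (Complex (x / sqrt 2) (y / sqrt 2)) ^ (2 * k) \<le> x ^ (2 * k) + y ^ (2 * k)" for x y
      proof -
        have "cmod (Complex (x / sqrt 2) (y / sqrt 2)) ^ (2 * k) = ((x\<^sup>2 + y\<^sup>2) / 2) ^ k"
          by (simp add: power_mult cmod_power2 power_divide add_divide_distrib)
        also have "\<dots> \<le> (max (x\<^sup>2) (y\<^sup>2)) ^ k"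
          by (intro power_mono) (auto simp: max_def)
        also have "\<dots> \<le> x ^ (2 * k) + y ^ (2 * k)"
          by (auto simp: max_def power_mult)
        finally show ?thesis .
      qed
      then show "AE p in std_normal_square.
        norm (cmod (case p of (x, y) \<Rightarrow> Complex (x / sqrt 2) (y / sqrt 2)) ^ (2 * k)) \<le> norm (fst p ^ (2 * k) + snd p ^ (2 * k))"
        by (auto simp: case_prod_beta')
    qed (simp add: case_prod_beta')
  qed (auto simp: case_prod_beta')
qed

text \<open>By circular symmetry: rotation by -1 reverses the sign of z, rotation by the imaginary
  unit that of z^2. The vanishing second moment without conjugation later removes every unconjugated
  covariance.\<close>

lemma integral_std_complex_normal:
  "(\<integral>z. z \<partial>std_complex_normal) = 0" "(\<integral>z. z\<^sup>2 \<partial>std_complex_normal) = 0"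
  "(\<integral>z. (cmod z)\<^sup>2 \<partial>std_complex_normal) = 1"
proof -
  have "(\<integral>z. z \<partial>std_complex_normal) = - (\<integral>z. z \<partial>std_complex_normal)"
    by (subst std_complex_normal_rotate[of "-1", symmetric]) (simp_all add: integral_distr)
  then show "(\<integral>z. z \<partial>std_complex_normal) = 0" by simp
  have "(\<integral>z. z\<^sup>2 \<partial>std_complex_normal) = - (\<integral>z. z\<^sup>2 \<partial>std_complex_normal)"
    by (subst std_complex_normal_rotate[of "\<i>", symmetric]) (simp_all add: integral_distr power_mult_distrib)
  then show "(\<integral>z. z\<^sup>2 \<partial>std_complex_normal) = 0" by simp
  have m2: "integrable std_normal_distribution (\<lambda>x. x\<^sup>2)" "(\<integral>x. x\<^sup>2 \<partial>std_normal_distribution) = 1"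
    using std_normal_distribution_even_moments[of 1] by auto
  have i1: "integrable std_normal_square (\<lambda>p. (fst p)\<^sup>2)"
    and i2: "integrable std_normal_square (\<lambda>p. (snd p)\<^sup>2)"
    using integrable_stdNN[OF m2(1)] by auto
  have "(\<integral>z. (cmod z)\<^sup>2 \<partial>std_complex_normal) = (\<integral>p. ((fst p)\<^sup>2 + (snd p)\<^sup>2) / 2 \<partial>std_normal_square)"
    unfolding std_complex_normal_eq
    by (subst integral_distr) (auto simp: case_prod_beta' cmod_power2 power_divide add_divide_distrib)
  also have "\<dots> = ((\<integral>p. (fst p)\<^sup>2 \<partial>std_normal_square) + (\<integral>p. (snd p)\<^sup>2 \<partial>std_normal_square)) / 2"
    using i1 i2 by simp
  also have "\<dots> = 1" 
    using stdNN.integral_fst'[OF i1] stdNN.integral_fst'[OF i2] m2 stdN.prob_space by simp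
  finally show "(\<integral>z. (cmod z)\<^sup>2 \<partial>std_complex_normal) = 1" .
qed

section \<open>Negative moments of shifted Gaussian variables\<close>

lemma nn_integral_powr_neg:
  "(\<integral>\<^sup>+x. ennreal (\<bar>x\<bar> powr (-3/4)) * indicator {-1..1} x \<partial>lborel) \<le> 8"
proof -
  have 1: "(\<integral>\<^sup>+x. ennreal (x powr (-3/4)) * indicator {0..1} x \<partial>lborel) = 4"
    using nn_integral_has_integral_lebesgue'[OF _ has_integral_powr_from_0[of "-3/4" 1]] by simp
  have "(\<integral>\<^sup>+x. ennreal (\<bar>x\<bar> powr (-3/4)) * indicator {-1..1} x \<partial>lborel)
    \<le> (\<integral>\<^sup>+x. ennreal (x powr (-3/4)) * indicator {0..1} x + ennreal ((-x) powr (-3/4)) * indicator {0..1} (-x) \<partial>lborel)"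
    by (intro nn_integral_mono) (auto simp: indicator_def)
  also have "\<dots> = 4 + (\<integral>\<^sup>+x. ennreal ((-x) powr (-3/4)) * indicator {0..1} (-x) \<partial>lborel)"
    by (subst nn_integral_add, measurable, subst 1, rule refl)
  also have "(\<integral>\<^sup>+x. ennreal ((-x) powr (-3/4)) * indicator {0..1} (-x) \<partial>lborel) = 4"
  proof -
    have m: "(\<lambda>x. ennreal (x powr (-3/4)) * indicator {0..1} x) \<in> borel_measurable borel" by measurable
    have n: "(-1::real) \<noteq> 0" by simp
    show ?thesis
      using nn_integral_real_affine[OF m n, of 0] 1
      by (simp only: abs_minus abs_one abs_minus_cancel ennreal_1 mult_1_left add_0_left mult_minus_left)
  qed
  finally show ?thesis by simp
qed

text \<open>The bound does not depend on the centre \<open>c\<close>: where \<bar>c / s + x\<bar>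
  \<le> 1 the density is at most 1 and the power contributes at most 8; elsewhere the power is at
  most 1 and contributes at most the total mass.\<close>

lemma std_normal_neg_moment:
  assumes "s > 0"
  shows "(\<integral>\<^sup>+x. ennreal (\<bar>c + s * x\<bar> powr (-3/4)) \<partial>std_normal_distribution) \<le> ennreal (9 * s powr (-3/4))"
proof -
  have d1: "std_normal_density x \<le> 1" for x
  proof -
    have "1 \<le> sqrt (2 * pi)" using pi_gt3 by (intro real_le_rsqrt) simp
    then have "1 / sqrt (2 * pi) * exp (- x\<^sup>2 / 2) \<le> 1 * 1" by (intro mult_mono) (auto simp: divide_simps)
    then show ?thesis by (simp add: std_normal_density_def)
  qed
  have "(\<integral>\<^sup>+x. ennreal (\<bar>c / s + x\<bar> powr (-3/4)) \<partial>std_normal_distribution)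
     \<le> (\<integral>\<^sup>+x. ennreal (std_normal_density x) + ennreal (\<bar>c / s + x\<bar> powr (-3/4)) * indicator {-1..1} (c / s + x) \<partial>lborel)"
  proof (subst nn_integral_density, simp, simp, rule nn_integral_mono)
    fix x
    show "ennreal (std_normal_density x) * ennreal (\<bar>c / s + x\<bar> powr (-3/4)) \<le> 
      ennreal (std_normal_density x) + ennreal (\<bar>c / s + x\<bar> powr (-3/4)) * indicator {-1..1} (c / s + x)"
    proof (cases "\<bar>c / s + x\<bar> \<le> 1")
      case True
      have "ennreal (std_normal_density x) * ennreal (\<bar>c / s + x\<bar> powr (-3/4)) \<le> 1 * ennreal (\<bar>c / s + x\<bar> powr (-3/4))"
        using d1[of x] by (intro mult_right_mono) (auto simp: ennreal_le_1)
      also have "\<dots> \<le> ennreal (std_normal_density x) + 1 * ennreal (\<bar>c / s + x\<bar> powr (-3/4))"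
        by (rule add_increasing) auto
      finally show ?thesis using True by (simp add: abs_le_iff)
    next
      case False
      then have "\<bar>c / s + x\<bar> powr (-3/4) \<le> \<bar>c / s + x\<bar> powr 0"
        by (intro powr_mono) auto
      then have "\<bar>c / s + x\<bar> powr (-3/4) \<le> 1" by (simp split: if_splits)
      then have "ennreal (std_normal_density x) * ennreal (\<bar>c / s + x\<bar> powr (-3/4)) \<le> ennreal (std_normal_density x) * 1"
        by (intro mult_left_mono) (auto simp: ennreal_le_1)
      also have "\<dots> \<le> ennreal (std_normal_density x) * 1 + ennreal (\<bar>c / s + x\<bar> powr (-3/4)) * indicator {-1..1} (c / s + x)"
        by (rule add_increasing2) auto
      finally show ?thesis by simp
    qed
  qed
  also have "\<dots> = 1 + (\<integral>\<^sup>+x. ennreal (\<bar>c / s + x\<bar> powr (-3/4)) * indicator {-1..1} (c / s + x) \<partial>lborel)"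
    by (subst nn_integral_add) (auto simp: nn_integral_eq_integral)
  also have "(\<integral>\<^sup>+x. ennreal (\<bar>c / s + x\<bar> powr (-3/4)) * indicator {-1..1} (c / s + x) \<partial>lborel)
     = (\<integral>\<^sup>+x. ennreal (\<bar>x\<bar> powr (-3/4)) * indicator {-1..1} x \<partial>lborel)"
    using nn_integral_real_affine[of "\<lambda>x. ennreal (\<bar>x\<bar> powr (-3/4)) * indicator {-1..1} x" "1" "c / s"] by simp
  also have "1 + \<dots> \<le> 1 + 8" by (intro add_left_mono nn_integral_powr_neg)
  finally have *: "(\<integral>\<^sup>+x. ennreal (\<bar>c / s + x\<bar> powr (-3/4)) \<partial>std_normal_distribution) \<le> 9" by simp
  have "\<bar>c + s * x\<bar> powr (-3/4) = s powr (-3/4) * \<bar>c / s + x\<bar> powr (-3/4)" for x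
  proof -
    have "\<bar>c + s * x\<bar> = s * \<bar>c / s + x\<bar>" using assms by (simp add: abs_mult[of s, symmetric] field_simps flip: abs_of_pos)
    then show ?thesis using assms by (simp add: powr_mult)
  qed
  then have "(\<integral>\<^sup>+x. ennreal (\<bar>c + s * x\<bar> powr (-3/4)) \<partial>std_normal_distribution)
    = ennreal (s powr (-3/4)) * (\<integral>\<^sup>+x. ennreal (\<bar>c / s + x\<bar> powr (-3/4)) \<partial>std_normal_distribution)"
    by (simp add: ennreal_mult nn_integral_cmult)
  also have "\<dots> \<le> ennreal (s powr (-3/4)) * 9" by (intro mult_left_mono *) simp
  finally show ?thesis by (simp add: ennreal_mult mult.commute)
qed

text \<open>Since |z| dominates both coordinates, |z|^(-3/2) is at most the product of the
  coordinate powers with exponent -3/4, and the integral factorises. The constant is 9 * 9 from the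
  two real bounds times 2, a bound for (sqrt 2) powr (3/2). Uniformity in the shift \<open>b\<close>
  allows conditioning later.\<close>

lemma std_complex_normal_neg_moment:
  assumes s: "s > 0"
  shows "(\<integral>\<^sup>+z. ennreal (cmod (b + complex_of_real s * z) powr (-3/2)) \<partial>std_complex_normal) \<le> ennreal (162 * s powr (-3/2))"
proof -
  define s' where "s' = s / sqrt 2"
  have s': "s' > 0" using s by (simp add: s'_def)
  let ?f = "\<lambda>c x. ennreal (\<bar>c + s' * x\<bar> powr (-3/4))"
  \<comment> \<open>The axes must be excluded: \<open>0 powr a\<close> is 0, so the product bound
    fails where one coordinate vanishes.\<close>
  have ae: "AE x in std_normal_distribution. c + s' * x \<noteq> 0" for c
  proof -
    have "AE x in lborel. c + s' * x \<noteq> 0"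
      by (rule eventually_mono[OF AE_lborel_singleton[of "- c / s'"]]) (use s' in \<open>auto simp: field_simps add_eq_0_iff\<close>)
    then show ?thesis by (subst AE_density) auto
  qed
  have "(\<integral>\<^sup>+z. ennreal (cmod (b + complex_of_real s * z) powr (-3/2)) \<partial>std_complex_normal)
     = (\<integral>\<^sup>+x. \<integral>\<^sup>+y. ennreal (cmod (Complex (Re b + s' * x) (Im b + s' * y)) powr (-3/2)) \<partial>std_normal_distribution \<partial>std_normal_distribution)"
    unfolding std_complex_normal_eq
    by (subst nn_integral_distr, simp add: case_prod_beta', simp, subst stdN.nn_integral_fst[symmetric])
      (auto simp: case_prod_beta' s'_def Complex_eq algebra_simps intro!: nn_integral_cong arg_cong[where f="\<lambda>x. ennreal (cmod x powr _)"] complex_eqI)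
  also have "\<dots> \<le> (\<integral>\<^sup>+x. \<integral>\<^sup>+y. ?f (Re b) x * ?f (Im b) y \<partial>std_normal_distribution \<partial>std_normal_distribution)"
  proof (rule nn_integral_mono_AE)
    show "AE x in std_normal_distribution. (\<integral>\<^sup>+y. ennreal (cmod (Complex (Re b + s' * x) (Im b + s' * y)) powr (-3/2)) \<partial>std_normal_distribution)
      \<le> (\<integral>\<^sup>+y. ?f (Re b) x * ?f (Im b) y \<partial>std_normal_distribution)"
      using ae[of "Re b"]
    proof eventually_elim
      case (elim x)
      show ?case
      proof (rule nn_integral_mono_AE)
        show "AE y in std_normal_distribution. ennreal (cmod (Complex (Re b + s' * x) (Im b + s' * y)) powr (-3/2)) \<le> ?f (Re b) x * ?f (Im b) y"
          using ae[of "Im b"]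
        proof eventually_elim
          case (elim y)
          define p q where "p = \<bar>Re b + s' * x\<bar>" and "q = \<bar>Im b + s' * y\<bar>"
          have pq: "p > 0" "q > 0" using elim \<open>Re b + s' * x \<noteq> 0\<close> by (auto simp: p_def q_def)
          define n where "n = cmod (Complex (Re b + s' * x) (Im b + s' * y))"
          have np: "p \<le> n" "q \<le> n" unfolding n_def p_def q_def
            using abs_Re_le_cmod[of "Complex (Re b + s' * x) (Im b + s' * y)"] abs_Im_le_cmod[of "Complex (Re b + s' * x) (Im b + s' * y)"] by auto
          have "n powr (-3/2) = n powr (-3/4) * n powr (-3/4)"
            by (simp add: powr_add[symmetric])
          also have "\<dots> \<le> p powr (-3/4) * q powr (-3/4)"
            using pq np by (intro mult_mono powr_mono2') auto
          finally show ?case by (simp add: n_def p_def q_def flip: ennreal_mult)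
        qed
      qed
    qed
  qed
  also have "\<dots> = (\<integral>\<^sup>+x. ?f (Re b) x \<partial>std_normal_distribution) * (\<integral>\<^sup>+y. ?f (Im b) y \<partial>std_normal_distribution)"
    by (simp add: nn_integral_cmult nn_integral_multc)
  also have "\<dots> \<le> ennreal (9 * s' powr (-3/4)) * ennreal (9 * s' powr (-3/4))"
    by (intro mult_mono std_normal_neg_moment s') auto
  also have "\<dots> = ennreal (81 * s' powr (-3/2))"
    by (simp add: powr_add[symmetric] flip: ennreal_mult)
  also have "\<dots> \<le> ennreal (162 * s powr (-3/2))"
  proof -
    have "s' powr (-3/2) = s powr (-3/2) * (sqrt 2) powr (3/2)"
      using s by (simp add: s'_def powr_divide powr_minus_divide)
    also have "(sqrt 2) powr (3/2) \<le> (sqrt 2) powr 2" by (intro powr_mono) auto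
    also have "(sqrt 2) powr 2 = (2::real)" by (simp add: powr_numeral)
    finally show ?thesis using s by (intro ennreal_leI) (auto simp: mult_left_mono)
  qed
  finally show ?thesis .
qed

section \<open>Characteristic functions of stationary Gaussian processes\<close>

lemma borel_measurable_cnj[measurable]: "cnj \<in> borel_measurable borel"
  by (intro borel_measurable_continuous_onI continuous_intros)

text \<open>The image of the process at time \<open>t\<close> under the spectral isometry into
  L2(\<rho>), with the sign convention of \<open>spectral_measure\<close>.\<close>

definition fourier_mode :: "real \<Rightarrow> real \<Rightarrow> complex" where
  "fourier_mode t l = exp (- \<i> * complex_of_real t * complex_of_real l)"

lemma fourier_mode_measurable[measurable]: "(\<lambda>p. fourier_mode (fst p) (snd p)) \<in> borel_measurable (borel \<Otimes>\<^sub>M borel)"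
  unfolding fourier_mode_def borel_prod by (intro borel_measurable_continuous_onI continuous_intros)

lemma fourier_mode_measurable'[measurable]: "fourier_mode t \<in> borel_measurable borel"
  unfolding fourier_mode_def by (intro borel_measurable_continuous_onI continuous_intros)

lemma norm_fourier_mode[simp]: "cmod (fourier_mode t l) = 1"
  by (simp add: fourier_mode_def)

lemma fourier_mode_mult_cnj: "fourier_mode t l * cnj (fourier_mode s l) = fourier_mode (t - s) l"
  by (simp add: fourier_mode_def exp_cnj exp_add[symmetric] algebra_simps)

lemma prod_scn_moments:
  fixes m :: nat
  defines "N \<equiv> Pi\<^sub>M {..<m} (\<lambda>_. std_complex_normal)"
  assumes "j < m" "k < m"
  shows "integrable N (\<lambda>v. v j * cnj (v k))" "(\<integral>v. v j * cnj (v k) \<partial>N) = (if j = k then 1 else 0)"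
proof -
  interpret P: product_sigma_finite "\<lambda>_. std_complex_normal" ..
  \<comment> \<open>The two factors are spread over all coordinates, with 1 everywhere except at
    \<open>j\<close> and \<open>k\<close>, so that one product formula serves both j = k and
    distinct indices.\<close>
  define g where "g i z = (if i = j then z else 1) * (if i = k then cnj z else 1)" for i :: nat and z :: complex
  have pr: "v j * cnj (v k) = (\<Prod>i<m. g i (v i))" for v
    using assms by (simp add: g_def prod.distrib)
  have sq: "integrable std_complex_normal (\<lambda>z. z * cnj z)"
    using integrable_std_complex_normal_moment[of 1]
    by (simp add: complex_norm_square[symmetric] del: of_real_power flip: of_real_power)
  have z1: "integrable std_complex_normal (\<lambda>z. z)"
  proof (rule Bochner_Integration.integrable_bound)
    show "integrable std_complex_normal (\<lambda>z. 1 + (cmod z) ^ (2 * 1))"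
      using integrable_std_complex_normal_moment[of 1] by (intro Bochner_Integration.integrable_add) auto
    have "cmod z \<le> 1 + (cmod z)\<^sup>2" for z
      using zero_le_power2[of "cmod z - 1"] unfolding power2_diff by (smt (verit) norm_ge_zero mult_2 mult_1_right one_power2)
    then show "AE z in std_complex_normal. norm z \<le> norm (1 + (cmod z) ^ (2 * 1))"
      by simp
  qed simp
  have z2: "integrable std_complex_normal (\<lambda>z. cnj z)"
    using integrable_cnj[OF z1] by simp
  have gi: "integrable std_complex_normal (g i)" for i
    unfolding g_def using sq z1 z2 by (cases "i = j"; cases "i = k"; simp)
  show "integrable N (\<lambda>v. v j * cnj (v k))"
    unfolding pr N_def by (intro P.product_integrable_prod gi) auto
  have "(\<integral>v. v j * cnj (v k) \<partial>N) = (\<Prod>i<m. \<integral>z. g i z \<partial>std_complex_normal)"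
    unfolding pr N_def by (intro P.product_integral_prod gi) auto
  also have "\<dots> = (if j = k then 1 else 0)"
  proof (cases "j = k")
    case True
    have "(\<integral>z. z * cnj z \<partial>std_complex_normal) = 1"
    proof -
      have "(\<integral>z. z * cnj z \<partial>std_complex_normal) = (\<integral>z. complex_of_real ((cmod z)\<^sup>2) \<partial>std_complex_normal)"
        by (simp add: complex_norm_square del: of_real_power)
      then show ?thesis using integral_std_complex_normal(3) by (simp del: of_real_power)
    qed
    then have "(\<integral>z. g i z \<partial>std_complex_normal) = 1" for i
      using True scn.prob_space by (cases "i = k") (auto simp: g_def)
    then show ?thesis using True by simp
  next
    case False
    have "(\<integral>z. g j z \<partial>std_complex_normal) = 0"
      using False by (simp add: g_def integral_std_complex_normal)
    then show ?thesis using False assms by (auto intro!: prod_zero)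
  qed
  finally show "(\<integral>v. v j * cnj (v k) \<partial>N) = (if j = k then 1 else 0)" .
qed

lemma prod_scn_char:
  fixes m :: nat
  shows "(\<integral>v. iexp (Re (\<Sum>j<m. b j * v j)) \<partial>Pi\<^sub>M {..<m} (\<lambda>_. std_complex_normal)) =
     complex_of_real (exp (- (\<Sum>j<m. (cmod (b j))\<^sup>2) / 4))"
proof -
  interpret P: product_sigma_finite "\<lambda>_::nat. std_complex_normal" ..
  have "(\<integral>v. iexp (Re (\<Sum>j<m. b j * v j)) \<partial>Pi\<^sub>M {..<m} (\<lambda>_. std_complex_normal)) =
    (\<integral>v. (\<Prod>j<m. iexp (Re (b j * v j))) \<partial>Pi\<^sub>M {..<m} (\<lambda>_. std_complex_normal))"
    by (subst exp_sum[symmetric]) (simp_all add: sum_distrib_left)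
  also have "\<dots> = (\<Prod>j<m. \<integral>z. iexp (Re (b j * z)) \<partial>std_complex_normal)"
    by (intro P.product_integral_prod) (auto intro!: scn.integrable_const_bound[where B=1])
  also have "\<dots> = complex_of_real (exp (- (\<Sum>j<m. (cmod (b j))\<^sup>2) / 4))"
    unfolding std_complex_normal_char
    by (simp add: exp_sum[symmetric] sum_negf sum_divide_distrib flip: of_real_prod)
  finally show ?thesis .
qed

context
  fixes M :: "'a measure" and f :: "real \<Rightarrow> 'a \<Rightarrow> complex" and r and \<rho> :: "real measure"
  assumes gp: "complex_gaussian_process M f" and st: "stationary_process M f"
    and r: "r = covariance_kernel M f" and sm: "spectral_measure \<rho> r"
begin

lemma gaussian_process_measurable: "f t \<in> borel_measurable M"
proof -
  have "complex_gaussian_vector M {t} f"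
    using gp unfolding complex_gaussian_process_def by blast
  then show ?thesis unfolding complex_gaussian_vector_def by blast
qed

text \<open>Stationarity moves the pair (t, s) to (t - s, 0). Working with the set of these times
  also covers t = s.\<close>

lemma gaussian_process_covariance: "(\<integral>\<omega>. f t \<omega> * cnj (f s \<omega>) \<partial>M) = r (t - s)"
proof -
  note [measurable] = gaussian_process_measurable
  let ?I = "{0, t - s}"
  have "(\<integral>x. x (t - s) * cnj (x 0) \<partial>distr M (Pi\<^sub>M ?I (\<lambda>_. borel)) (\<lambda>\<omega>. \<lambda>t\<in>?I. f (t + s) \<omega>)) =
    (\<integral>x. x (t - s) * cnj (x 0) \<partial>distr M (Pi\<^sub>M ?I (\<lambda>_. borel)) (\<lambda>\<omega>. \<lambda>t\<in>?I. f t \<omega>))"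
    using st by (simp add: stationary_process_def)
  moreover have "(\<lambda>x. x (t - s) * cnj (x 0)) \<in> borel_measurable (Pi\<^sub>M ?I (\<lambda>_. borel))"
    by (intro borel_measurable_times measurable_compose[OF _ borel_measurable_cnj] measurable_component_singleton) auto
  moreover have "(\<lambda>\<omega>. \<lambda>u\<in>?I. f (u + k) \<omega>) \<in> measurable M (Pi\<^sub>M ?I (\<lambda>_. borel))" for k
    by (intro measurable_restrict gaussian_process_measurable)
  from this[of s] this[of 0] calculation show ?thesis
    by (simp add: integral_distr r covariance_kernel_def)
qed

text \<open>The matrix in the definition depends on \<open>S\<close> and is not unique, but the
  characteristic function sees it only through the covariances. These are values of
  \<open>r\<close>, hence inner products of Fourier modes in L2(\<rho>), and the exponent becomes a
  squared norm there.\<close>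

lemma gaussian_process_char:
  assumes S: "finite S"
  shows "(\<integral>\<omega>. iexp (Re (\<Sum>t\<in>S. c t * f t \<omega>)) \<partial>M) =
     complex_of_real (exp (- (\<integral>l. (cmod (\<Sum>t\<in>S. c t * fourier_mode t l))\<^sup>2 \<partial>\<rho>) / 4))"
proof -
  note [measurable] = gaussian_process_measurable
  interpret rho: real_distribution \<rho> using sm by (simp add: spectral_measure_def)
  obtain m :: nat and A where law: "distr M (Pi\<^sub>M S (\<lambda>_. borel)) (\<lambda>\<omega>. \<lambda>i\<in>S. f i \<omega>) =
        distr (Pi\<^sub>M {..<m} (\<lambda>_. std_complex_normal)) (Pi\<^sub>M S (\<lambda>_. borel))
          (\<lambda>v. \<lambda>i\<in>S. \<Sum>j<m. A i j * v j)"
  proof -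
    have "complex_gaussian_vector M S f"
      using gp S unfolding complex_gaussian_process_def by blast
    then have "\<exists>(m::nat) A. distr M (Pi\<^sub>M S (\<lambda>_. borel)) (\<lambda>\<omega>. \<lambda>i\<in>S. f i \<omega>) =
        distr (Pi\<^sub>M {..<m} (\<lambda>_. std_complex_normal)) (Pi\<^sub>M S (\<lambda>_. borel))
          (\<lambda>v. \<lambda>i\<in>S. \<Sum>j<m. A i j * v j)"
      unfolding complex_gaussian_vector_def by (rule conjunct2)
    then show ?thesis by (elim exE) (rule that)
  qed
  define N where "N = Pi\<^sub>M {..<m::nat} (\<lambda>_. std_complex_normal)"
  have [measurable]: "(\<lambda>v. v j) \<in> borel_measurable N" if "j < m" for j
    using that measurable_component_singleton[of j "{..<m}" "\<lambda>_. std_complex_normal"] by (simp add: N_def cong: measurable_cong_sets)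
  have transfer: "(\<integral>\<omega>. g (\<lambda>i\<in>S. f i \<omega>) \<partial>M) = (\<integral>v. g (\<lambda>i\<in>S. \<Sum>j<m. A i j * v j) \<partial>N)"
    if "g \<in> borel_measurable (Pi\<^sub>M S (\<lambda>_. borel))" for g :: "_ \<Rightarrow> complex"
  proof -
    have m: "(\<lambda>\<omega>. \<lambda>i\<in>S. f i \<omega>) \<in> measurable M (Pi\<^sub>M S (\<lambda>_. borel))"
      "(\<lambda>v. \<lambda>i\<in>S. \<Sum>j<m. A i j * v j) \<in> measurable N (Pi\<^sub>M S (\<lambda>_. borel))"
      by measurable
    show ?thesis
      using integral_distr[OF m(1) that] integral_distr[OF m(2) that] law
      by (simp add: N_def)
  qed
  define b where "b j = (\<Sum>t\<in>S. c t * A t j)" for j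
  have sum: "(\<Sum>t\<in>S. c t * (\<Sum>j<m. A t j * v j)) = (\<Sum>j<m. b j * v j)" for v
    unfolding b_def sum_distrib_left sum_distrib_right by (subst sum.swap) (simp add: mult.assoc)
  have cov: "r (t - s) = (\<Sum>j<m. A t j * cnj (A s j))" if ts: "t \<in> S" "s \<in> S" for t s
  proof -
    have "r (t - s) = (\<integral>\<omega>. (\<lambda>x. x t * cnj (x s)) (\<lambda>i\<in>S. f i \<omega>) \<partial>M)"
      using ts by (simp add: gaussian_process_covariance)
    also have "\<dots> = (\<integral>v. (\<Sum>j<m. A t j * v j) * cnj (\<Sum>j<m. A s j * v j) \<partial>N)"
      using ts by (subst transfer) (auto intro!: borel_measurable_times measurable_compose[OF _ borel_measurable_cnj] simp: measurable_component_singleton)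
    also have "\<dots> = (\<integral>v. (\<Sum>j<m. \<Sum>k<m. A t j * cnj (A s k) * (v j * cnj (v k))) \<partial>N)"
      by (simp add: sum_product algebra_simps)
    also have "\<dots> = (\<Sum>j<m. \<Sum>k<m. A t j * cnj (A s k) * (\<integral>v. v j * cnj (v k) \<partial>N))"
    proof -
      have i: "integrable N (\<lambda>v. v j * cnj (v k))" if "j \<in> {..<m}" "k \<in> {..<m}" for j k
        using that prod_scn_moments(1)[of j m k] by (simp add: N_def)
      show ?thesis
        by (simp only: i Bochner_Integration.integral_sum Bochner_Integration.integrable_sum
            integrable_mult_right integral_mult_right_zero cong: sum.cong)
    qed
    also have "\<dots> = (\<Sum>j<m. \<Sum>k<m. if j = k then A t j * cnj (A s k) else 0)"
      using prod_scn_moments(2)[of _ m] by (intro sum.cong refl) (simp add: N_def)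
    also have "\<dots> = (\<Sum>j<m. A t j * cnj (A s j))" by simp
    finally show ?thesis .
  qed
  have rr: "r (t - s) = (\<integral>l. fourier_mode t l * cnj (fourier_mode s l) \<partial>\<rho>)" for t s
    using sm by (simp add: spectral_measure_def fourier_mode_mult_cnj) (simp add: fourier_mode_def)
  have int: "integrable \<rho> (\<lambda>l. fourier_mode t l * cnj (fourier_mode s l))" for t s
    by (rule rho.integrable_const_bound[where B=1]) (auto simp: norm_mult)
  have "complex_of_real (\<Sum>j<m. (cmod (b j))\<^sup>2) = (\<Sum>j<m. b j * cnj (b j))"
    by (simp add: complex_norm_square del: of_real_power)
  also have "\<dots> = (\<Sum>j<m. \<Sum>t\<in>S. \<Sum>s\<in>S. c t * cnj (c s) * (A t j * cnj (A s j)))"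
    by (simp add: b_def sum_product algebra_simps)
  also have "\<dots> = (\<Sum>t\<in>S. \<Sum>s\<in>S. \<Sum>j<m. c t * cnj (c s) * (A t j * cnj (A s j)))"
    by (subst sum.swap, intro sum.cong refl, subst sum.swap) simp
  also have "\<dots> = (\<Sum>t\<in>S. \<Sum>s\<in>S. c t * cnj (c s) * r (t - s))"
    by (intro sum.cong refl) (simp add: cov sum_distrib_left)
  also have "\<dots> = (\<integral>l. (\<Sum>t\<in>S. \<Sum>s\<in>S. c t * cnj (c s) * (fourier_mode t l * cnj (fourier_mode s l))) \<partial>\<rho>)"
    by (simp add: int rr)
  also have "\<dots> = (\<integral>l. complex_of_real ((cmod (\<Sum>t\<in>S. c t * fourier_mode t l))\<^sup>2) \<partial>\<rho>)"
    unfolding complex_norm_square by (simp add: sum_product algebra_simps)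
  finally have var: "(\<Sum>j<m. (cmod (b j))\<^sup>2) = (\<integral>l. (cmod (\<Sum>t\<in>S. c t * fourier_mode t l))\<^sup>2 \<partial>\<rho>)"
    by (simp del: of_real_power of_real_sum)
  have "(\<integral>\<omega>. iexp (Re (\<Sum>t\<in>S. c t * f t \<omega>)) \<partial>M) = (\<integral>\<omega>. (\<lambda>x. iexp (Re (\<Sum>t\<in>S. c t * x t))) (\<lambda>i\<in>S. f i \<omega>) \<partial>M)"
    by (simp cong: sum.cong)
  also have "\<dots> = (\<integral>v. iexp (Re (\<Sum>t\<in>S. c t * (\<Sum>j<m. A t j * v j))) \<partial>N)"
    by (subst transfer) (auto cong: sum.cong)
  also have "\<dots> = complex_of_real (exp (- (\<Sum>j<m. (cmod (b j))\<^sup>2) / 4))"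
    unfolding sum N_def by (rule prod_scn_char)
  finally show ?thesis unfolding var .
qed

end

text \<open>Rounding time down to multiples of 1/(n+1) leaves countably many values of the time
  variable, so the rounded process is jointly measurable; continuity of paths passes to the limit.
  Joint measurability is what every exchange of time and probability rests on.\<close>

lemma continuous_paths_measurable:
  fixes F :: "real \<Rightarrow> 'a \<Rightarrow> complex"
  assumes [measurable]: "\<And>t. F t \<in> borel_measurable M" and cont: "\<And>\<omega>. continuous_on UNIV (\<lambda>t. F t \<omega>)"
  shows "(\<lambda>p. F (fst p) (snd p)) \<in> borel_measurable (borel \<Otimes>\<^sub>M M)"
proof (rule borel_measurable_LIMSEQ_metric)
  fix n :: nat
  show "(\<lambda>p. F (real_of_int \<lfloor>fst p * real (Suc n)\<rfloor> / real (Suc n)) (snd p)) \<in> borel_measurable (borel \<Otimes>\<^sub>M M)"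
  proof -
    have 1: "(\<lambda>p. F (real_of_int k / real (Suc n)) (snd p)) \<in> borel_measurable (borel \<Otimes>\<^sub>M M)" for k
      by (rule measurable_compose[OF measurable_snd]) simp
    have 2: "(\<lambda>p. \<lfloor>fst p * real (Suc n)\<rfloor>) \<in> (borel :: real measure) \<Otimes>\<^sub>M M \<rightarrow>\<^sub>M count_space UNIV"
      by (rule measurable_compose[where N=borel, OF _ measurable_real_floor]) measurable
    show ?thesis
      using measurable_compose_countable[OF 1 2] by simp
  qed
next
  fix p :: "real \<times> 'a"
  have "(\<lambda>n. real_of_int \<lfloor>fst p * real (Suc n)\<rfloor> / real (Suc n)) \<longlonglongrightarrow> fst p"
  proof (rule LIM_zero_cancel, rule Lim_null_comparison)
    show "\<forall>\<^sub>F n in sequentially. norm (real_of_int \<lfloor>fst p * real (Suc n)\<rfloor> / real (Suc n) - fst p) \<le> inverse (real (Suc n))"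
    proof (intro always_eventually allI)
      fix n
      have "norm (real_of_int \<lfloor>fst p * real (Suc n)\<rfloor> / real (Suc n) - fst p) = \<bar>real_of_int \<lfloor>fst p * real (Suc n)\<rfloor> - fst p * real (Suc n)\<bar> / real (Suc n)"
      proof -
        have eq: "real_of_int \<lfloor>fst p * real (Suc n)\<rfloor> / real (Suc n) - fst p =
            (real_of_int \<lfloor>fst p * real (Suc n)\<rfloor> - fst p * real (Suc n)) / real (Suc n)"
          by (simp add: diff_divide_distrib del: of_nat_Suc)
        show ?thesis by (simp only: eq real_norm_def abs_divide abs_of_nat)
      qed
      also have "\<dots> \<le> 1 / Suc n"
        by (intro divide_right_mono) linarith+
      finally show "norm (real_of_int \<lfloor>fst p * real (Suc n)\<rfloor> / real (Suc n) - fst p) \<le> inverse (real (Suc n))"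
        by (simp add: divide_inverse)
    qed
    show "(\<lambda>n. inverse (real (Suc n))) \<longlonglongrightarrow> 0" by (rule LIMSEQ_inverse_real_of_nat)
  qed
  then show "(\<lambda>n. F (real_of_int \<lfloor>fst p * real (Suc n)\<rfloor> / real (Suc n)) (snd p)) \<longlonglongrightarrow> F (fst p) (snd p)"
    using cont[of "snd p"] by (auto simp: continuous_on_eq_continuous_at intro: isCont_tendsto_compose)
qed

text \<open>Continuity is asked of every path; the final proof reaches this by a modification on a
  null set. The Gaussian, stationarity and covariance assumptions enter only as the characteristic
  functions of finite combinations, with r 0 = 1 hidden in \<rho> being a probability measure. The
  logarithm appears to the first power, the form matched by the sum over dyadic scales.\<close>

locale stationary_gaussian = prob_space M + rho: real_distribution \<rho>
  for M :: "'a measure" and \<rho> :: "real measure" +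
  fixes F :: "real \<Rightarrow> 'a \<Rightarrow> complex"
  assumes F_measurable[measurable]: "(\<lambda>p. F (fst p) (snd p)) \<in> borel_measurable (borel \<Otimes>\<^sub>M M)"
    and F_cont: "\<And>\<omega>. continuous_on UNIV (\<lambda>t. F t \<omega>)"
    and F_char: "\<And>S c. finite S \<Longrightarrow> expectation (\<lambda>\<omega>. iexp (Re (\<Sum>t\<in>S. c t * F t \<omega>))) =
       complex_of_real (exp (- (\<integral>l. (cmod (\<Sum>t\<in>S. c t * fourier_mode t l))\<^sup>2 \<partial>\<rho>) / 4))"
    and log_moment: "integrable \<rho> (\<lambda>l. l\<^sup>2 * (1 + ln (1 + \<bar>l\<bar>)))"
    and no_atoms: "\<And>x. measure \<rho> {x} = 0"

section \<open>The Gaussian Hilbert space and its spectral representation\<close>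

definition square_integrable :: "'a measure \<Rightarrow> ('a \<Rightarrow> complex) \<Rightarrow> bool" where
  "square_integrable M \<phi> \<longleftrightarrow> \<phi> \<in> borel_measurable M \<and> integrable M (\<lambda>x. (cmod (\<phi> x))\<^sup>2)"

lemma square_integrableD:
  assumes "square_integrable M \<phi>"
  shows "\<phi> \<in> borel_measurable M" "integrable M (\<lambda>x. (cmod (\<phi> x))\<^sup>2)"
  using assms by (auto simp: square_integrable_def)

lemma cmod_lincomb_sq:
  "(cmod (a * x + b * y))\<^sup>2 \<le> 2 * (cmod a)\<^sup>2 * (cmod x)\<^sup>2 + 2 * (cmod b)\<^sup>2 * (cmod y)\<^sup>2"
proof -
  have "(cmod (a * x + b * y))\<^sup>2 \<le> (cmod (a * x) + cmod (b * y))\<^sup>2"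
    by (intro power_mono norm_triangle_ineq) simp
  also have "\<dots> \<le> 2 * (cmod (a * x))\<^sup>2 + 2 * (cmod (b * y))\<^sup>2"
    using zero_le_power2[of "cmod (a * x) - cmod (b * y)"] by (simp add: power2_eq_square algebra_simps)
  finally show ?thesis by (simp add: norm_mult power_mult_distrib)
qed

lemma square_integrable_lincomb:
  assumes "square_integrable M \<phi>" "square_integrable M \<psi>"
  shows "square_integrable M (\<lambda>x. a * \<phi> x + b * \<psi> x)"
    and "(\<integral>x. (cmod (a * \<phi> x + b * \<psi> x))\<^sup>2 \<partial>M) \<le>
      2 * (cmod a)\<^sup>2 * (\<integral>x. (cmod (\<phi> x))\<^sup>2 \<partial>M) + 2 * (cmod b)\<^sup>2 * (\<integral>x. (cmod (\<psi> x))\<^sup>2 \<partial>M)"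
proof -
  note [measurable] = square_integrableD(1)[OF assms(1)] square_integrableD(1)[OF assms(2)]
  note i = square_integrableD(2)[OF assms(1)] square_integrableD(2)[OF assms(2)]
  have i2: "integrable M (\<lambda>x. 2 * (cmod a)\<^sup>2 * (cmod (\<phi> x))\<^sup>2 + 2 * (cmod b)\<^sup>2 * (cmod (\<psi> x))\<^sup>2)"
    using i by auto
  have i3: "integrable M (\<lambda>x. (cmod (a * \<phi> x + b * \<psi> x))\<^sup>2)"
    by (rule Bochner_Integration.integrable_bound[OF i2]) (auto simp: cmod_lincomb_sq)
  then show "square_integrable M (\<lambda>x. a * \<phi> x + b * \<psi> x)" by (simp add: square_integrable_def)
  have "(\<integral>x. (cmod (a * \<phi> x + b * \<psi> x))\<^sup>2 \<partial>M) \<le> (\<integral>x. 2 * (cmod a)\<^sup>2 * (cmod (\<phi> x))\<^sup>2 + 2 * (cmod b)\<^sup>2 * (cmod (\<psi> x))\<^sup>2 \<partial>M)"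
    by (intro integral_mono i2 i3 cmod_lincomb_sq)
  then show "(\<integral>x. (cmod (a * \<phi> x + b * \<psi> x))\<^sup>2 \<partial>M) \<le>
      2 * (cmod a)\<^sup>2 * (\<integral>x. (cmod (\<phi> x))\<^sup>2 \<partial>M) + 2 * (cmod b)\<^sup>2 * (\<integral>x. (cmod (\<psi> x))\<^sup>2 \<partial>M)"
    using i by simp
qed

lemma square_integrable_mult:
  assumes "square_integrable M \<phi>" "square_integrable M \<psi>"
  shows "integrable M (\<lambda>x. \<phi> x * \<psi> x)" "integrable M (\<lambda>x. \<phi> x * cnj (\<psi> x))"
proof -
  note [measurable] = square_integrableD(1)[OF assms(1)] square_integrableD(1)[OF assms(2)]
  have i: "integrable M (\<lambda>x. (cmod (\<phi> x))\<^sup>2 + (cmod (\<psi> x))\<^sup>2)"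
    using square_integrableD(2)[OF assms(1)] square_integrableD(2)[OF assms(2)] by auto
  have le: "cmod x * cmod y \<le> (cmod x)\<^sup>2 + (cmod y)\<^sup>2" for x y
    using sum_squares_bound[of "cmod x" "cmod y"] mult_nonneg_nonneg[OF norm_ge_zero norm_ge_zero, of x y] by linarith
  show "integrable M (\<lambda>x. \<phi> x * \<psi> x)" "integrable M (\<lambda>x. \<phi> x * cnj (\<psi> x))"
    by (rule Bochner_Integration.integrable_bound[OF i], simp, auto simp: norm_mult le)+
qed

text \<open>Continuity of the L2 norm, obtained from 2 a b \<le> a^2 / e + e b^2 with a weight
  \<open>e n\<close> that shrinks slowly enough for both terms to vanish.\<close>

lemma square_integrable_norm_tendsto:
  fixes \<phi> :: "'a \<Rightarrow> complex"
  assumes n: "\<And>n. square_integrable M (\<phi>n n)" and p: "square_integrable M \<phi>"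
    and lim: "(\<lambda>n. \<integral>x. (cmod (\<phi>n n x - \<phi> x))\<^sup>2 \<partial>M) \<longlonglongrightarrow> 0"
  shows "(\<lambda>n. \<integral>x. (cmod (\<phi>n n x))\<^sup>2 \<partial>M) \<longlonglongrightarrow> (\<integral>x. (cmod (\<phi> x))\<^sup>2 \<partial>M)"
proof -
  define d where "d n = (\<integral>x. (cmod (\<phi>n n x - \<phi> x))\<^sup>2 \<partial>M)" for n
  \<comment> \<open>The added 1/(n+1) keeps the weight positive when the distance is 0; being at
    least sqrt (d n), it gives d n / e n \<le> sqrt (d n).\<close>
  define e where "e n = sqrt (d n) + inverse (real (Suc n))" for n
  let ?N = "\<integral>x. (cmod (\<phi> x))\<^sup>2 \<partial>M"
  have d0: "d n \<ge> 0" for n unfolding d_def by simp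
  have e0: "e n > 0" for n unfolding e_def using d0 by (intro add_nonneg_pos) auto
  have dl: "d \<longlonglongrightarrow> 0" using lim unfolding d_def .
  have sl: "(\<lambda>n. sqrt (d n)) \<longlonglongrightarrow> 0" using tendsto_real_sqrt[OF dl] by simp
  have el: "e \<longlonglongrightarrow> 0" unfolding e_def using tendsto_add[OF sl LIMSEQ_inverse_real_of_nat] by simp
  have bound: "\<bar>(\<integral>x. (cmod (\<phi>n n x))\<^sup>2 \<partial>M) - ?N\<bar> \<le> d n + sqrt (d n) + e n * ?N" for n
  proof -
    have sd: "square_integrable M (\<lambda>x. \<phi>n n x - \<phi> x)"
      using square_integrable_lincomb(1)[OF n p, of 1 n "-1"] by simp
    have i1: "integrable M (\<lambda>x. (1 + 1 / e n) * (cmod (\<phi>n n x - \<phi> x))\<^sup>2 + e n * (cmod (\<phi> x))\<^sup>2)"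
      using square_integrableD(2)[OF sd] square_integrableD(2)[OF p] by auto
    have pt: "\<bar>(cmod x)\<^sup>2 - (cmod y)\<^sup>2\<bar> \<le> (1 + 1 / e n) * (cmod (x - y))\<^sup>2 + e n * (cmod y)\<^sup>2" for x y
    proof -
      define a b where "a = cmod (x - y)" and "b = cmod y"
      have "cmod x \<le> b + a" "b \<le> cmod x + a" unfolding a_def b_def
        using norm_triangle_sub[of x y] norm_triangle_sub[of y x] by (auto simp: norm_minus_commute)
      then have "\<bar>cmod x - b\<bar> \<le> a" "cmod x + b \<le> 2 * b + a" by auto
      then have "\<bar>cmod x - b\<bar> * (cmod x + b) \<le> a * (2 * b + a)"
        by (intro mult_mono) (auto simp: a_def b_def)
      then have 1: "\<bar>(cmod x)\<^sup>2 - b\<^sup>2\<bar> \<le> a * (2 * b + a)"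
        by (simp add: power2_eq_square square_diff_square_factored abs_mult b_def mult.commute)
      have "0 \<le> (a - e n * b)\<^sup>2 / e n" using e0[of n] by simp
      also have "\<dots> = a\<^sup>2 / e n - 2 * a * b + e n * b\<^sup>2"
        using e0[of n] by (simp add: field_simps power2_eq_square)
      finally show ?thesis using 1 by (simp add: a_def[symmetric] b_def[symmetric] algebra_simps power2_eq_square)
    qed
    have "\<bar>(\<integral>x. (cmod (\<phi>n n x))\<^sup>2 \<partial>M) - ?N\<bar> = \<bar>\<integral>x. (cmod (\<phi>n n x))\<^sup>2 - (cmod (\<phi> x))\<^sup>2 \<partial>M\<bar>"
      using square_integrableD(2)[OF n[of n]] square_integrableD(2)[OF p] by simp
    also have "\<dots> \<le> (\<integral>x. \<bar>(cmod (\<phi>n n x))\<^sup>2 - (cmod (\<phi> x))\<^sup>2\<bar> \<partial>M)"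
      by (rule integral_abs_bound)
    also have "\<dots> \<le> (\<integral>x. (1 + 1 / e n) * (cmod (\<phi>n n x - \<phi> x))\<^sup>2 + e n * (cmod (\<phi> x))\<^sup>2 \<partial>M)"
      using square_integrableD(2)[OF n[of n]] square_integrableD(2)[OF p]
      by (intro integral_mono i1 pt) auto
    also have "\<dots> = (1 + 1 / e n) * d n + e n * ?N"
      using square_integrableD(2)[OF sd] square_integrableD(2)[OF p] by (simp add: d_def)
    also have "d n / e n \<le> sqrt (d n)"
    proof -
      have "d n = sqrt (d n) * sqrt (d n)" using d0 by simp
      also have "\<dots> \<le> sqrt (d n) * e n" using d0 by (intro mult_left_mono) (auto simp: e_def)
      finally show ?thesis using e0[of n] by (simp add: divide_simps)
    qed
    then have "(1 + 1 / e n) * d n + e n * ?N \<le> d n + sqrt (d n) + e n * ?N" by (simp add: distrib_right)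
    finally show ?thesis .
  qed
  have "(\<lambda>n. d n + sqrt (d n) + e n * ?N) \<longlonglongrightarrow> 0"
    using tendsto_add[OF tendsto_add[OF dl sl] tendsto_mult_right[OF el, of ?N]] by simp
  then have "(\<lambda>n. (\<integral>x. (cmod (\<phi>n n x))\<^sup>2 \<partial>M) - ?N) \<longlonglongrightarrow> 0"
    by (rule Lim_null_comparison[rotated]) (rule always_eventually, simp only: real_norm_def bound, simp)
  then show ?thesis by (rule LIM_zero_cancel)
qed

section \<open>The spectral isometry, laws and independence of represented variables\<close>

context stationary_gaussian
begin

definition mode_combination :: "('a \<Rightarrow> complex) \<Rightarrow> (real \<Rightarrow> complex) \<Rightarrow> bool" where
  "mode_combination X \<phi> \<longleftrightarrow> (\<exists>S c. finite S \<and> X = (\<lambda>\<omega>. \<Sum>t\<in>S. c t * F t \<omega>) \<and> \<phi> = (\<lambda>l. \<Sum>t\<in>S. c t * fourier_mode t l))"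

text \<open>The graph of the spectral isometry on the closed span of the process, kept as a relation
  so that well-definedness never has to be shown. Variables are approximated almost surely and
  symbols in L2(\<rho>): exactly what is needed to pass to the limit on the two sides of the
  characteristic function formula.\<close>

definition represents :: "('a \<Rightarrow> complex) \<Rightarrow> (real \<Rightarrow> complex) \<Rightarrow> bool" where
  "represents X \<phi> \<longleftrightarrow> X \<in> borel_measurable M \<and> square_integrable \<rho> \<phi> \<and>
     (\<exists>Xn \<phi>n. (\<forall>n. mode_combination (Xn n) (\<phi>n n)) \<and> (AE \<omega> in M. (\<lambda>n. Xn n \<omega>) \<longlonglongrightarrow> X \<omega>) \<and>
        (\<lambda>n. \<integral>l. (cmod (\<phi>n n l - \<phi> l))\<^sup>2 \<partial>\<rho>) \<longlonglongrightarrow> 0)"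

lemma F_measurable'[measurable]: "F t \<in> borel_measurable M"
  using measurable_compose[OF measurable_Pair1' F_measurable, of t] by simp

lemma mode_combination_F: "mode_combination (F t) (fourier_mode t)"
  unfolding mode_combination_def by (rule exI[of _ "{t}"], rule exI[of _ "\<lambda>_. 1"]) simp

lemma mode_combination_lincomb:
  assumes "mode_combination X \<phi>" "mode_combination Y \<psi>"
  shows "mode_combination (\<lambda>\<omega>. a * X \<omega> + b * Y \<omega>) (\<lambda>l. a * \<phi> l + b * \<psi> l)"
proof -
  obtain S c where S: "finite S" "X = (\<lambda>\<omega>. \<Sum>t\<in>S. c t * F t \<omega>)" "\<phi> = (\<lambda>l. \<Sum>t\<in>S. c t * fourier_mode t l)"
    using assms by (auto simp: mode_combination_def)
  obtain R d where R: "finite R" "Y = (\<lambda>\<omega>. \<Sum>t\<in>R. d t * F t \<omega>)" "\<psi> = (\<lambda>l. \<Sum>t\<in>R. d t * fourier_mode t l)"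
    using assms by (auto simp: mode_combination_def)
  define e where "e t = a * (if t \<in> S then c t else 0) + b * (if t \<in> R then d t else 0)" for t
  have "(\<Sum>t\<in>S \<union> R. e t * g t) = a * (\<Sum>t\<in>S. c t * g t) + b * (\<Sum>t\<in>R. d t * g t)" for g
  proof -
    have "(\<Sum>t\<in>S. c t * g t) = (\<Sum>t\<in>S \<union> R. (if t \<in> S then c t else 0) * g t)"
      using S(1) R(1) by (intro sum.mono_neutral_cong_left) auto
    moreover have "(\<Sum>t\<in>R. d t * g t) = (\<Sum>t\<in>S \<union> R. (if t \<in> R then d t else 0) * g t)"
      using S(1) R(1) by (intro sum.mono_neutral_cong_left) auto
    ultimately show ?thesis
      by (simp only: e_def distrib_right sum.distrib sum_distrib_left mult.assoc)
  qed
  then show ?thesis unfolding mode_combination_def using S R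
    by (intro exI[of _ "S \<union> R"] exI[of _ e]) simp
qed

lemma mode_combinationD:
  assumes "mode_combination X \<phi>"
  shows "X \<in> borel_measurable M" "square_integrable \<rho> \<phi>"
    "expectation (\<lambda>\<omega>. iexp (Re (X \<omega>))) = complex_of_real (exp (- (\<integral>l. (cmod (\<phi> l))\<^sup>2 \<partial>\<rho>) / 4))"
proof -
  obtain S c where S: "finite S" "X = (\<lambda>\<omega>. \<Sum>t\<in>S. c t * F t \<omega>)" "\<phi> = (\<lambda>l. \<Sum>t\<in>S. c t * fourier_mode t l)"
    using assms by (auto simp: mode_combination_def)
  show "X \<in> borel_measurable M" unfolding S by measurable
  show "expectation (\<lambda>\<omega>. iexp (Re (X \<omega>))) = complex_of_real (exp (- (\<integral>l. (cmod (\<phi> l))\<^sup>2 \<partial>\<rho>) / 4))"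
    unfolding S by (rule F_char[OF S(1)])
  have b: "cmod (\<phi> l) \<le> (\<Sum>t\<in>S. cmod (c t))" for l
    unfolding S by (rule order_trans[OF norm_sum]) (simp add: norm_mult)
  have [measurable]: "\<phi> \<in> borel_measurable borel" unfolding S by measurable
  have "integrable \<rho> (\<lambda>l. (cmod (\<phi> l))\<^sup>2)"
    by (rule rho.integrable_const_bound[where B="(\<Sum>t\<in>S. cmod (c t))\<^sup>2"]) (auto intro!: power_mono b)
  then show "square_integrable \<rho> \<phi>" by (simp add: square_integrable_def)
qed

lemma represents_mode_combination: "mode_combination X \<phi> \<Longrightarrow> represents X \<phi>"
  unfolding represents_def using mode_combinationD[of X \<phi>]
  by (intro conjI exI[of _ "\<lambda>_. X"] exI[of _ "\<lambda>_. \<phi>"]) auto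

lemma represents_F: "represents (F t) (fourier_mode t)"
  by (intro represents_mode_combination mode_combination_F)

lemma representsD:
  assumes "represents X \<phi>"
  shows "X \<in> borel_measurable M" "square_integrable \<rho> \<phi>"
  using assms by (auto simp: represents_def)

lemma represents_lincomb:
  assumes X: "represents X \<phi>" and Y: "represents Y \<psi>"
  shows "represents (\<lambda>\<omega>. a * X \<omega> + b * Y \<omega>) (\<lambda>l. a * \<phi> l + b * \<psi> l)"
proof -
  note [measurable] = representsD(1)[OF X] representsD(1)[OF Y]
  obtain Xn \<phi>n where Xn: "\<And>n. mode_combination (Xn n) (\<phi>n n)" "AE \<omega> in M. (\<lambda>n. Xn n \<omega>) \<longlonglongrightarrow> X \<omega>"
    "(\<lambda>n. \<integral>l. (cmod (\<phi>n n l - \<phi> l))\<^sup>2 \<partial>\<rho>) \<longlonglongrightarrow> 0"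
    using X by (auto simp: represents_def)
  obtain Yn \<psi>n where Yn: "\<And>n. mode_combination (Yn n) (\<psi>n n)" "AE \<omega> in M. (\<lambda>n. Yn n \<omega>) \<longlonglongrightarrow> Y \<omega>"
    "(\<lambda>n. \<integral>l. (cmod (\<psi>n n l - \<psi> l))\<^sup>2 \<partial>\<rho>) \<longlonglongrightarrow> 0"
    using Y by (auto simp: represents_def)
  have sq: "square_integrable \<rho> (\<lambda>l. \<phi>n n l - \<phi> l)" "square_integrable \<rho> (\<lambda>l. \<psi>n n l - \<psi> l)" for n
    using square_integrable_lincomb(1)[OF mode_combinationD(2)[OF Xn(1)[of n]] representsD(2)[OF X], of 1 "-1"]
      square_integrable_lincomb(1)[OF mode_combinationD(2)[OF Yn(1)[of n]] representsD(2)[OF Y], of 1 "-1"] by auto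
  have "(\<lambda>n. 2 * (cmod a)\<^sup>2 * (\<integral>l. (cmod (\<phi>n n l - \<phi> l))\<^sup>2 \<partial>\<rho>) + 2 * (cmod b)\<^sup>2 * (\<integral>l. (cmod (\<psi>n n l - \<psi> l))\<^sup>2 \<partial>\<rho>)) \<longlonglongrightarrow>
     2 * (cmod a)\<^sup>2 * 0 + 2 * (cmod b)\<^sup>2 * 0"
    by (intro tendsto_intros Xn Yn)
  then have "(\<lambda>n. 2 * (cmod a)\<^sup>2 * (\<integral>l. (cmod (\<phi>n n l - \<phi> l))\<^sup>2 \<partial>\<rho>) + 2 * (cmod b)\<^sup>2 * (\<integral>l. (cmod (\<psi>n n l - \<psi> l))\<^sup>2 \<partial>\<rho>)) \<longlonglongrightarrow> 0"
    by simp
  then have "(\<lambda>n. \<integral>l. (cmod (a * (\<phi>n n l - \<phi> l) + b * (\<psi>n n l - \<psi> l)))\<^sup>2 \<partial>\<rho>) \<longlonglongrightarrow> 0"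
    by (rule Lim_null_comparison[rotated])
      (rule always_eventually, simp only: real_norm_def abs_of_nonneg[OF Bochner_Integration.integral_nonneg] zero_le_power2 square_integrable_lincomb(2)[OF sq], simp)
  then have "(\<lambda>n. \<integral>l. (cmod ((a * \<phi>n n l + b * \<psi>n n l) - (a * \<phi> l + b * \<psi> l)))\<^sup>2 \<partial>\<rho>) \<longlonglongrightarrow> 0"
    by (simp add: algebra_simps)
  moreover have "AE \<omega> in M. (\<lambda>n. a * Xn n \<omega> + b * Yn n \<omega>) \<longlonglongrightarrow> a * X \<omega> + b * Y \<omega>"
    using Xn(2) Yn(2) by eventually_elim (intro tendsto_intros)
  ultimately show ?thesis
    unfolding represents_def using square_integrable_lincomb(1)[OF representsD(2)[OF X] representsD(2)[OF Y]]
    by (intro conjI exI[of _ "\<lambda>n \<omega>. a * Xn n \<omega> + b * Yn n \<omega>"] exI[of _ "\<lambda>n l. a * \<phi>n n l + b * \<psi>n n l"])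
      (auto intro: mode_combination_lincomb Xn Yn)
qed

lemma represents_scale: "represents X \<phi> \<Longrightarrow> represents (\<lambda>\<omega>. a * X \<omega>) (\<lambda>l. a * \<phi> l)"
  using represents_lincomb[of X \<phi> X \<phi> a 0] by simp

text \<open>Almost sure convergence goes through the bounded function \<open>iexp\<close> by
  dominated convergence, and L2 convergence of the symbols gives the limit of the exponents.\<close>

lemma represents_char:
  assumes "represents X \<phi>"
  shows "expectation (\<lambda>\<omega>. iexp (Re (X \<omega>))) = complex_of_real (exp (- (\<integral>l. (cmod (\<phi> l))\<^sup>2 \<partial>\<rho>) / 4))"
proof -
  note [measurable] = representsD(1)[OF assms]
  obtain Xn \<phi>n where Xn: "\<And>n. mode_combination (Xn n) (\<phi>n n)" "AE \<omega> in M. (\<lambda>n. Xn n \<omega>) \<longlonglongrightarrow> X \<omega>"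
    "(\<lambda>n. \<integral>l. (cmod (\<phi>n n l - \<phi> l))\<^sup>2 \<partial>\<rho>) \<longlonglongrightarrow> 0"
    using assms by (auto simp: represents_def)
  note [measurable] = mode_combinationD(1)[OF Xn(1)]
  have lim: "(\<lambda>n. expectation (\<lambda>\<omega>. iexp (Re (Xn n \<omega>)))) \<longlonglongrightarrow> expectation (\<lambda>\<omega>. iexp (Re (X \<omega>)))"
  proof (rule integral_dominated_convergence[where w="\<lambda>_. 1"])
    show "AE \<omega> in M. (\<lambda>n. iexp (Re (Xn n \<omega>))) \<longlonglongrightarrow> iexp (Re (X \<omega>))"
      using Xn(2) by eventually_elim (intro tendsto_intros)
  qed auto
  have lim2: "(\<lambda>n. expectation (\<lambda>\<omega>. iexp (Re (Xn n \<omega>)))) \<longlonglongrightarrow> complex_of_real (exp (- (\<integral>l. (cmod (\<phi> l))\<^sup>2 \<partial>\<rho>) / 4))"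
    unfolding mode_combinationD(3)[OF Xn(1)]
    using square_integrable_norm_tendsto[OF mode_combinationD(2)[OF Xn(1)] representsD(2)[OF assms] Xn(3)]
    by (intro tendsto_intros) auto
  show ?thesis by (rule LIMSEQ_unique[OF lim lim2])
qed

text \<open>Scaling \<open>X\<close> by \<open>cnj u\<close> turns \<open>represents_char\<close>
  into the full characteristic function in the plane: \<open>X\<close> is circular Gaussian with
  variance the squared norm of its symbol, and all its moments follow.\<close>

lemma represents_law:
  assumes "represents X \<phi>"
  shows "distr M borel X = distr std_complex_normal borel (\<lambda>z. complex_of_real (sqrt (\<integral>l. (cmod (\<phi> l))\<^sup>2 \<partial>\<rho>)) * z)"
proof (rule char_unique)
  note [measurable] = representsD(1)[OF assms]
  let ?n = "\<integral>l. (cmod (\<phi> l))\<^sup>2 \<partial>\<rho>"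
  show "prob_space (distr M borel X)" by (rule prob_space_distr) simp
  show "prob_space (distr std_complex_normal borel (\<lambda>z. complex_of_real (sqrt ?n) * z))"
    by (rule scn.prob_space_distr) simp
  fix u
  have "(\<integral>x. iexp (u \<bullet> x) \<partial>distr M borel X) = expectation (\<lambda>\<omega>. iexp (Re (cnj u * X \<omega>)))"
    by (simp add: integral_distr inner_complex_def)
  also have "\<dots> = complex_of_real (exp (- (cmod u)\<^sup>2 * ?n / 4))"
    using represents_char[OF represents_scale[OF assms, of "cnj u"]]
    by (simp add: norm_mult power_mult_distrib)
  also have "\<dots> = (\<integral>z. iexp (Re ((cnj u * complex_of_real (sqrt ?n)) * z)) \<partial>std_complex_normal)"
    unfolding std_complex_normal_char by (simp add: norm_mult power_mult_distrib)
  also have "\<dots> = (\<integral>x. iexp (u \<bullet> x) \<partial>distr std_complex_normal borel (\<lambda>z. complex_of_real (sqrt ?n) * z))"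
    by (simp add: integral_distr inner_complex_def algebra_simps)
  finally show "(\<integral>x. iexp (u \<bullet> x) \<partial>distr M borel X) = \<dots>" .
qed auto

lemma represents_nn_integral:
  assumes X: "represents X \<phi>" and [measurable]: "g \<in> borel_measurable borel"
  shows "(\<integral>\<^sup>+\<omega>. g (X \<omega>) \<partial>M) = (\<integral>\<^sup>+z. g (complex_of_real (sqrt (\<integral>l. (cmod (\<phi> l))\<^sup>2 \<partial>\<rho>)) * z) \<partial>std_complex_normal)"
  using arg_cong[OF represents_law[OF X], of "\<lambda>N. \<integral>\<^sup>+x. g x \<partial>N"] representsD(1)[OF X]
  by (simp add: nn_integral_distr)

lemma represents_integral:
  fixes g :: "complex \<Rightarrow> 'b::{banach, second_countable_topology}"
  assumes X: "represents X \<phi>" and [measurable]: "g \<in> borel_measurable borel"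
  shows "(\<integral>\<omega>. g (X \<omega>) \<partial>M) = (\<integral>z. g (complex_of_real (sqrt (\<integral>l. (cmod (\<phi> l))\<^sup>2 \<partial>\<rho>)) * z) \<partial>std_complex_normal)"
    "integrable M (\<lambda>\<omega>. g (X \<omega>)) \<longleftrightarrow> integrable std_complex_normal (\<lambda>z. g (complex_of_real (sqrt (\<integral>l. (cmod (\<phi> l))\<^sup>2 \<partial>\<rho>)) * z))"
  using arg_cong[OF represents_law[OF X], of "\<lambda>N. \<integral>x. g x \<partial>N"]
    arg_cong[OF represents_law[OF X], of "\<lambda>N. integrable N g"] representsD(1)[OF X]
  by (simp_all add: integral_distr integrable_distr_eq)

lemma represents_moment:
  assumes X: "represents X \<phi>"
  shows "integrable M (\<lambda>\<omega>. (cmod (X \<omega>)) ^ (2 * k))"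
    "expectation (\<lambda>\<omega>. (cmod (X \<omega>)) ^ (2 * k)) = (\<integral>l. (cmod (\<phi> l))\<^sup>2 \<partial>\<rho>) ^ k * (\<integral>z. (cmod z) ^ (2 * k) \<partial>std_complex_normal)"
  using represents_integral[OF X, of "\<lambda>z. (cmod z) ^ (2 * k)"] integrable_std_complex_normal_moment[of k]
  by (simp_all add: norm_mult power_mult_distrib power_mult[of "sqrt _"])

lemma represents_moments:
  assumes X: "represents X \<phi>"
  shows "square_integrable M X" "expectation (\<lambda>\<omega>. (cmod (X \<omega>))\<^sup>2) = (\<integral>l. (cmod (\<phi> l))\<^sup>2 \<partial>\<rho>)"
    "expectation X = 0" "expectation (\<lambda>\<omega>. (X \<omega>)\<^sup>2) = 0"
  using represents_moment[OF X, of 1] representsD(1)[OF X]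
    represents_integral(1)[OF X, of "\<lambda>z. z"] represents_integral(1)[OF X, of "\<lambda>z. z\<^sup>2"]
  by (auto simp: square_integrable_def integral_std_complex_normal power_mult_distrib)

lemma polarization:
  "x * cnj y = complex_of_real ((cmod (1 * x + 1 * y))\<^sup>2 / 4) - complex_of_real ((cmod (1 * x + (-1) * y))\<^sup>2 / 4)
     + \<i> * complex_of_real ((cmod (1 * x + \<i> * y))\<^sup>2 / 4) - \<i> * complex_of_real ((cmod (1 * x + (-\<i>) * y))\<^sup>2 / 4)"
  by (simp add: complex_eq_iff cmod_power2, simp add: power2_eq_square field_simps)

text \<open>Polarization reduces both claims to single linear combinations: the mean of the squared
  modulus is a squared norm of symbols, while the mean of the square vanishes by circular
  symmetry.\<close>

lemma represents_covariance:
  assumes X: "represents X \<phi>" and Y: "represents Y \<psi>"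
  shows "expectation (\<lambda>\<omega>. X \<omega> * cnj (Y \<omega>)) = (\<integral>l. \<phi> l * cnj (\<psi> l) \<partial>\<rho>)"
    "expectation (\<lambda>\<omega>. X \<omega> * Y \<omega>) = 0"
proof -
  note XY = represents_lincomb[OF X Y, of 1]
  have sp: "integrable M (\<lambda>\<omega>. (cmod (1 * X \<omega> + b * Y \<omega>))\<^sup>2)" "integrable \<rho> (\<lambda>l. (cmod (1 * \<phi> l + b * \<psi> l))\<^sup>2)" for b
    using square_integrableD(2)[OF represents_moments(1)[OF XY[of b]]] square_integrableD(2)[OF representsD(2)[OF XY[of b]]] by auto
  show "expectation (\<lambda>\<omega>. X \<omega> * cnj (Y \<omega>)) = (\<integral>l. \<phi> l * cnj (\<psi> l) \<partial>\<rho>)"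
  proof -
    have 1: "integrable M (\<lambda>\<omega>. complex_of_real ((cmod (1 * X \<omega> + b * Y \<omega>))\<^sup>2 / 4))"
      "integrable \<rho> (\<lambda>l. complex_of_real ((cmod (1 * \<phi> l + b * \<psi> l))\<^sup>2 / 4))" for b
      using sp[of b] by (intro integrable_of_real integrable_divide_zero; simp)+
    have 2: "expectation (\<lambda>\<omega>. complex_of_real ((cmod (1 * X \<omega> + b * Y \<omega>))\<^sup>2 / 4)) =
       (\<integral>l. complex_of_real ((cmod (1 * \<phi> l + b * \<psi> l))\<^sup>2 / 4) \<partial>\<rho>)" for b
      by (simp only: integral_complex_of_real integral_divide_zero represents_moments(2)[OF XY])
    show ?thesis
      unfolding polarization
      by (simp only: 1 2 Bochner_Integration.integral_add Bochner_Integration.integral_diff Bochner_Integration.integrable_diff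
          Bochner_Integration.integrable_add integral_mult_right_zero integrable_mult_right)
  qed
  have "expectation (\<lambda>\<omega>. X \<omega> * Y \<omega>) = expectation (\<lambda>\<omega>. ((1 * X \<omega> + 1 * Y \<omega>)\<^sup>2 - (1 * X \<omega> + (-1) * Y \<omega>)\<^sup>2) / 4)"
    by (intro Bochner_Integration.integral_cong) (auto simp: power2_eq_square algebra_simps)
  also have "\<dots> = 0"
  proof -
    have 1: "expectation (\<lambda>\<omega>. (1 * X \<omega> + b * Y \<omega>)\<^sup>2) = 0" "integrable M (\<lambda>\<omega>. (1 * X \<omega> + b * Y \<omega>)\<^sup>2)" for b
      using represents_moments(4)[OF XY] square_integrable_mult(1)[OF represents_moments(1)[OF XY] represents_moments(1)[OF XY]]
      by (simp_all only: power2_eq_square)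
    show ?thesis
      by (simp only: integral_divide_zero Bochner_Integration.integral_diff 1) simp
  qed
  finally show "expectation (\<lambda>\<omega>. X \<omega> * Y \<omega>) = 0" .
qed

text \<open>Orthogonal symbols have additive squared norms, so the exponentials multiply and
  \<open>distr_pair_char\<close> applies. The families \<open>P\<close> and \<open>Q\<close> express
  all real linear functionals of the vectors \<open>U\<close> and \<open>V\<close>; conjugated
  covariances suffice because the unconjugated ones are always 0.\<close>

lemma represents_independent:
  fixes U :: "'a \<Rightarrow> 'b::euclidean_space" and V :: "'a \<Rightarrow> 'c::euclidean_space"
  assumes [measurable]: "U \<in> borel_measurable M" "V \<in> borel_measurable M"
    and U: "\<And>u. represents (P u) (\<phi> u)" "\<And>u \<omega>. u \<bullet> U \<omega> = Re (P u \<omega>)"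
    and V: "\<And>v. represents (Q v) (\<psi> v)" "\<And>v \<omega>. v \<bullet> V \<omega> = Re (Q v \<omega>)"
    and orth: "\<And>u v. (\<integral>l. \<phi> u l * cnj (\<psi> v l) \<partial>\<rho>) = 0"
  shows "distr M borel (\<lambda>\<omega>. (U \<omega>, V \<omega>)) = distr M borel U \<Otimes>\<^sub>M distr M borel V"
proof (rule distr_pair_char)
  fix u v
  note sq = representsD(2)[OF U(1)[of u]] representsD(2)[OF V(1)[of v]]
  have split: "complex_of_real ((cmod (1 * \<phi> u l + 1 * \<psi> v l))\<^sup>2) = complex_of_real ((cmod (\<phi> u l))\<^sup>2) + complex_of_real ((cmod (\<psi> v l))\<^sup>2)
      + \<phi> u l * cnj (\<psi> v l) + cnj (\<phi> u l * cnj (\<psi> v l))" for l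
    unfolding complex_norm_square by (simp add: algebra_simps)
  have "(\<integral>l. complex_of_real ((cmod (1 * \<phi> u l + 1 * \<psi> v l))\<^sup>2) \<partial>\<rho>) = complex_of_real (\<integral>l. (cmod (\<phi> u l))\<^sup>2 \<partial>\<rho>) + complex_of_real (\<integral>l. (cmod (\<psi> v l))\<^sup>2 \<partial>\<rho>)"
    unfolding split
    using sq[THEN square_integrableD(2)] square_integrable_mult(2)[OF sq] orth[of u v]
    by (simp del: of_real_power complex_cnj_mult complex_cnj_cnj)
  then have n: "(\<integral>l. (cmod (1 * \<phi> u l + 1 * \<psi> v l))\<^sup>2 \<partial>\<rho>) = (\<integral>l. (cmod (\<phi> u l))\<^sup>2 \<partial>\<rho>) + (\<integral>l. (cmod (\<psi> v l))\<^sup>2 \<partial>\<rho>)"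
    by (simp only: integral_complex_of_real of_real_eq_iff flip: of_real_add)
  have "expectation (\<lambda>x. iexp (u \<bullet> U x + v \<bullet> V x)) = expectation (\<lambda>\<omega>. iexp (Re (1 * P u \<omega> + 1 * Q v \<omega>)))"
    by (simp add: U V)
  also have "\<dots> = expectation (\<lambda>x. iexp (u \<bullet> U x)) * expectation (\<lambda>x. iexp (v \<bullet> V x))"
    unfolding represents_char[OF represents_lincomb[OF U(1) V(1)]] U(2) V(2) represents_char[OF U(1)] represents_char[OF V(1)] n
    by (simp add: exp_add[symmetric] add_divide_distrib diff_divide_distrib flip: of_real_mult)
  finally show "expectation (\<lambda>x. iexp (u \<bullet> U x + v \<bullet> V x)) = expectation (\<lambda>x. iexp (u \<bullet> U x)) * expectation (\<lambda>x. iexp (v \<bullet> V x))" .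
qed auto

end

section \<open>Differentiability of paths\<close>

lemma has_vector_derivative_quotient_limit:
  fixes g :: "real \<Rightarrow> 'b::real_normed_vector"
  assumes D: "(g has_vector_derivative D) (at t)"
  shows "((\<lambda>h. (g (t + h) - g t) /\<^sub>R h) \<longlongrightarrow> D) (at 0)"
proof (rule LIM_zero_cancel, rule tendsto_norm_zero_cancel, rule Lim_transform_eventually)
  show "((\<lambda>h. norm (g (t + h) - g t - h *\<^sub>R D) / norm h) \<longlongrightarrow> 0) (at 0)"
    using D by (simp add: has_vector_derivative_def has_derivative_at)
  have "norm (g (t + h) - g t - h *\<^sub>R D) / norm h = norm ((g (t + h) - g t) /\<^sub>R h - D)" if "h \<noteq> 0" for h
  proof -
    have "(g (t + h) - g t) /\<^sub>R h - D = (g (t + h) - g t - h *\<^sub>R D) /\<^sub>R h"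
      using that by (simp add: scaleR_diff_right)
    then show ?thesis by (simp only: norm_scaleR) (simp add: divide_inverse abs_inverse)
  qed
  then show "\<forall>\<^sub>F h in at 0. norm (g (t + h) - g t - h *\<^sub>R D) / norm h = norm ((g (t + h) - g t) /\<^sub>R h - D)"
    by (auto simp: eventually_at_filter)
qed

text \<open>The paths are only shown to be differentiable almost everywhere, while
  \<open>winding\<close> evaluates \<open>vector_derivative\<close> at every time; its measurability
  is needed before the integrand may be exchanged for another one almost everywhere.
  Differentiability with the candidate derivative \<open>L\<close> is expressed by countably many
  conditions on rational increments.\<close>

lemma vector_derivative_measurable:
  fixes g :: "real \<Rightarrow> complex"
  assumes cont: "continuous_on UNIV g"
  shows "(\<lambda>t. vector_derivative g (at t)) \<in> borel_measurable borel"
proof -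
  have [measurable]: "g \<in> borel_measurable borel" by (rule borel_measurable_continuous_onI[OF cont])
  define L where "L t = lim (\<lambda>n. real (Suc n) *\<^sub>R (g (t + 1 / real (Suc n)) - g t))" for t
  have [measurable]: "L \<in> borel_measurable borel" unfolding L_def by measurable
  \<comment> \<open>The common value of \<open>vector_derivative\<close> at all points without a
    derivative.\<close>
  define c :: complex where "c = (SOME x. False)"
  define P where "P t \<longleftrightarrow> (\<forall>m. \<exists>k. \<forall>q::rat. \<bar>real_of_rat q\<bar> < 1 / real (Suc k) \<longrightarrow>
     cmod (g (t + real_of_rat q) - g t - real_of_rat q *\<^sub>R L t) \<le> \<bar>real_of_rat q\<bar> / real (Suc m))" for t
  have [measurable]: "Measurable.pred borel P" unfolding P_def by measurable
  have deriv_L: "(g has_vector_derivative L t) (at t)" if "P t" for t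
    unfolding has_vector_derivative_def has_derivative_at_alt
  proof (intro conjI allI impI)
    show "bounded_linear (\<lambda>x. x *\<^sub>R L t)" by (rule bounded_linear_scaleR_left)
    fix e :: real assume "e > 0"
    then obtain m where m: "1 / real (Suc m) < e" using nat_approx_posE by blast
    obtain k where k: "\<And>q::rat. \<bar>real_of_rat q\<bar> < 1 / real (Suc k) \<Longrightarrow>
       cmod (g (t + real_of_rat q) - g t - real_of_rat q *\<^sub>R L t) \<le> \<bar>real_of_rat q\<bar> / real (Suc m)"
      using \<open>P t\<close> unfolding P_def by blast
    \<comment> \<open>Continuity of \<open>g\<close> extends the estimate from rational to real
      increments: a violation would hold on an open set and hence at some rational.\<close>
    have bd: "cmod (g (t + h) - g t - h *\<^sub>R L t) \<le> \<bar>h\<bar> / real (Suc m)" if h: "\<bar>h\<bar> < 1 / real (Suc k)" for h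
    proof (rule ccontr)
      define \<phi> where "\<phi> x = \<bar>x\<bar> / real (Suc m) - cmod (g (t + x) - g t - x *\<^sub>R L t)" for x
      have c\<phi>: "continuous_on UNIV \<phi>" unfolding \<phi>_def
        by (intro continuous_intros continuous_on_compose2[OF cont]) auto
      assume "\<not> cmod (g (t + h) - g t - h *\<^sub>R L t) \<le> \<bar>h\<bar> / real (Suc m)"
      then have "h \<in> {x. \<phi> x < 0} \<inter> {x. \<bar>x\<bar> < 1 / real (Suc k)}" using h by (auto simp: \<phi>_def)
      moreover have "open ({x. \<phi> x < 0} \<inter> {x. \<bar>x\<bar> < 1 / real (Suc k)})"
        by (intro open_Int open_Collect_less c\<phi> continuous_intros)
      ultimately obtain d where d: "d > 0" "ball h d \<subseteq> {x. \<phi> x < 0} \<inter> {x. \<bar>x\<bar> < 1 / real (Suc k)}"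
        unfolding open_contains_ball by blast
      obtain x where x: "x \<in> \<rat>" "h < x" "x < h + d" using Rats_dense_in_real[of h "h + d"] d by auto
      then obtain q where q: "x = real_of_rat q" by (auto simp: Rats_def)
      have "x \<in> ball h d" using x by (simp add: dist_real_def)
      then have "\<phi> x < 0" "\<bar>x\<bar> < 1 / real (Suc k)" using d by auto
      then show False using k[of q] unfolding \<phi>_def q by linarith
    qed
    show "\<exists>d>0. \<forall>y. norm (y - t) < d \<longrightarrow> norm (g y - g t - (y - t) *\<^sub>R L t) \<le> e * norm (y - t)"
    proof (intro exI[of _ "1 / real (Suc k)"] conjI allI impI)
      fix y assume "norm (y - t) < 1 / real (Suc k)"
      then have "cmod (g (t + (y - t)) - g t - (y - t) *\<^sub>R L t) \<le> \<bar>y - t\<bar> / real (Suc m)"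
        by (intro bd) simp
      also have "\<dots> = 1 / real (Suc m) * \<bar>y - t\<bar>" by simp
      also have "\<dots> \<le> e * \<bar>y - t\<bar>" using m by (intro mult_right_mono) auto
      finally show "norm (g y - g t - (y - t) *\<^sub>R L t) \<le> e * norm (y - t)" by simp
    qed simp
  qed
  have deriv_eq: "vector_derivative g (at t) = (if P t then L t else c)" for t
  proof (cases "\<exists>D. (g has_vector_derivative D) (at t)")
    case True
    then obtain D where D: "(g has_vector_derivative D) (at t)" by blast
    note lim0 = has_vector_derivative_quotient_limit[OF D]
    have "(\<lambda>n. (g (t + 1 / real (Suc n)) - g t) /\<^sub>R (1 / real (Suc n))) \<longlonglongrightarrow> D"
    proof (rule filterlim_compose[OF lim0])
      show "filterlim (\<lambda>n. 1 / real (Suc n)) (at 0) sequentially"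
        using LIMSEQ_inverse_real_of_nat by (auto simp: filterlim_at inverse_eq_divide intro!: always_eventually)
    qed
    then have LD: "L t = D" unfolding L_def by (intro limI) simp
    have "P t" unfolding P_def
    proof
      fix m
      have "0 < 1 / real (Suc m)" by simp
      then obtain d where d: "d > 0" "\<And>y. norm (y - t) < d \<Longrightarrow> norm (g y - g t - (y - t) *\<^sub>R D) \<le> 1 / real (Suc m) * norm (y - t)"
        using D unfolding has_vector_derivative_def has_derivative_at_alt by blast
      obtain k where k: "1 / real (Suc k) < d" using d(1) nat_approx_posE by blast
      show "\<exists>k. \<forall>q::rat. \<bar>real_of_rat q\<bar> < 1 / real (Suc k) \<longrightarrow>
         cmod (g (t + real_of_rat q) - g t - real_of_rat q *\<^sub>R L t) \<le> \<bar>real_of_rat q\<bar> / real (Suc m)"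
        using d(2)[of "t + real_of_rat _"] k LD by (intro exI[of _ k]) auto
    qed
    then show ?thesis using LD vector_derivative_at[OF D] by simp
  next
    case False
    then have "\<not> P t" using deriv_L by blast
    then show ?thesis using False by (simp add: vector_derivative_def c_def)
  qed
  show ?thesis unfolding deriv_eq by measurable
qed

text \<open>A Lebesgue point argument in mean square. The hypothesis speaks of dyadic windows only;
  an increment \<open>h\<close> is compared with the dyadic scale just above it, at the price of a
  factor 2.\<close>

lemma has_vector_derivative_of_integral_mean:
  fixes g g' :: "real \<Rightarrow> complex"
  assumes [measurable]: "g' \<in> borel_measurable borel"
    and int: "\<And>a b. a \<le> b \<Longrightarrow> set_integrable lborel {a..b} g'"
    and ftc: "\<And>a b. a \<le> b \<Longrightarrow> g b - g a = (LBINT s:{a..b}. g' s)"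
    and lim: "(\<lambda>n. ennreal (2 ^ n) * (\<integral>\<^sup>+u. ennreal ((cmod (g' (t + u) - g' t))\<^sup>2) * indicator {- (1/2^n)..1/2^n} u \<partial>lborel)) \<longlonglongrightarrow> 0"
  shows "(g has_vector_derivative g' t) (at t)"
  unfolding has_vector_derivative_def has_derivative_at_alt
proof (intro conjI allI impI)
  show "bounded_linear (\<lambda>x. x *\<^sub>R g' t)" by (rule bounded_linear_scaleR_left)
  fix e' :: real assume "e' > 0"
  define e where "e = e' / 4"
  have e: "e > 0" using \<open>e' > 0\<close> by (simp add: e_def)
  define y where "y u = cmod (g' (t + u) - g' t)" for u
  have [measurable]: "y \<in> borel_measurable borel" unfolding y_def by measurable
  define I where "I n = {- (1/2^n)..1/(2::real)^n}" for n :: nat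
  have [measurable]: "I n \<in> sets borel" for n unfolding I_def by simp
  have "\<forall>\<^sub>F n in sequentially. ennreal (2 ^ n) * (\<integral>\<^sup>+u. ennreal ((y u)\<^sup>2) * indicator (I n) u \<partial>lborel) < ennreal (2 * e\<^sup>2)"
    using order_tendstoD(2)[OF lim, of "ennreal (2 * e\<^sup>2)"] e by (simp add: y_def I_def)
  then obtain n0 where n0: "\<And>n. n \<ge> n0 \<Longrightarrow> ennreal (2 ^ n) * (\<integral>\<^sup>+u. ennreal ((y u)\<^sup>2) * indicator (I n) u \<partial>lborel) < ennreal (2 * e\<^sup>2)"
    unfolding eventually_sequentially by blast
  \<comment> \<open>From mean square to mean by y \<le> e/2 + y^2/(2 e); over a window of length 2 /
    2^n each of the two terms contributes e / 2^n.\<close>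
  have mean: "(\<integral>\<^sup>+u. ennreal (y u) * indicator (I n) u \<partial>lborel) \<le> ennreal (2 * e / 2 ^ n)" if n: "n \<ge> n0" for n
  proof -
    have 1: "(\<integral>\<^sup>+u. ennreal ((y u)\<^sup>2) * indicator (I n) u \<partial>lborel) \<le> ennreal (2 * e\<^sup>2 / 2 ^ n)"
    proof -
      have "(\<integral>\<^sup>+u. ennreal ((y u)\<^sup>2) * indicator (I n) u \<partial>lborel) = 
        ennreal (1 / 2 ^ n) * (ennreal (2 ^ n) * (\<integral>\<^sup>+u. ennreal ((y u)\<^sup>2) * indicator (I n) u \<partial>lborel))"
        by (simp add: mult.assoc[symmetric] flip: ennreal_mult)
      also have "\<dots> \<le> ennreal (1 / 2 ^ n) * ennreal (2 * e\<^sup>2)"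
        using n0[OF n] by (intro mult_left_mono) auto
      finally show ?thesis by (simp flip: ennreal_mult)
    qed
    have "(\<integral>\<^sup>+u. ennreal (y u) * indicator (I n) u \<partial>lborel) \<le>
      (\<integral>\<^sup>+u. ennreal (e / 2) * indicator (I n) u + ennreal (1 / (2 * e)) * (ennreal ((y u)\<^sup>2) * indicator (I n) u) \<partial>lborel)"
    proof (intro nn_integral_mono)
      fix u
      have "0 \<le> (y u - e)\<^sup>2 / (2 * e)" using e by simp
      also have "\<dots> = (y u)\<^sup>2 / (2 * e) - y u + e / 2" using e by (simp add: power2_eq_square field_simps)
      finally have "ennreal (y u) \<le> ennreal (e / 2 + 1 / (2 * e) * (y u)\<^sup>2)" by (intro ennreal_leI) simp
      also have "\<dots> = ennreal (e / 2) + ennreal (1 / (2 * e)) * ennreal ((y u)\<^sup>2)"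
        using e by (simp flip: ennreal_mult ennreal_plus)
      finally show "ennreal (y u) * indicator (I n) u \<le> ennreal (e / 2) * indicator (I n) u + ennreal (1 / (2 * e)) * (ennreal ((y u)\<^sup>2) * indicator (I n) u)"
        by (auto simp: indicator_def)
    qed
    also have "\<dots> = ennreal (e / 2) * emeasure lborel (I n) + ennreal (1 / (2 * e)) * (\<integral>\<^sup>+u. ennreal ((y u)\<^sup>2) * indicator (I n) u \<partial>lborel)"
      by (subst nn_integral_add) (auto simp: nn_integral_cmult)
    also have "\<dots> \<le> ennreal (e / 2) * ennreal (2 / 2 ^ n) + ennreal (1 / (2 * e)) * ennreal (2 * e\<^sup>2 / 2 ^ n)"
      by (intro add_mono mult_left_mono 1) (auto simp: I_def)
    also have "\<dots> = ennreal (2 * e / 2 ^ n)"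
      using e by (simp add: power2_eq_square field_simps flip: ennreal_mult ennreal_plus)
    finally show ?thesis .
  qed
  have diff: "cmod (g b - g a - (b - a) *\<^sub>R g' t) \<le> 2 * e / 2 ^ n"
    if "a \<le> b" "t - 1/2^n \<le> a" "b \<le> t + 1/2^n" "n \<ge> n0" for a b n
  proof -
    have ic: "set_integrable lborel {a..b} (\<lambda>_. g' t)"
      unfolding set_integrable_def by (intro integrable_scaleR_left integrable_real_indicator) (use that(1) in \<open>auto simp: less_top[symmetric]\<close>)
    have i2: "set_integrable lborel {a..b} (\<lambda>s. g' s - g' t)"
      using int[OF that(1)] ic by (intro set_integral_diff)
    have "g b - g a - (b - a) *\<^sub>R g' t = (LBINT s:{a..b}. g' s - g' t)"
      using that(1) int[OF that(1)] ftc[OF that(1)]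
      by (subst set_integral_diff(2)[OF int[OF that(1)] ic]) (auto simp: set_lebesgue_integral_def)
    then have "ennreal (cmod (g b - g a - (b - a) *\<^sub>R g' t)) \<le> (\<integral>\<^sup>+s. ennreal (norm (indicator {a..b} s *\<^sub>R (g' s - g' t))) \<partial>lborel)"
      using integral_norm_bound_ennreal[OF i2[unfolded set_integrable_def]] by (simp add: set_lebesgue_integral_def)
    also have "\<dots> \<le> (\<integral>\<^sup>+s. ennreal (y (s - t)) * indicator (I n) (s - t) \<partial>lborel)"
      using that by (intro nn_integral_mono) (auto simp: indicator_def y_def I_def)
    also have "\<dots> = (\<integral>\<^sup>+u. ennreal (y u) * indicator (I n) u \<partial>lborel)"
      using nn_integral_real_affine[of "\<lambda>u. ennreal (y u) * indicator (I n) u" 1 "- t"] by simp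
    also have "\<dots> \<le> ennreal (2 * e / 2 ^ n)" using that by (intro mean)
    finally show ?thesis using e by simp
  qed
  show "\<exists>d>0. \<forall>x. norm (x - t) < d \<longrightarrow> norm (g x - g t - (x - t) *\<^sub>R g' t) \<le> e' * norm (x - t)"
  proof (intro exI[of _ "1 / 2 ^ n0"] conjI allI impI)
    fix x assume x: "norm (x - t) < 1 / 2 ^ n0"
    show "norm (g x - g t - (x - t) *\<^sub>R g' t) \<le> e' * norm (x - t)"
    proof (cases "x = t")
      case False
      define h where "h = \<bar>x - t\<bar>"
      have h: "h > 0" "h < 1 / 2 ^ n0" using False x by (auto simp: h_def)
      have "\<exists>n. 1 / 2 ^ Suc n < h" 
      proof -
        obtain n where "(1/2) ^ n < h" using real_arch_pow_inv[of h "1/2"] h by auto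
        moreover have "(1/2::real) ^ Suc n \<le> (1/2) ^ n" by (intro power_decreasing) auto
        ultimately have "(1/2) ^ Suc n < h" by linarith
        then show ?thesis by (auto simp: power_one_over)
      qed
      \<comment> \<open>The scale with 1 / 2^(n+1) < h \<le> 1 / 2^n. The bound 2 e / 2^n is then
        below 4 e h, which explains e = e'/4.\<close>
      define n where "n = (LEAST n. 1 / 2 ^ Suc n < h)"
      have n1: "1 / 2 ^ Suc n < h" unfolding n_def using \<open>\<exists>n. 1 / 2 ^ Suc n < h\<close> by (rule LeastI_ex)
      have n2: "n \<ge> n0"
      proof (rule ccontr)
        assume "\<not> n \<ge> n0"
        then have "(1/2::real) ^ n0 \<le> (1/2) ^ Suc n" by (intro power_decreasing) auto
        then show False using n1 h(2) by (simp add: power_one_over)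
      qed
      have n3: "h \<le> 1 / 2 ^ n"
      proof (cases "n = n0")
        case False
        then obtain m where m: "n = Suc m" "m < n" using n2 by (cases n) auto
        then show ?thesis using not_less_Least[of m "\<lambda>n. 1 / 2 ^ Suc n < h"] unfolding n_def[symmetric] by auto
      qed (use h in auto)
      have "norm (g x - g t - (x - t) *\<^sub>R g' t) \<le> 2 * e / 2 ^ n"
      proof (cases "t \<le> x")
        case True
        then show ?thesis using diff[of t x n] n2 n3 by (auto simp: h_def)
      next
        case False
        have "g x - g t - (x - t) *\<^sub>R g' t = - (g t - g x - (t - x) *\<^sub>R g' t)" by (simp add: algebra_simps)
        then have "norm (g x - g t - (x - t) *\<^sub>R g' t) = norm (g t - g x - (t - x) *\<^sub>R g' t)"
          by (simp only: norm_minus_cancel)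
        then show ?thesis using diff[of x t n] n2 n3 False by (auto simp: h_def)
      qed
      also have "\<dots> = 4 * e * (1 / 2 ^ Suc n)" by simp
      also have "\<dots> \<le> 4 * e * h" using n1 e by (intro mult_left_mono) auto
      finally show ?thesis by (simp add: e_def h_def)
    qed simp
  qed simp
qed

lemma AE_suminf_finite:
  fixes X :: "nat \<Rightarrow> 'a \<Rightarrow> ennreal"
  assumes [measurable]: "\<And>n. X n \<in> borel_measurable M"
    and le: "\<And>n. (\<integral>\<^sup>+\<omega>. X n \<omega> \<partial>M) \<le> ennreal (a n)" and a: "summable a" "\<And>n. 0 \<le> a n"
  shows "AE \<omega> in M. (\<Sum>n. X n \<omega>) \<noteq> \<infinity>"
proof (rule nn_integral_PInf_AE)
  have "(\<integral>\<^sup>+\<omega>. (\<Sum>n. X n \<omega>) \<partial>M) = (\<Sum>n. \<integral>\<^sup>+\<omega>. X n \<omega> \<partial>M)" by (rule nn_integral_suminf) simp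
  also have "\<dots> \<le> (\<Sum>n. ennreal (a n))" by (intro suminf_le le) auto
  also have "\<dots> = ennreal (\<Sum>n. a n)" using a by (intro suminf_ennreal2) auto
  finally show "(\<integral>\<^sup>+\<omega>. (\<Sum>n. X n \<omega>) \<partial>M) \<noteq> \<infinity>" by (auto simp: top_unique)
qed simp

lemma ennreal_suminf_finite_tendsto:
  fixes x :: "nat \<Rightarrow> ennreal"
  assumes "(\<Sum>n. x n) \<noteq> \<infinity>"
  shows "x \<longlonglongrightarrow> 0"
proof -
  have fin: "x n \<noteq> \<infinity>" for n
    using assms ennreal_suminf_lessD[of x \<infinity> n] by (auto simp: less_top)
  define r where "r n = enn2real (x n)" for n
  have x: "x n = ennreal (r n)" "0 \<le> r n" for n using fin[of n] by (auto simp: r_def less_top)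
  have "summable r" using assms x by (intro summable_suminf_not_top) auto
  then have "r \<longlonglongrightarrow> 0" by (rule summable_LIMSEQ_zero)
  then have "(\<lambda>n. ennreal (r n)) \<longlonglongrightarrow> ennreal 0" by (intro tendsto_ennrealI)
  then show ?thesis by (simp add: x(1)[symmetric] fun_eq_iff[symmetric])
qed

text \<open>About log x scales satisfy 2^n < x and contribute at most 4 each; from there on the
  terms decay geometrically. The induction removes one scale by halving \<open>x\<close>.\<close>

lemma sum_min_dyadic_le:
  fixes x :: real
  assumes "x \<ge> 0"
  shows "(\<Sum>n<K. min 4 ((1 / 2 ^ n)\<^sup>2 * x\<^sup>2)) \<le> 2 + 16 * ln (1 + x)"
proof -
  have small: "(\<Sum>n<K. min 4 ((1 / 2 ^ n)\<^sup>2 * x\<^sup>2)) \<le> 2" if "0 \<le> x" "x \<le> 1" for x :: real and K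
  proof -
    have "(\<Sum>n<K. min 4 ((1 / 2 ^ n)\<^sup>2 * x\<^sup>2)) \<le> (\<Sum>n<K. (1/2) ^ n)"
    proof (rule sum_mono)
      fix n
      have "(1 / 2 ^ n)\<^sup>2 * x\<^sup>2 \<le> (1/2 ^ n)\<^sup>2 * 1" using that by (intro mult_left_mono) (auto simp: power_le_one)
      also have "\<dots> \<le> (1/2)^n * 1" unfolding power2_eq_square power_one_over[symmetric] mult_1_right 
        by (intro mult_left_le) (auto simp: power_le_one)
      finally show "min 4 ((1 / 2 ^ n)\<^sup>2 * x\<^sup>2) \<le> (1/2::real) ^ n" by simp
    qed
    also have "\<dots> \<le> (\<Sum>n. (1/2) ^ n)" by (intro sum_le_suminf) auto
    also have "\<dots> = 2" by (simp add: suminf_geometric)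
    finally show ?thesis .
  qed
  show ?thesis using assms
  proof (induction K arbitrary: x)
    case (Suc K)
    show ?case
    proof (cases "x \<le> 1")
      case True
      have "0 \<le> ln (1 + x)" using Suc.prems by simp
      then show ?thesis using small[OF Suc.prems True, of "Suc K"] by linarith
    next
      case False
      have "(\<Sum>n<Suc K. min 4 ((1 / 2 ^ n)\<^sup>2 * x\<^sup>2)) = min 4 (x\<^sup>2) + (\<Sum>n<K. min 4 ((1 / 2 ^ n)\<^sup>2 * (x / 2)\<^sup>2))"
        by (subst sum.lessThan_Suc_shift) (simp add: power_divide power_mult_distrib mult.commute)
      also have "\<dots> \<le> 4 + (2 + 16 * ln (1 + x / 2))"
        using Suc.IH[of "x / 2"] Suc.prems by (intro add_mono) auto
      \<comment> \<open>For x > 1, halving lowers the logarithm by at least ln (4/3) \<ge> 1/4; the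
        factor 16 makes this pay for one term of size 4.\<close>
      also have "16 * ln (1 + x / 2) \<le> 16 * ln (1 + x) - 4"
      proof -
        have "ln (1 + x) - ln (1 + x / 2) = ln ((1 + x) / (1 + x / 2))" using False by (subst ln_div) auto
        also have "\<dots> \<ge> ln (4/3)" using False by (subst ln_le_cancel_iff) (auto simp: field_simps)
        moreover have "ln (4/3 :: real) \<ge> 1/4" using ln_ge_iff[of "4/3" "1/4"] ln_one_minus_pos_upper_bound[of "1/4"] by (simp add: ln_div)
        ultimately show ?thesis by linarith
      qed
      finally show ?thesis by simp
    qed
  qed simp
qed

text \<open>The fundamental theorem of calculus from local L1 convergence of difference quotients,
  without pointwise differentiability of \<open>g\<close>. The integral of a difference quotient of
  \<open>g\<close> is the difference between the two endpoints of a difference quotient of an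
  antiderivative \<open>G\<close>, which tends to g b - g a by continuity.\<close>

lemma integral_of_difference_quotients:
  fixes g g' :: "real \<Rightarrow> complex"
  assumes cont: "continuous_on UNIV g" and [measurable]: "g' \<in> borel_measurable borel"
    and h: "\<And>n. 0 < h n" "h \<longlonglongrightarrow> 0"
    and lim: "\<And>N::nat. (\<lambda>n. \<integral>\<^sup>+s. ennreal (cmod ((g (s + h n) - g s) / of_real (h n) - g' s)) * indicator {-real N..real N} s \<partial>lborel) \<longlonglongrightarrow> 0"
    and ab: "a \<le> b"
  shows "set_integrable lborel {a..b} g' \<and> g b - g a = (LBINT s:{a..b}. g' s)"
proof -
  define q where "q n s = (g (s + h n) - g s) / complex_of_real (h n)" for n s
  have cont_g: "continuous_on A (\<lambda>s. g (s + c))" for A c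
    by (intro continuous_on_compose2[OF cont] continuous_intros) auto
  have qc: "continuous_on A (q n)" for n A
    unfolding q_def using h(1)[of n] cont_g[of _ 0] by (intro continuous_intros cont_g) auto
  have [measurable]: "q n \<in> borel_measurable borel" for n by (rule borel_measurable_continuous_onI[OF qc])
  obtain N :: nat where N: "max \<bar>a\<bar> \<bar>b\<bar> \<le> real N" using real_arch_simple by blast
  define X where "X n = (\<integral>\<^sup>+s. ennreal (cmod (q n s - g' s)) * indicator {a..b} s \<partial>lborel)" for n
  have X_lim: "X \<longlonglongrightarrow> 0"
  proof (rule tendsto_sandwich[OF _ _ tendsto_const lim[of N]])
    show "\<forall>\<^sub>F n in sequentially. X n \<le> (\<integral>\<^sup>+s. ennreal (cmod ((g (s + h n) - g s) / of_real (h n) - g' s)) * indicator {-real N..real N} s \<partial>lborel)"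
      using N unfolding X_def q_def by (intro always_eventually allI nn_integral_mono) (auto simp: indicator_def)
  qed auto
  have q_int: "set_integrable lborel {a..b} (q n)" for n
    by (rule borel_integrable_atLeastAtMost') (rule qc)
  obtain n where "X n < 1" using order_tendstoD(2)[OF X_lim, of 1] by (auto simp: eventually_sequentially)
  have "(\<integral>\<^sup>+s. ennreal (norm (indicator {a..b} s *\<^sub>R (q n s - g' s))) \<partial>lborel) = X n"
    unfolding X_def by (intro nn_integral_cong) (auto simp: indicator_def)
  also have "\<dots> < \<infinity>" using \<open>X n < 1\<close> by (rule less_trans) simp
  finally have "integrable lborel (\<lambda>s. indicator {a..b} s *\<^sub>R (q n s - g' s))"
    by (intro integrableI_bounded) simp_all
  then have d_int: "set_integrable lborel {a..b} (\<lambda>s. q n s - g' s)" by (simp add: set_integrable_def)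
  have g'_int: "set_integrable lborel {a..b} g'"
    using set_integral_diff(1)[OF q_int[of n] d_int] by simp
  have "(\<lambda>n. (LBINT s:{a..b}. q n s)) \<longlonglongrightarrow> (LBINT s:{a..b}. g' s)"
  proof (rule LIM_zero_cancel, rule tendsto_norm_zero_cancel)
    have le: "ennreal (norm ((LBINT s:{a..b}. q n s) - (LBINT s:{a..b}. g' s))) \<le> X n" for n
    proof -
      have "(LBINT s:{a..b}. q n s) - (LBINT s:{a..b}. g' s) = (LBINT s:{a..b}. q n s - g' s)"
        by (rule set_integral_diff(2)[OF q_int g'_int, symmetric])
      also have "ennreal (norm \<dots>) \<le> (\<integral>\<^sup>+s. ennreal (norm (indicator {a..b} s *\<^sub>R (q n s - g' s))) \<partial>lborel)"
        unfolding set_lebesgue_integral_def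
        by (rule integral_norm_bound_ennreal) (rule set_integral_diff(1)[OF q_int g'_int, unfolded set_integrable_def])
      also have "\<dots> = X n" unfolding X_def by (intro nn_integral_cong) (auto simp: indicator_def)
      finally show ?thesis .
    qed
    have "(\<lambda>n. ennreal (norm ((LBINT s:{a..b}. q n s) - (LBINT s:{a..b}. g' s)))) \<longlonglongrightarrow> ennreal 0"
      unfolding ennreal_0 by (rule tendsto_sandwich[OF _ _ tendsto_const X_lim]) (simp, rule always_eventually, intro allI le)
    then show "(\<lambda>n. norm ((LBINT s:{a..b}. q n s) - (LBINT s:{a..b}. g' s))) \<longlonglongrightarrow> 0"
      by (subst (asm) tendsto_ennreal_iff) auto
  qed
  moreover have "(\<lambda>n. (LBINT s:{a..b}. q n s)) \<longlonglongrightarrow> g b - g a"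
  proof -
    \<comment> \<open>A margin of 1 on both sides keeps the points shifted by h n < 1 inside the
      domain of \<open>G\<close>.\<close>
    define c d where "c = a - 1" and "d = b + 1"
    obtain G where G: "\<And>x. x \<in> {c..d} \<Longrightarrow> (G has_vector_derivative g x) (at x within {c..d})"
      using antiderivative_continuous[OF continuous_on_subset[OF cont subset_UNIV]] by blast
    have G': "(G has_vector_derivative g x) (at x)" if "c < x" "x < d" for x
      using G[of x] that by (simp add: at_within_Icc_at)
    have Gq: "((\<lambda>k. (G (x + k) - G x) /\<^sub>R k) \<longlongrightarrow> g x) (at 0)" if "c < x" "x < d" for x
      using has_vector_derivative_quotient_limit[OF G'[OF that]] .
    have hl: "filterlim h (at 0) sequentially"
    proof -
      have "h n \<noteq> 0" for n using h(1)[of n] by simp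
      then show ?thesis by (simp add: filterlim_at h(2))
    qed
    have ev: "\<forall>\<^sub>F n in sequentially. h n < 1" using order_tendstoD(2)[OF h(2), of 1] by simp
    have "\<forall>\<^sub>F n in sequentially. (G (b + h n) - G b) /\<^sub>R h n - (G (a + h n) - G a) /\<^sub>R h n = (LBINT s:{a..b}. q n s)"
      using ev
    proof eventually_elim
      case (elim n)
      define Q where "Q s = (G (s + h n) - G s) /\<^sub>R h n" for s
      have "(q n has_integral Q b - Q a) {a..b}"
      proof (rule fundamental_theorem_of_calculus[OF ab])
        fix x assume x: "x \<in> {a..b}"
        have 1: "((\<lambda>s. G (s + h n)) has_vector_derivative g (x + h n)) (at x within {a..b})"
        proof -
          have "((G \<circ> (\<lambda>s. s + h n)) has_vector_derivative 1 *\<^sub>R g (x + h n)) (at x within {a..b})"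
            using x elim h(1)[of n]
            by (intro vector_diff_chain_within[where g' = "g (x + h n)"] has_vector_derivative_at_within[OF G'])
              (auto intro!: derivative_eq_intros simp: c_def d_def)
          then show ?thesis by (simp add: comp_def)
        qed
        have 2: "(G has_vector_derivative g x) (at x within {a..b})"
          using x by (intro has_vector_derivative_at_within[OF G']) (auto simp: c_def d_def)
        show "(Q has_vector_derivative q n x) (at x within {a..b})"
          unfolding Q_def q_def using has_vector_derivative_scaleR[OF DERIV_const has_vector_derivative_diff[OF 1 2], of "inverse (h n)"]
          by (simp add: scaleR_conv_of_real divide_inverse mult.commute)
      qed
      then have "integral {a..b} (q n) = Q b - Q a" by (rule integral_unique)
      then show ?case using set_borel_integral_eq_integral(2)[OF q_int[of n]] by (simp add: Q_def)
    qed
    moreover have "(\<lambda>n. (G (b + h n) - G b) /\<^sub>R h n - (G (a + h n) - G a) /\<^sub>R h n) \<longlonglongrightarrow> g b - g a"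
      by (intro tendsto_diff filterlim_compose[OF Gq hl]) (use ab in \<open>auto simp: c_def d_def\<close>)
    ultimately show ?thesis by (rule Lim_transform_eventually[rotated])
  qed
  ultimately show ?thesis using g'_int LIMSEQ_unique by blast
qed

lemma (in prob_space) nn_integral_norm_le:
  assumes X: "square_integrable M X" and c: "c > 0" "expectation (\<lambda>\<omega>. (cmod (X \<omega>))\<^sup>2) \<le> c\<^sup>2"
  shows "(\<integral>\<^sup>+\<omega>. ennreal (cmod (X \<omega>)) \<partial>M) \<le> ennreal c"
proof -
  note [measurable] = square_integrableD(1)[OF X]
  have i: "integrable M (\<lambda>\<omega>. 1 / (2 * c) * (cmod (X \<omega>))\<^sup>2 + c / 2)"
    using square_integrableD(2)[OF X] by auto
  have "(\<integral>\<^sup>+\<omega>. ennreal (cmod (X \<omega>)) \<partial>M) \<le> (\<integral>\<^sup>+\<omega>. ennreal (1 / (2 * c) * (cmod (X \<omega>))\<^sup>2 + c / 2) \<partial>M)"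
  proof (intro nn_integral_mono ennreal_leI)
    fix \<omega>
    have "0 \<le> (cmod (X \<omega>) - c)\<^sup>2 / (2 * c)" using c by simp
    also have "\<dots> = 1 / (2 * c) * (cmod (X \<omega>))\<^sup>2 + c / 2 - cmod (X \<omega>)"
      using c by (simp add: power2_eq_square field_simps)
    finally show "cmod (X \<omega>) \<le> 1 / (2 * c) * (cmod (X \<omega>))\<^sup>2 + c / 2" by simp
  qed
  also have "\<dots> = ennreal (expectation (\<lambda>\<omega>. 1 / (2 * c) * (cmod (X \<omega>))\<^sup>2 + c / 2))"
    by (intro nn_integral_eq_integral i) (use c in auto)
  also have "expectation (\<lambda>\<omega>. 1 / (2 * c) * (cmod (X \<omega>))\<^sup>2 + c / 2) = 1 / (2 * c) * expectation (\<lambda>\<omega>. (cmod (X \<omega>))\<^sup>2) + c / 2"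
    using square_integrableD(2)[OF X] prob_space by simp
  also have "ennreal \<dots> \<le> ennreal (1 / (2 * c) * c\<^sup>2 + c / 2)"
    using c by (intro ennreal_leI add_right_mono mult_left_mono) auto
  also have "1 / (2 * c) * c\<^sup>2 + c / 2 = c" using c by (simp add: power2_eq_square)
  finally show ?thesis .
qed

lemma iexp_bounds:
  "cmod (iexp x - 1) \<le> 2" "cmod (iexp x - 1) \<le> \<bar>x\<bar>"
  "cmod (iexp x - 1 - \<i> * complex_of_real x) \<le> 2 * \<bar>x\<bar>" "cmod (iexp x - 1 - \<i> * complex_of_real x) \<le> x\<^sup>2 / 2"
  using iexp_approx1[of x 0] iexp_approx2[of x 0] iexp_approx1[of x 1] iexp_approx2[of x 1]
  by (auto simp: algebra_simps numeral_2_eq_2)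

section \<open>Spectral bounds for increments and difference quotients\<close>

context stationary_gaussian
begin

text \<open>A common majorant for two squared L2 distances: between the derivative at two times at
  distance \<open>h\<close>, and between a difference quotient of step \<open>h\<close> and the
  derivative. The minimum with 4 records that |exp (i x) - 1| is at most both 2 and |x|.\<close>

definition increment_bound :: "real \<Rightarrow> real" where
  "increment_bound h = (\<integral>l. l\<^sup>2 * min 4 (h\<^sup>2 * l\<^sup>2) \<partial>\<rho>)"

definition deriv_mode :: "real \<Rightarrow> real \<Rightarrow> complex" where
  "deriv_mode t l = - \<i> * complex_of_real l * fourier_mode t l"

lemma deriv_mode_measurable[measurable]: "deriv_mode t \<in> borel_measurable borel"
  unfolding deriv_mode_def by measurable

lemma integrable_square: "integrable \<rho> (\<lambda>l. l\<^sup>2)"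
proof (rule Bochner_Integration.integrable_bound[OF log_moment])
  have "l\<^sup>2 \<le> \<bar>l\<^sup>2 * (1 + ln (1 + \<bar>l\<bar>))\<bar>" for l :: real
  proof -
    have "l\<^sup>2 * 1 \<le> l\<^sup>2 * (1 + ln (1 + \<bar>l\<bar>))" by (intro mult_left_mono) auto
    then show ?thesis by linarith
  qed
  then show "AE l in \<rho>. norm (l\<^sup>2) \<le> norm (l\<^sup>2 * (1 + ln (1 + \<bar>l\<bar>)))" by auto
qed auto

lemma increment_integrable: "integrable \<rho> (\<lambda>l. l\<^sup>2 * min 4 (h\<^sup>2 * l\<^sup>2))"
proof (rule Bochner_Integration.integrable_bound)
  show "integrable \<rho> (\<lambda>l. 4 * l\<^sup>2)" using integrable_square by simp
  have "l\<^sup>2 * min 4 (h\<^sup>2 * l\<^sup>2) \<le> l\<^sup>2 * 4" for l :: real by (intro mult_left_mono) auto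
  then show "AE l in \<rho>. norm (l\<^sup>2 * min 4 (h\<^sup>2 * l\<^sup>2)) \<le> norm (4 * l\<^sup>2)" by (auto simp: abs_mult mult.commute)
qed auto

lemma increment_bound_nonneg: "0 \<le> increment_bound h"
  unfolding increment_bound_def by (intro Bochner_Integration.integral_nonneg) auto

lemma increment_bound_mono:
  assumes "\<bar>h\<bar> \<le> \<bar>k\<bar>"
  shows "increment_bound h \<le> increment_bound k"
proof -
  have "h\<^sup>2 \<le> k\<^sup>2" using assms by (simp add: abs_le_square_iff)
  then show ?thesis unfolding increment_bound_def
    by (intro integral_mono increment_integrable mult_left_mono min.mono mult_right_mono) auto
qed

lemma increment_bound_tendsto:
  assumes "h \<longlonglongrightarrow> 0"
  shows "(\<lambda>n. increment_bound (h n)) \<longlonglongrightarrow> 0"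
proof -
  have "(\<lambda>n. increment_bound (h n)) \<longlonglongrightarrow> (\<integral>l. 0 \<partial>\<rho>)"
    unfolding increment_bound_def
  proof (rule integral_dominated_convergence[where w="\<lambda>l. 4 * l\<^sup>2"])
    show "integrable \<rho> (\<lambda>l. 4 * l\<^sup>2)" using integrable_square by simp
    have "l\<^sup>2 * min 4 (k\<^sup>2 * l\<^sup>2) \<le> l\<^sup>2 * 4" for l k :: real by (intro mult_left_mono) auto
    then show "AE l in \<rho>. norm (l\<^sup>2 * min 4 ((h n)\<^sup>2 * l\<^sup>2)) \<le> 4 * l\<^sup>2" for n by (auto simp: abs_mult mult.commute)
    have "(\<lambda>n. l\<^sup>2 * min 4 ((h n)\<^sup>2 * l\<^sup>2)) \<longlonglongrightarrow> l\<^sup>2 * min 4 (0\<^sup>2 * l\<^sup>2)" for l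
      by (intro tendsto_intros assms)
    then show "AE l in \<rho>. (\<lambda>n. l\<^sup>2 * min 4 ((h n)\<^sup>2 * l\<^sup>2)) \<longlonglongrightarrow> 0" by simp
  qed auto
  then show ?thesis by simp
qed

text \<open>The use of the logarithmic moment: summing the truncated squares over dyadic steps
  inside the integral costs one factor of order 1 + ln (1 + |l|), by
  \<open>sum_min_dyadic_le\<close>.\<close>

lemma summable_increment_bound: "summable (\<lambda>n. increment_bound (1 / 2 ^ n))"
proof (rule bounded_imp_summable[where B="\<integral>l. 16 * (l\<^sup>2 * (1 + ln (1 + \<bar>l\<bar>))) \<partial>\<rho>"])
  fix K
  have "(\<Sum>n\<le>K. increment_bound (1 / 2 ^ n)) = (\<integral>l. (\<Sum>n\<le>K. l\<^sup>2 * min 4 ((1 / 2 ^ n)\<^sup>2 * l\<^sup>2)) \<partial>\<rho>)"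
    unfolding increment_bound_def by (intro Bochner_Integration.integral_sum[symmetric] increment_integrable)
  also have "\<dots> \<le> (\<integral>l. 16 * (l\<^sup>2 * (1 + ln (1 + \<bar>l\<bar>))) \<partial>\<rho>)"
  proof (rule integral_mono)
    show "integrable \<rho> (\<lambda>l. \<Sum>n\<le>K. l\<^sup>2 * min 4 ((1 / 2 ^ n)\<^sup>2 * l\<^sup>2))"
      by (intro Bochner_Integration.integrable_sum increment_integrable)
    show "integrable \<rho> (\<lambda>l. 16 * (l\<^sup>2 * (1 + ln (1 + \<bar>l\<bar>))))"
      by (intro integrable_mult_right log_moment)
    fix l :: real
    have "(\<Sum>n\<le>K. l\<^sup>2 * min 4 ((1 / 2 ^ n)\<^sup>2 * l\<^sup>2)) = l\<^sup>2 * (\<Sum>n<Suc K. min 4 ((1 / 2 ^ n)\<^sup>2 * \<bar>l\<bar>\<^sup>2))"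
      by (simp only: sum_distrib_left lessThan_Suc_atMost power2_abs)
    also have "\<dots> \<le> l\<^sup>2 * (2 + 16 * ln (1 + \<bar>l\<bar>))"
      by (intro mult_left_mono sum_min_dyadic_le) auto
    also have "\<dots> \<le> l\<^sup>2 * (16 * (1 + ln (1 + \<bar>l\<bar>)))" by (intro mult_left_mono) auto
    finally show "(\<Sum>n\<le>K. l\<^sup>2 * min 4 ((1 / 2 ^ n)\<^sup>2 * l\<^sup>2)) \<le> 16 * (l\<^sup>2 * (1 + ln (1 + \<bar>l\<bar>)))"
      by (simp add: mult_ac)
  qed
  finally show "(\<Sum>n\<le>K. increment_bound (1 / 2 ^ n)) \<le> \<dots>" .
qed (rule increment_bound_nonneg)

lemma square_integrable_deriv_mode: "square_integrable \<rho> (deriv_mode t)"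
  using integrable_square by (simp add: square_integrable_def deriv_mode_def norm_mult power_mult_distrib)

lemma fourier_mode_add: "fourier_mode (t + h) l = fourier_mode t l * iexp (- (h * l))"
  by (simp add: fourier_mode_def exp_add[symmetric] algebra_simps)

lemma deriv_mode_diff_le:
  "(cmod (deriv_mode s l - deriv_mode t l))\<^sup>2 \<le> l\<^sup>2 * min 4 ((s - t)\<^sup>2 * l\<^sup>2)"
proof -
  have "deriv_mode s l - deriv_mode t l = - \<i> * complex_of_real l * fourier_mode t l * (iexp (- ((s - t) * l)) - 1)"
    using fourier_mode_add[of t "s - t" l] by (simp add: deriv_mode_def algebra_simps)
  then have "(cmod (deriv_mode s l - deriv_mode t l))\<^sup>2 = l\<^sup>2 * (cmod (iexp (- ((s - t) * l)) - 1))\<^sup>2"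
    by (simp add: norm_mult power_mult_distrib)
  also have "\<dots> \<le> l\<^sup>2 * min 4 ((s - t)\<^sup>2 * l\<^sup>2)"
  proof (intro mult_left_mono min.boundedI)
    show "(cmod (iexp (- ((s - t) * l)) - 1))\<^sup>2 \<le> 4"
      using power_mono[OF iexp_bounds(1)[of "- ((s - t) * l)"], of 2] by simp
    show "(cmod (iexp (- ((s - t) * l)) - 1))\<^sup>2 \<le> (s - t)\<^sup>2 * l\<^sup>2"
      using power_mono[OF iexp_bounds(2)[of "- ((s - t) * l)"], of 2] by (simp add: abs_mult power_mult_distrib)
  qed simp
  finally show ?thesis .
qed

text \<open>The difference is a second-order Taylor remainder of the exponential divided by
  \<open>h\<close>; the remainder bounds 2 |x| and x^2 / 2 at x = - h l give the two entries of the
  minimum.\<close>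

lemma quotient_mode_diff_le:
  assumes h: "h \<noteq> 0"
  shows "(cmod ((fourier_mode (t + h) l - fourier_mode t l) / complex_of_real h - deriv_mode t l))\<^sup>2 \<le> l\<^sup>2 * min 4 (h\<^sup>2 * l\<^sup>2)"
proof -
  define x where "x = - (h * l)"
  have "(fourier_mode (t + h) l - fourier_mode t l) / complex_of_real h - deriv_mode t l =
     fourier_mode t l * (iexp x - 1 - \<i> * complex_of_real x) / complex_of_real h"
    unfolding fourier_mode_add x_def deriv_mode_def using h by (simp add: field_simps)
  then have eq: "(cmod ((fourier_mode (t + h) l - fourier_mode t l) / complex_of_real h - deriv_mode t l))\<^sup>2 =
     (cmod (iexp x - 1 - \<i> * complex_of_real x))\<^sup>2 / h\<^sup>2"
    by (simp add: norm_mult norm_divide power_divide power_mult_distrib)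
  have "(cmod (iexp x - 1 - \<i> * complex_of_real x))\<^sup>2 / h\<^sup>2 \<le> (2 * \<bar>x\<bar>)\<^sup>2 / h\<^sup>2"
    by (intro divide_right_mono power_mono iexp_bounds) auto
  also have "\<dots> = l\<^sup>2 * 4" using h by (simp add: x_def power_mult_distrib)
  finally have 1: "(cmod (iexp x - 1 - \<i> * complex_of_real x))\<^sup>2 / h\<^sup>2 \<le> l\<^sup>2 * 4" .
  have "(cmod (iexp x - 1 - \<i> * complex_of_real x))\<^sup>2 / h\<^sup>2 \<le> (x\<^sup>2)\<^sup>2 / h\<^sup>2"
    by (intro divide_right_mono power_mono order_trans[OF iexp_bounds(4)]) auto
  also have "\<dots> = l\<^sup>2 * (h\<^sup>2 * l\<^sup>2)" using h by (simp add: x_def power_mult_distrib power2_eq_square)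
  finally have 2: "(cmod (iexp x - 1 - \<i> * complex_of_real x))\<^sup>2 / h\<^sup>2 \<le> l\<^sup>2 * (h\<^sup>2 * l\<^sup>2)" .
  show ?thesis unfolding eq using 1 2 by (simp add: min_def)
qed

end

section \<open>The derivative process\<close>

context stationary_gaussian
begin

text \<open>Steps with squared error at most 4^(-n) have L2 errors at most 2^(-n). Summability
  upgrades mean-square convergence of the quotients to almost sure convergence, with steps that do
  not depend on the time.\<close>

lemma ex_steps: "\<exists>H. \<forall>n. 0 < H n \<and> H n \<le> 1 / real (Suc n) \<and> increment_bound (H n) \<le> (1 / 4) ^ n"
proof -
  have "\<exists>h. 0 < h \<and> h \<le> 1 / real (Suc n) \<and> increment_bound h \<le> (1 / 4) ^ n" for n
  proof -
    have "(\<lambda>k. increment_bound (1 / real (Suc k))) \<longlonglongrightarrow> 0"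
      by (intro increment_bound_tendsto) (use LIMSEQ_inverse_real_of_nat in \<open>simp add: inverse_eq_divide\<close>)
    then have "\<forall>\<^sub>F k in sequentially. increment_bound (1 / real (Suc k)) < (1/4) ^ n"
      by (rule order_tendstoD) simp
    then obtain k where k: "k \<ge> n" "increment_bound (1 / real (Suc k)) < (1/4) ^ n"
      unfolding eventually_sequentially by (meson nle_le)
    then show ?thesis by (intro exI[of _ "1 / real (Suc k)"]) (auto intro!: divide_left_mono)
  qed
  then show ?thesis by metis
qed

definition step_size :: "nat \<Rightarrow> real" where
  "step_size = (SOME H. \<forall>n. 0 < H n \<and> H n \<le> 1 / real (Suc n) \<and> increment_bound (H n) \<le> (1 / 4) ^ n)"

lemma step_size: "0 < step_size n" "step_size n \<le> 1 / real (Suc n)" "increment_bound (step_size n) \<le> (1 / 4) ^ n"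
  using someI_ex[OF ex_steps] unfolding step_size_def[symmetric] by auto

lemma step_size_tendsto: "step_size \<longlonglongrightarrow> 0"
  by (rule tendsto_sandwich[OF _ _ tendsto_const LIMSEQ_inverse_real_of_nat])
    (use step_size in \<open>auto intro!: always_eventually less_imp_le simp: inverse_eq_divide\<close>)

definition diff_quotient :: "nat \<Rightarrow> real \<Rightarrow> 'a \<Rightarrow> complex" where
  "diff_quotient n t \<omega> = (F (t + step_size n) \<omega> - F t \<omega>) / complex_of_real (step_size n)"

text \<open>A limit taken pointwise instead of in L2, so that the derivative process is jointly
  measurable in time and sample. Where the quotients diverge its value is unspecified.\<close>

definition deriv_F :: "real \<Rightarrow> 'a \<Rightarrow> complex" where
  "deriv_F t \<omega> = lim (\<lambda>n. diff_quotient n t \<omega>)"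

lemma F_compose_measurable[measurable (raw)]:
  assumes [measurable]: "f \<in> borel_measurable N" "g \<in> measurable N M"
  shows "(\<lambda>x. F (f x) (g x)) \<in> borel_measurable N"
  using measurable_compose[OF measurable_Pair[OF assms] F_measurable] by simp

lemma diff_quotient_measurable[measurable (raw)]:
  assumes [measurable]: "f \<in> borel_measurable N" "g \<in> measurable N M"
  shows "(\<lambda>x. diff_quotient n (f x) (g x)) \<in> borel_measurable N"
  unfolding diff_quotient_def by measurable

lemma deriv_F_measurable[measurable (raw)]:
  assumes [measurable]: "f \<in> borel_measurable N" "g \<in> measurable N M"
  shows "(\<lambda>x. deriv_F (f x) (g x)) \<in> borel_measurable N"
  unfolding deriv_F_def by measurable

definition quotient_mode :: "nat \<Rightarrow> real \<Rightarrow> real \<Rightarrow> complex" where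
  "quotient_mode n t l = (fourier_mode (t + step_size n) l - fourier_mode t l) / complex_of_real (step_size n)"

lemma mode_combination_diff_quotient: "mode_combination (diff_quotient n t) (quotient_mode n t)"
  using mode_combination_lincomb[OF mode_combination_F[of "t + step_size n"] mode_combination_F[of t], of "1 / complex_of_real (step_size n)" "- (1 / complex_of_real (step_size n))"]
  by (simp add: diff_quotient_def[abs_def] quotient_mode_def[abs_def] diff_divide_distrib)

lemma quotient_mode_approx:
  "square_integrable \<rho> (\<lambda>l. quotient_mode n t l - deriv_mode t l)"
  "(\<integral>l. (cmod (quotient_mode n t l - deriv_mode t l))\<^sup>2 \<partial>\<rho>) \<le> (1 / 4) ^ n"
proof -
  show sq: "square_integrable \<rho> (\<lambda>l. quotient_mode n t l - deriv_mode t l)"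
    using square_integrable_lincomb(1)[OF mode_combinationD(2)[OF mode_combination_diff_quotient[of n t]] square_integrable_deriv_mode[of t], of 1 "-1"]
    by simp
  have "(\<integral>l. (cmod (quotient_mode n t l - deriv_mode t l))\<^sup>2 \<partial>\<rho>) \<le> increment_bound (step_size n)"
    unfolding increment_bound_def quotient_mode_def
    using square_integrableD(2)[OF sq] step_size(1)[of n]
    by (intro integral_mono increment_integrable quotient_mode_diff_le) (auto simp: quotient_mode_def)
  then show "(\<integral>l. (cmod (quotient_mode n t l - deriv_mode t l))\<^sup>2 \<partial>\<rho>) \<le> (1 / 4) ^ n"
    using step_size(3)[of n] by linarith
qed

text \<open>Consecutive quotients differ by at most 2 * 2^(-n) in L2, hence in L1; the telescoping
  series then converges absolutely almost surely.\<close>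

lemma AE_diff_quotient_tendsto: "AE \<omega> in M. (\<lambda>n. diff_quotient n t \<omega>) \<longlonglongrightarrow> deriv_F t \<omega>"
proof -
  define Y where "Y n \<omega> = 1 * diff_quotient (Suc n) t \<omega> + (-1) * diff_quotient n t \<omega>" for n \<omega>
  define \<eta> where "\<eta> n l = 1 * quotient_mode (Suc n) t l + (-1) * quotient_mode n t l" for n l
  have rep: "represents (Y n) (\<eta> n)" for n
    unfolding Y_def[abs_def] \<eta>_def[abs_def]
    by (intro represents_mode_combination mode_combination_lincomb mode_combination_diff_quotient)
  have [measurable]: "Y n \<in> borel_measurable M" for n unfolding Y_def by measurable
  have norm_le: "(\<integral>l. (cmod (\<eta> n l))\<^sup>2 \<partial>\<rho>) \<le> (2 * (1/2) ^ n)\<^sup>2" for n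
  proof -
    have "(\<integral>l. (cmod (\<eta> n l))\<^sup>2 \<partial>\<rho>) = (\<integral>l. (cmod (1 * (quotient_mode (Suc n) t l - deriv_mode t l) + (-1) * (quotient_mode n t l - deriv_mode t l)))\<^sup>2 \<partial>\<rho>)"
      by (simp add: \<eta>_def)
    also have "\<dots> \<le> 2 * (\<integral>l. (cmod (quotient_mode (Suc n) t l - deriv_mode t l))\<^sup>2 \<partial>\<rho>) + 2 * (\<integral>l. (cmod (quotient_mode n t l - deriv_mode t l))\<^sup>2 \<partial>\<rho>)"
      using square_integrable_lincomb(2)[OF quotient_mode_approx(1)[of "Suc n" t] quotient_mode_approx(1)[of n t], of 1 "-1"] by simp
    also have "\<dots> \<le> 2 * (1/4) ^ Suc n + 2 * (1/4) ^ n"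
      by (intro add_mono mult_left_mono quotient_mode_approx(2)) auto
    also have "\<dots> \<le> 4 * (1/4) ^ n" by simp
    also have "\<dots> = (2 * (1/2) ^ n)\<^sup>2" by (simp add: power_mult_distrib power_mult[symmetric] mult.commute[of n] power_mult[of _ 2] power_divide)
    finally show ?thesis .
  qed
  have "AE \<omega> in M. (\<Sum>n. ennreal (cmod (Y n \<omega>))) \<noteq> \<infinity>"
  proof (rule AE_suminf_finite)
    show "(\<integral>\<^sup>+\<omega>. ennreal (cmod (Y n \<omega>)) \<partial>M) \<le> ennreal (2 * (1/2) ^ n)" for n
      using represents_moments(1,2)[OF rep[of n]] norm_le[of n] by (intro nn_integral_norm_le) auto
  qed (auto intro!: summable_mult summable_geometric)
  then show ?thesis
  proof eventually_elim
    case (elim \<omega>)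
    have "summable (\<lambda>n. cmod (Y n \<omega>))"
      using elim by (intro summable_suminf_not_top) auto
    then have "summable (\<lambda>n. Y n \<omega>)" by (rule summable_norm_cancel)
    then have "convergent (\<lambda>n. \<Sum>k<n. diff_quotient (Suc k) t \<omega> - diff_quotient k t \<omega>)"
      by (simp add: Y_def summable_iff_convergent)
    then have "convergent (\<lambda>n. diff_quotient n t \<omega> - diff_quotient 0 t \<omega>)"
      by (simp only: sum_lessThan_telescope[of "\<lambda>k. diff_quotient k t \<omega>"])
    then have "convergent (\<lambda>n. (diff_quotient n t \<omega> - diff_quotient 0 t \<omega>) + diff_quotient 0 t \<omega>)"
      by (intro convergent_add convergent_const)
    then show ?case unfolding deriv_F_def by (simp add: convergent_LIMSEQ_iff)
  qed
qed

lemma represents_deriv_F: "represents (deriv_F t) (deriv_mode t)"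
  unfolding represents_def
proof (intro conjI exI[of _ "\<lambda>n. diff_quotient n t"] exI[of _ "\<lambda>n. quotient_mode n t"] allI)
  show "deriv_F t \<in> borel_measurable M" by measurable
  have "(\<lambda>n. (1 / 4 :: real) ^ n) \<longlonglongrightarrow> 0" by (rule LIMSEQ_power_zero) simp
  then show "(\<lambda>n. \<integral>l. (cmod (quotient_mode n t l - deriv_mode t l))\<^sup>2 \<partial>\<rho>) \<longlonglongrightarrow> 0"
    by (rule tendsto_sandwich[OF _ _ tendsto_const, rotated 2]) (auto intro!: always_eventually quotient_mode_approx(2))
qed (auto intro: square_integrable_deriv_mode mode_combination_diff_quotient AE_diff_quotient_tendsto)

lemma nn_integral_diff_quotient_approx:
  "(\<integral>\<^sup>+\<omega>. ennreal (cmod (diff_quotient n t \<omega> - deriv_F t \<omega>)) \<partial>M) \<le> ennreal ((1/2) ^ n)"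
proof -
  have rep: "represents (\<lambda>\<omega>. diff_quotient n t \<omega> - deriv_F t \<omega>) (\<lambda>l. quotient_mode n t l - deriv_mode t l)"
    using represents_lincomb[OF represents_mode_combination[OF mode_combination_diff_quotient[of n t]] represents_deriv_F[of t], of 1 "-1"] by simp
  have "((1/2)^n)\<^sup>2 = (1/4 :: real) ^ n" by (simp add: power_mult[symmetric] mult.commute[of n] power_mult[of _ 2] power_divide)
  then show ?thesis
    using represents_moments(1,2)[OF rep] quotient_mode_approx(2)[of n t] by (intro nn_integral_norm_le) auto
qed

sublocale LM: pair_sigma_finite lborel M ..

text \<open>The L1 errors of the quotients over a window [-N, N] have summable expectations, so they
  tend to 0 almost surely. Countably many windows give one null set valid for all a and b.\<close>

lemma AE_F_eq_integral:
  "AE \<omega> in M. \<forall>a b. a \<le> b \<longrightarrow> set_integrable lborel {a..b} (\<lambda>s. deriv_F s \<omega>) \<and>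
     F b \<omega> - F a \<omega> = (LBINT s:{a..b}. deriv_F s \<omega>)"
proof -
  define X where "X N n \<omega> = (\<integral>\<^sup>+s. ennreal (cmod (diff_quotient n s \<omega> - deriv_F s \<omega>)) * indicator {-real N..real N} s \<partial>lborel)" for N n :: nat and \<omega>
  have [measurable]: "X N n \<in> borel_measurable M" for N n
    unfolding X_def by measurable
  have le: "(\<integral>\<^sup>+\<omega>. X N n \<omega> \<partial>M) \<le> ennreal (2 * real N * (1/2) ^ n)" for N n
  proof -
    have "(\<integral>\<^sup>+\<omega>. X N n \<omega> \<partial>M) = (\<integral>\<^sup>+s. (\<integral>\<^sup>+\<omega>. ennreal (cmod (diff_quotient n s \<omega> - deriv_F s \<omega>)) * indicator {-real N..real N} s \<partial>M) \<partial>lborel)"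
      unfolding X_def by (rule LM.Fubini') measurable
    also have "\<dots> \<le> (\<integral>\<^sup>+s. ennreal ((1/2) ^ n) * indicator {-real N..real N} s \<partial>lborel)"
      by (intro nn_integral_mono) (auto simp: nn_integral_multc intro!: mult_right_mono nn_integral_diff_quotient_approx)
    also have "\<dots> = ennreal ((1/2) ^ n) * ennreal (2 * real N)"
      by (subst nn_integral_cmult_indicator) auto
    finally show ?thesis by (simp add: mult.commute flip: ennreal_mult)
  qed
  have "AE \<omega> in M. \<forall>N. (\<Sum>n. X N n \<omega>) \<noteq> \<infinity>"
    unfolding AE_all_countable
    by (intro allI, rule AE_suminf_finite[OF _ le]) (auto intro!: summable_mult summable_geometric)
  then show ?thesis
  proof (rule AE_mp, intro AE_I2 impI allI)
    fix \<omega> a b assume \<omega>: "\<omega> \<in> space M" and fin: "\<forall>N. (\<Sum>n. X N n \<omega>) \<noteq> \<infinity>" and ab: "a \<le> (b::real)"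
    show "set_integrable lborel {a..b} (\<lambda>s. deriv_F s \<omega>) \<and> F b \<omega> - F a \<omega> = (LBINT s:{a..b}. deriv_F s \<omega>)"
    proof (rule integral_of_difference_quotients[OF F_cont _ step_size(1) step_size_tendsto _ ab])
      show "(\<lambda>s. deriv_F s \<omega>) \<in> borel_measurable borel" using \<omega> by measurable
      show "(\<lambda>n. \<integral>\<^sup>+s. ennreal (cmod ((F (s + step_size n) \<omega> - F s \<omega>) / of_real (step_size n) - deriv_F s \<omega>)) * indicator {-real N..real N} s \<partial>lborel) \<longlonglongrightarrow> 0" for N
        using ennreal_suminf_finite_tendsto[of "\<lambda>n. X N n \<omega>"] fin by (simp add: X_def diff_quotient_def)
    qed
  qed
qed

text \<open>The expected dyadic mean \<open>B n t\<close> is at most twice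
  \<open>increment_bound (1 / 2 ^ n)\<close>. Summability makes these means tend to 0 almost surely
  at each fixed time, which is the Lebesgue point condition of
  \<open>has_vector_derivative_of_integral_mean\<close>.\<close>

lemma AE_F_has_derivative:
  "AE \<omega> in M. AE t in lborel. ((\<lambda>t. F t \<omega>) has_vector_derivative deriv_F t \<omega>) (at t)"
proof -
  define B where "B n t \<omega> = ennreal (2 ^ n) * (\<integral>\<^sup>+u. ennreal ((cmod (deriv_F (t + u) \<omega> - deriv_F t \<omega>))\<^sup>2) * indicator {- (1/2^n)..1/2^n} u \<partial>lborel)" for n t \<omega>
  have B_meas: "(\<lambda>p. B n (fst p) (snd p)) \<in> borel_measurable (borel \<Otimes>\<^sub>M M)" for n
    unfolding B_def by measurable
  note [measurable] = measurable_compose[OF _ B_meas]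
  have B_meas'[measurable]: "B n t \<in> borel_measurable M" for n t
    using measurable_compose[OF measurable_Pair1' B_meas, of t] by simp
  have fin: "AE \<omega> in M. (\<Sum>n. B n t \<omega>) \<noteq> \<infinity>" for t
  proof (rule AE_suminf_finite)
    fix n
    have eq: "(\<integral>\<^sup>+\<omega>. B n t \<omega> \<partial>M) = ennreal (2 ^ n) * (\<integral>\<^sup>+\<omega>. (\<integral>\<^sup>+u. ennreal ((cmod (deriv_F (t + u) \<omega> - deriv_F t \<omega>))\<^sup>2) * indicator {- (1/2^n)..1/2^n} u \<partial>lborel) \<partial>M)"
      unfolding B_def by (rule nn_integral_cmult) measurable
    have "(\<integral>\<^sup>+\<omega>. (\<integral>\<^sup>+u. ennreal ((cmod (deriv_F (t + u) \<omega> - deriv_F t \<omega>))\<^sup>2) * indicator {- (1/2^n)..1/2^n} u \<partial>lborel) \<partial>M) =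
      (\<integral>\<^sup>+u. (\<integral>\<^sup>+\<omega>. ennreal ((cmod (deriv_F (t + u) \<omega> - deriv_F t \<omega>))\<^sup>2) * indicator {- (1/2^n)..1/2^n} u \<partial>M) \<partial>lborel)"
      by (rule LM.Fubini') measurable
    also have "\<dots> \<le> (\<integral>\<^sup>+u. ennreal (increment_bound (1/2^n)) * indicator {- (1/2^n)..1/2^n} (u::real) \<partial>lborel)"
    proof (rule nn_integral_mono)
      fix u :: real
      have "(\<integral>\<^sup>+\<omega>. ennreal ((cmod (deriv_F (t + u) \<omega> - deriv_F t \<omega>))\<^sup>2) \<partial>M) \<le> ennreal (increment_bound (1/2^n))"
        if "\<bar>u\<bar> \<le> 1 / 2 ^ n"
      proof -
        have rep: "represents (\<lambda>\<omega>. deriv_F (t + u) \<omega> - deriv_F t \<omega>) (\<lambda>l. deriv_mode (t + u) l - deriv_mode t l)"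
          using represents_lincomb[OF represents_deriv_F[of "t + u"] represents_deriv_F[of t], of 1 "-1"] by simp
        have "(\<integral>\<^sup>+\<omega>. ennreal ((cmod (deriv_F (t + u) \<omega> - deriv_F t \<omega>))\<^sup>2) \<partial>M) = ennreal (\<integral>l. (cmod (deriv_mode (t + u) l - deriv_mode t l))\<^sup>2 \<partial>\<rho>)"
          using represents_moments(2)[OF rep] square_integrableD(2)[OF represents_moments(1)[OF rep]]
          by (subst nn_integral_eq_integral) auto
        also have "\<dots> \<le> ennreal (increment_bound u)"
          unfolding increment_bound_def
          using square_integrableD(2)[OF representsD(2)[OF rep]] deriv_mode_diff_le[of "t + u" _ t]
          by (intro ennreal_leI integral_mono increment_integrable) auto
        also have "\<dots> \<le> ennreal (increment_bound (1/2^n))"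
          using that by (intro ennreal_leI increment_bound_mono) auto
        finally show ?thesis .
      qed
      then show "(\<integral>\<^sup>+\<omega>. ennreal ((cmod (deriv_F (t + u) \<omega> - deriv_F t \<omega>))\<^sup>2) * indicator {- (1/2^n)..1/2^n} u \<partial>M) \<le> ennreal (increment_bound (1/2^n)) * indicator {- (1/2^n)..1/2^n} u"
        by (auto simp: indicator_def abs_le_iff)
    qed
    also have "\<dots> = ennreal (increment_bound (1/2^n)) * emeasure lborel {- (1/2^n)..1/(2::real)^n}"
      by (rule nn_integral_cmult_indicator) simp
    also have "emeasure lborel {- (1/2^n)..1/(2::real)^n} = ennreal (2 / 2 ^ n)" by simp
    finally have "(\<integral>\<^sup>+\<omega>. B n t \<omega> \<partial>M) \<le> ennreal (2 ^ n) * (ennreal (increment_bound (1/2^n)) * ennreal (2 / 2 ^ n))"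
      unfolding eq by (rule mult_left_mono) simp
    also have "\<dots> = ennreal (2 * increment_bound (1/2^n))"
      using increment_bound_nonneg by (simp flip: ennreal_mult)
    finally show "(\<integral>\<^sup>+\<omega>. B n t \<omega> \<partial>M) \<le> ennreal (2 * increment_bound (1/2^n))" .
  qed (auto intro!: summable_mult summable_increment_bound increment_bound_nonneg)
  \<comment> \<open>Tonelli exchanges the quantifiers: from almost surely for each time to almost
    every time for almost every path.\<close>
  have "AE t in lborel. AE \<omega> in M. (\<Sum>n. B n t \<omega>) \<noteq> \<infinity>" using fin by simp
  then have "AE \<omega> in M. AE t in lborel. (\<Sum>n. B n t \<omega>) \<noteq> \<infinity>"
    by (subst (asm) LM.AE_commute) measurable
  note both = eventually_conj[OF AE_F_eq_integral this]
  show ?thesis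
  proof (rule AE_mp[OF both], rule AE_I2, rule impI)
    fix \<omega> assume \<omega>: "\<omega> \<in> space M" and A: "(\<forall>a b. a \<le> b \<longrightarrow> set_integrable lborel {a..b} (\<lambda>s. deriv_F s \<omega>) \<and>
     F b \<omega> - F a \<omega> = (LBINT s:{a..b}. deriv_F s \<omega>)) \<and> (AE t in lborel. (\<Sum>n. B n t \<omega>) \<noteq> \<infinity>)"
    have [measurable]: "(\<lambda>s. deriv_F s \<omega>) \<in> borel_measurable borel" using \<omega> by measurable
    show "AE t in lborel. ((\<lambda>t. F t \<omega>) has_vector_derivative deriv_F t \<omega>) (at t)"
      using A[THEN conjunct2]
    proof (rule AE_mp, intro AE_I2 impI)
      fix t assume "(\<Sum>n. B n t \<omega>) \<noteq> \<infinity>"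
      then show "((\<lambda>t. F t \<omega>) has_vector_derivative deriv_F t \<omega>) (at t)"
        using A ennreal_suminf_finite_tendsto[of "\<lambda>n. B n t \<omega>"]
        by (intro has_vector_derivative_of_integral_mean[where g'="\<lambda>s. deriv_F s \<omega>"]) (auto simp: B_def)
    qed
  qed
qed

text \<open>Times without a derivative form a null set and leave the integral unchanged; z - cnj z =
  2 i Im z cancels the prefactor of \<open>winding\<close>. A single null set serves all T.\<close>

lemma AE_winding_eq:
  "AE \<omega> in M. \<forall>T. winding (\<lambda>t. F t \<omega>) T = complex_of_real (LBINT t:{0..T}. Im (deriv_F t \<omega> / F t \<omega>))"
  using AE_F_has_derivative
proof (rule AE_mp, intro AE_I2 impI allI)
  fix \<omega> T assume \<omega>: "\<omega> \<in> space M" and D: "AE t in lborel. ((\<lambda>t. F t \<omega>) has_vector_derivative deriv_F t \<omega>) (at t)"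
  have [measurable]: "(\<lambda>s. deriv_F s \<omega>) \<in> borel_measurable borel" "(\<lambda>s. F s \<omega>) \<in> borel_measurable borel"
    "(\<lambda>t. vector_derivative (\<lambda>t. F t \<omega>) (at t)) \<in> borel_measurable borel"
    using \<omega> by (measurable, measurable, intro vector_derivative_measurable F_cont)
  have "(LBINT t:{0..T}. vector_derivative (\<lambda>t. F t \<omega>) (at t) / F t \<omega> - cnj (vector_derivative (\<lambda>t. F t \<omega>) (at t) / F t \<omega>))
    = (LBINT t:{0..T}. 2 * \<i> * complex_of_real (Im (deriv_F t \<omega> / F t \<omega>)))"
    unfolding set_lebesgue_integral_def
  proof (rule integral_cong_AE)
    show "AE x in lborel. indicat_real {0..T} x *\<^sub>R (vector_derivative (\<lambda>t. F t \<omega>) (at x) / F x \<omega> - cnj (vector_derivative (\<lambda>t. F t \<omega>) (at x) / F x \<omega>)) =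
         indicat_real {0..T} x *\<^sub>R (2 * \<i> * complex_of_real (Im (deriv_F x \<omega> / F x \<omega>)))"
      using D
    proof eventually_elim
      case (elim x)
      show ?case using vector_derivative_at[OF elim] complex_diff_cnj[of "deriv_F x \<omega> / F x \<omega>"] by (simp add: mult_ac)
    qed
  qed measurable
  also have "\<dots> = 2 * \<i> * (LBINT t:{0..T}. complex_of_real (Im (deriv_F t \<omega> / F t \<omega>)))" by simp
  also have "(LBINT t:{0..T}. complex_of_real (Im (deriv_F t \<omega> / F t \<omega>))) = complex_of_real (LBINT t:{0..T}. Im (deriv_F t \<omega> / F t \<omega>))"
    by (rule set_integral_complex_of_real)
  finally show "winding (\<lambda>t. F t \<omega>) T = complex_of_real (LBINT t:{0..T}. Im (deriv_F t \<omega> / F t \<omega>))"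
    unfolding winding_def by simp
qed

end

section \<open>Fourier transforms of the spectral measure\<close>

text \<open>Time is rescaled to [0, 1], so that averages over [0, T] become expectations for a fixed
  probability measure and T remains only as a parameter of the integrand.\<close>

definition unit_lebesgue :: "real measure" where
  "unit_lebesgue = density lborel (indicator {0..1})"

abbreviation unit_square :: "(real \<times> real) measure" where
  "unit_square \<equiv> unit_lebesgue \<Otimes>\<^sub>M unit_lebesgue"

lemma sets_unit_lebesgue[simp, measurable_cong]: "sets unit_lebesgue = sets borel"
  by (simp add: unit_lebesgue_def)

lemma space_unit_lebesgue[simp]: "space unit_lebesgue = UNIV"
  by (simp add: unit_lebesgue_def)

interpretation unitL: prob_space unit_lebesgue
  by (rule prob_spaceI) (simp add: unit_lebesgue_def emeasure_density)

lemma integral_unit_lebesgue: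
  fixes g :: "real \<Rightarrow> 'b::{banach, second_countable_topology}"
  assumes [measurable]: "g \<in> borel_measurable borel"
  shows "(\<integral>u. g u \<partial>unit_lebesgue) = (LBINT u:{0..1}. g u)"
    "integrable unit_lebesgue g \<longleftrightarrow> set_integrable lborel {0..1} g"
proof -
  have eq: "unit_lebesgue = density lborel (\<lambda>x. ennreal (indicator {0..1} x))"
    unfolding unit_lebesgue_def by (intro arg_cong2[where f=density] refl ext) (auto simp: indicator_def)
  show "(\<integral>u. g u \<partial>unit_lebesgue) = (LBINT u:{0..1}. g u)"
    unfolding eq by (subst integral_density) (auto simp: set_lebesgue_integral_def)
  show "integrable unit_lebesgue g \<longleftrightarrow> set_integrable lborel {0..1} g"
    unfolding eq by (subst integrable_density) (auto simp: set_integrable_def)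
qed

lemma norm_integral_fourier_mode_le:
  assumes "x \<noteq> 0" "T > 0"
  shows "cmod (\<integral>u. fourier_mode (T * u) x \<partial>unit_lebesgue) \<le> 2 / (T * \<bar>x\<bar>)"
proof -
  define c where "c = - \<i> * complex_of_real (T * x)"
  have c: "c \<noteq> 0" "cmod c = T * \<bar>x\<bar>" using assms by (auto simp: c_def norm_mult abs_mult)
  have fm: "fourier_mode (T * u) x = exp (c * complex_of_real u)" for u
    by (simp add: fourier_mode_def c_def algebra_simps)
  have "(\<integral>u. fourier_mode (T * u) x \<partial>unit_lebesgue) = (LBINT u:{0..1}. exp (c * complex_of_real u))"
    unfolding fm by (rule integral_unit_lebesgue) (intro borel_measurable_continuous_onI continuous_intros)
  also have "\<dots> = exp (c * complex_of_real 1) / c - exp (c * complex_of_real 0) / c"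
    unfolding set_lebesgue_integral_def
  proof (rule integral_FTC_Icc)
    show "continuous_on {0..1} (\<lambda>u. exp (c * complex_of_real u))" by (intro continuous_intros)
    fix u :: real
    have "((\<lambda>z. exp (c * z) / c) has_field_derivative exp (c * complex_of_real u)) (at (complex_of_real u))"
      using c(1) by (auto intro!: derivative_eq_intros)
    then show "((\<lambda>u. exp (c * complex_of_real u) / c) has_vector_derivative exp (c * complex_of_real u)) (at u within {0..1})"
      by (rule has_vector_derivative_at_within[OF has_vector_derivative_real_field])
  qed simp
  also have "cmod \<dots> \<le> 2 / (T * \<bar>x\<bar>)"
  proof -
    have "cmod (exp (c * complex_of_real 1)) = 1" by (simp add: c_def)
    then have "cmod (exp (c * complex_of_real 1) - 1) \<le> 2"
      using norm_triangle_ineq4[of "exp (c * complex_of_real 1)" 1] by simp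
    then have "cmod ((exp (c * complex_of_real 1) - 1) / c) \<le> 2 / (T * \<bar>x\<bar>)"
      unfolding norm_divide c(2) using assms by (intro divide_right_mono) auto
    then show ?thesis by (simp add: diff_divide_distrib)
  qed
  finally show ?thesis .
qed

lemma abs_sinc_le: "\<bar>sinc x\<bar> \<le> 1"
  using abs_sin_x_le_abs_x[of x] by (auto simp: divide_simps)

section \<open>Wiener averages and the quadratic lower bound for the covariance defect\<close>

context stationary_gaussian
begin

sublocale RR: pair_prob_space \<rho> \<rho> ..

abbreviation rho_square :: "(real \<times> real) measure" where
  "rho_square \<equiv> \<rho> \<Otimes>\<^sub>M \<rho>"

lemma rho_sets[measurable_cong]: "sets \<rho> = sets borel" by simp

lemma null_countable:
  assumes "countable C"
  shows "AE l in \<rho>. l \<notin> C"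
proof -
  have "{x} \<in> null_sets \<rho>" for x
    using no_atoms[of x] by (auto simp: null_sets_def rho.emeasure_eq_measure)
  then have "(\<Union>x\<in>C. {x}) \<in> null_sets \<rho>" using assms by (intro null_sets_UN') auto
  then have "C \<in> null_sets \<rho>" by simp
  then show ?thesis by (rule AE_not_in)
qed

text \<open>Absence of atoms in the form used twice below: the difference of two independent
  frequencies almost surely avoids any given countable set.\<close>

lemma AE_diff_notin_countable:
  assumes "countable C"
  shows "AE p in rho_square. fst p - snd p \<notin> C"
proof (rule RR.AE_pair_measure)
  have [measurable]: "C \<in> sets borel" by (rule sets.countable) (use assms in auto)
  show "{p \<in> space rho_square. fst p - snd p \<notin> C} \<in> sets rho_square" by measurable
  show "AE x in \<rho>. AE y in \<rho>. fst (x, y) - snd (x, y) \<notin> C"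
  proof (rule AE_I2)
    fix x
    have "AE y in \<rho>. y \<notin> (\<lambda>c. x - c) ` C" using assms by (intro null_countable countable_image)
    then show "AE y in \<rho>. fst (x, y) - snd (x, y) \<notin> C"
      by eventually_elim (auto simp: image_iff algebra_simps)
  qed
qed

lemma pair_integral_product:
  fixes f g :: "real \<Rightarrow> complex"
  assumes f: "integrable \<rho> f" and g: "integrable \<rho> g"
  shows "integrable rho_square (\<lambda>p. f (fst p) * g (snd p))"
    "(\<integral>p. f (fst p) * g (snd p) \<partial>rho_square) = (\<integral>x. f x \<partial>\<rho>) * (\<integral>x. g x \<partial>\<rho>)"
proof -
  note [measurable] = borel_measurable_integrable[OF f] borel_measurable_integrable[OF g]
  show i: "integrable rho_square (\<lambda>p. f (fst p) * g (snd p))"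
    using f g by (intro RR.Fubini_integrable) (auto simp: norm_mult)
  show "(\<integral>p. f (fst p) * g (snd p) \<partial>rho_square) = (\<integral>x. f x \<partial>\<rho>) * (\<integral>x. g x \<partial>\<rho>)"
    using RR.integral_fst'[OF i] by simp
qed

text \<open>With the weights 1, \<open>centered_freq\<close> and \<open>centered_freq_sq\<close>,
  these transforms are, up to a factor of modulus 1, all covariances between the process and its
  centred derivative.\<close>

definition weighted_ft :: "(real \<Rightarrow> real) \<Rightarrow> real \<Rightarrow> complex" where
  "weighted_ft h t = (\<integral>l. complex_of_real (h l) * fourier_mode t l \<partial>\<rho>)"

lemma weighted_ft_integrable: "integrable \<rho> h \<Longrightarrow> integrable \<rho> (\<lambda>l. complex_of_real (h l) * fourier_mode t l)"
  by (rule Bochner_Integration.integrable_bound[of _ h]) (auto simp: norm_mult)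

lemma weighted_ft_measurable[measurable]:
  assumes [measurable]: "h \<in> borel_measurable borel"
  shows "weighted_ft h \<in> borel_measurable borel"
  unfolding weighted_ft_def by measurable

text \<open>The squared modulus is a product of two copies of the integral, so the phase sees only
  the difference of two independent frequencies.\<close>

lemma norm_weighted_ft_sq:
  assumes h: "integrable \<rho> h"
  shows "complex_of_real ((cmod (weighted_ft h t))\<^sup>2) =
    (\<integral>p. complex_of_real (h (fst p) * h (snd p)) * fourier_mode t (fst p - snd p) \<partial>rho_square)"
    "integrable rho_square (\<lambda>p. complex_of_real (h (fst p) * h (snd p)) * fourier_mode t (fst p - snd p))"
proof -
  note i = weighted_ft_integrable[OF h, of t]
  have j: "integrable \<rho> (\<lambda>l. cnj (complex_of_real (h l) * fourier_mode t l))"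
    using integrable_cnj[OF i] by simp
  have eq: "complex_of_real (h x * h y) * fourier_mode t (x - y) =
     (complex_of_real (h x) * fourier_mode t x) * cnj (complex_of_real (h y) * fourier_mode t y)" for x y
    by (simp add: fourier_mode_def exp_cnj exp_add[symmetric] exp_diff[symmetric] algebra_simps)
  show "integrable rho_square (\<lambda>p. complex_of_real (h (fst p) * h (snd p)) * fourier_mode t (fst p - snd p))"
    unfolding eq by (rule pair_integral_product(1)[OF i j])
  show "complex_of_real ((cmod (weighted_ft h t))\<^sup>2) =
    (\<integral>p. complex_of_real (h (fst p) * h (snd p)) * fourier_mode t (fst p - snd p) \<partial>rho_square)"
    unfolding eq complex_norm_square weighted_ft_def by (simp only: pair_integral_product(2)[OF i j] Bochner_Integration.integral_cnj)
qed

lemma norm_weighted_ft_le: "integrable \<rho> h \<Longrightarrow> cmod (weighted_ft h t) \<le> (\<integral>l. \<bar>h l\<bar> \<partial>\<rho>)"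
  unfolding weighted_ft_def by (rule order_trans[OF integral_norm_bound]) (simp add: norm_mult)

text \<open>Wiener's lemma in rescaled form: the double average over \<open>[0, T]\<^sup>2\<close> is written over the unit square.\<close>

lemma wiener:
  assumes h: "integrable \<rho> h"
  shows "((\<lambda>T. \<integral>u. \<integral>v. (cmod (weighted_ft h (T * (u - v))))\<^sup>2 \<partial>unit_lebesgue \<partial>unit_lebesgue) \<longlongrightarrow> 0) at_top"
proof -
  have [measurable]: "h \<in> borel_measurable borel" using borel_measurable_integrable[OF h] by simp
  interpret UU: pair_prob_space unit_lebesgue unit_lebesgue ..
  interpret UR: pair_prob_space "unit_square" "rho_square" ..
  have fm[measurable (raw)]: "(\<lambda>x. fourier_mode (a x) (b x)) \<in> borel_measurable N"
    if [measurable]: "a \<in> borel_measurable N" "b \<in> borel_measurable N" for a b and N :: "'n measure"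
    using measurable_compose[OF measurable_Pair[OF that] fourier_mode_measurable] by simp
  define J where "J T x = (\<integral>u. fourier_mode (T * u) x \<partial>unit_lebesgue)" for T x
  have [measurable]: "J T \<in> borel_measurable borel" for T unfolding J_def by measurable
  have J1: "cmod (J T x) \<le> 1" for T x
  proof -
    have "cmod (J T x) \<le> (\<integral>u. cmod (fourier_mode (T * u) x) \<partial>unit_lebesgue)"
      unfolding J_def by (rule integral_norm_bound)
    also have "\<dots> = 1" using unitL.prob_space by simp
    finally show ?thesis .
  qed
  define H where "H p = h (fst p) * h (snd p)" for p
  have H_int: "integrable rho_square H"
  proof -
    have "integrable rho_square (\<lambda>p. complex_of_real (H p))"
      using norm_weighted_ft_sq(2)[OF h, of 0] by (simp add: H_def fourier_mode_def)
    then show ?thesis by (simp only: complex_of_real_integrable_eq)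
  qed
  have [measurable]: "H \<in> borel_measurable (borel \<Otimes>\<^sub>M borel)" unfolding H_def by measurable
  have J_eq: "(\<integral>q. fourier_mode (T * (fst q - snd q)) x \<partial>unit_square) = complex_of_real ((cmod (J T x))\<^sup>2)" for T x
  proof -
    have i: "integrable unit_square (\<lambda>q. fourier_mode (T * fst q) x * cnj (fourier_mode (T * snd q) x))"
      by (rule UU.P.integrable_const_bound[where B=1]) (auto simp: norm_mult)
    have "(\<integral>q. fourier_mode (T * (fst q - snd q)) x \<partial>unit_square) =
      (\<integral>q. fourier_mode (T * fst q) x * cnj (fourier_mode (T * snd q) x) \<partial>unit_square)"
      by (simp add: fourier_mode_mult_cnj right_diff_distrib)
    also have "\<dots> = J T x * cnj (J T x)"
      using UU.integral_fst'[OF i] by (simp add: J_def)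
    finally show ?thesis by (simp add: complex_norm_square del: of_real_power)
  qed
  \<comment> \<open>After Fubini the time average acts on the phase alone and leaves the squared
    modulus of \<open>J\<close>. This is bounded and tends to 0 at nonzero frequency differences,
    hence almost everywhere because no atoms exist.\<close>
  have main: "(\<integral>u. \<integral>v. (cmod (weighted_ft h (T * (u - v))))\<^sup>2 \<partial>unit_lebesgue \<partial>unit_lebesgue) = (\<integral>p. H p * (cmod (J T (fst p - snd p)))\<^sup>2 \<partial>rho_square)" for T
  proof -
    have i1: "integrable unit_square (\<lambda>q. (cmod (weighted_ft h (T * (fst q - snd q))))\<^sup>2)"
      by (rule UU.P.integrable_const_bound[where B="(\<integral>l. \<bar>h l\<bar> \<partial>\<rho>)\<^sup>2"]) (auto intro!: power_mono norm_weighted_ft_le h)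
    have i2: "integrable (unit_square \<Otimes>\<^sub>M rho_square)
        (\<lambda>(q, p). complex_of_real (H p) * fourier_mode (T * (fst q - snd q)) (fst p - snd p))"
    proof (rule UR.Fubini_integrable)
      show "integrable unit_square (\<lambda>q. \<integral>p. norm (case (q, p) of (q, p) \<Rightarrow> complex_of_real (H p) * fourier_mode (T * (fst q - snd q)) (fst p - snd p)) \<partial>rho_square)"
        by (simp add: norm_mult)
      show "AE q in unit_square. integrable rho_square (\<lambda>p. case (q, p) of (q, p) \<Rightarrow> complex_of_real (H p) * fourier_mode (T * (fst q - snd q)) (fst p - snd p))"
        using norm_weighted_ft_sq(2)[OF h] by (simp add: H_def)
    qed measurable
    have "complex_of_real (\<integral>u. \<integral>v. (cmod (weighted_ft h (T * (u - v))))\<^sup>2 \<partial>unit_lebesgue \<partial>unit_lebesgue)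
      = (\<integral>q. complex_of_real ((cmod (weighted_ft h (T * (fst q - snd q))))\<^sup>2) \<partial>unit_square)"
      using UU.integral_fst'[OF i1] by (simp del: of_real_power)
    also have "\<dots> = (\<integral>q. \<integral>p. complex_of_real (H p) * fourier_mode (T * (fst q - snd q)) (fst p - snd p) \<partial>rho_square \<partial>unit_square)"
      unfolding norm_weighted_ft_sq(1)[OF h] H_def ..
    also have "\<dots> = (\<integral>p. \<integral>q. complex_of_real (H p) * fourier_mode (T * (fst q - snd q)) (fst p - snd p) \<partial>unit_square \<partial>rho_square)"
      by (rule UR.Fubini_integral[OF i2, symmetric])
    also have "\<dots> = (\<integral>p. complex_of_real (H p * (cmod (J T (fst p - snd p)))\<^sup>2) \<partial>rho_square)"
      by (simp add: J_eq del: of_real_power)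
    also have "\<dots> = complex_of_real (\<integral>p. H p * (cmod (J T (fst p - snd p)))\<^sup>2 \<partial>rho_square)"
      by (rule integral_complex_of_real)
    finally show ?thesis by (simp only: of_real_eq_iff)
  qed
  have "((\<lambda>T. \<integral>p. H p * (cmod (J T (fst p - snd p)))\<^sup>2 \<partial>rho_square) \<longlongrightarrow> (\<integral>p. 0 \<partial>rho_square)) at_top"
  proof (rule integral_dominated_convergence_at_top[where w="\<lambda>p. \<bar>H p\<bar>"])
    show "integrable rho_square (\<lambda>p. \<bar>H p\<bar>)" using H_int by simp
    have b: "\<bar>H p * (cmod z)\<^sup>2\<bar> \<le> \<bar>H p\<bar>" if "cmod z \<le> 1" for p z
      using mult_left_mono[OF power_mono[OF that, of 2], of "\<bar>H p\<bar>"] by (simp add: abs_mult)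
    show "\<forall>\<^sub>F T in at_top. AE p in rho_square. norm (H p * (cmod (J T (fst p - snd p)))\<^sup>2) \<le> \<bar>H p\<bar>"
      by (intro always_eventually allI AE_I2) (simp add: b J1)
    show "AE p in rho_square. ((\<lambda>T. H p * (cmod (J T (fst p - snd p)))\<^sup>2) \<longlongrightarrow> 0) at_top"
      using AE_diff_notin_countable[of "{0}", simplified]
    proof eventually_elim
      case (elim p)
      have "((\<lambda>T. 2 / \<bar>fst p - snd p\<bar> * inverse T) \<longlongrightarrow> 2 / \<bar>fst p - snd p\<bar> * 0) at_top"
        by (intro tendsto_intros tendsto_inverse_0_at_top filterlim_ident)
      then have "((\<lambda>T. 2 / \<bar>fst p - snd p\<bar> * inverse T) \<longlongrightarrow> 0) at_top" by simp
      then have "((\<lambda>T. J T (fst p - snd p)) \<longlongrightarrow> 0) at_top"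
      proof (rule Lim_null_comparison[rotated])
        show "\<forall>\<^sub>F T in at_top. norm (J T (fst p - snd p)) \<le> 2 / \<bar>fst p - snd p\<bar> * inverse T"
          using eventually_gt_at_top[of 0]
        proof eventually_elim
          case (elim T)
          then show ?case using norm_integral_fourier_mode_le[of "fst p - snd p" T] \<open>fst p \<noteq> snd p\<close>
            by (simp add: J_def divide_inverse mult_ac)
        qed
      qed
      then have "((\<lambda>T. H p * (cmod (J T (fst p - snd p)))\<^sup>2) \<longlongrightarrow> H p * (cmod 0)\<^sup>2) at_top"
        by (intro tendsto_intros)
      then show ?case by simp
    qed
  qed auto
  then show ?thesis unfolding main by simp
qed

definition cov_r :: "real \<Rightarrow> complex" where "cov_r = weighted_ft (\<lambda>_. 1)"

text \<open>After division by \<tau>^2 the defect is a continuous function \<open>G\<close>, also at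
  0, so its minimum over a compact set of lags is attained. A zero minimum would force the
  difference of two independent frequencies into a countable set.\<close>

lemma cov_r_defect_lower_bound:
  assumes "T > 0"
  shows "\<exists>c>0. \<forall>\<tau>. \<bar>\<tau>\<bar> \<le> T \<longrightarrow> c * \<tau>\<^sup>2 \<le> 1 - (cmod (cov_r \<tau>))\<^sup>2"
proof -
  have one: "integrable \<rho> (\<lambda>_. 1::real)" by simp
  define G where "G \<tau> = (\<integral>p. (sinc (\<tau> * (fst p - snd p) / 2))\<^sup>2 * (fst p - snd p)\<^sup>2 / 2 \<partial>rho_square)" for \<tau>
  have x2: "integrable rho_square (\<lambda>p. (fst p - snd p)\<^sup>2)"
  proof (rule Bochner_Integration.integrable_bound)
    have 1: "integrable rho_square (\<lambda>p. (fst p)\<^sup>2)"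
      using integrable_square by (intro RR.Fubini_integrable) auto
    have 2: "integrable rho_square (\<lambda>p. (snd p)\<^sup>2)"
      using RR.integrable_product_swap[OF 1] by (simp add: case_prod_beta')
    show "integrable rho_square (\<lambda>p. 2 * (fst p)\<^sup>2 + 2 * (snd p)\<^sup>2)" using 1 2 by simp
    have "(x - y)\<^sup>2 \<le> 2 * x\<^sup>2 + 2 * y\<^sup>2" for x y :: real
      using zero_le_power2[of "x + y"] by (simp add: power2_eq_square algebra_simps)
    then show "AE p in rho_square. norm ((fst p - snd p)\<^sup>2) \<le> norm (2 * (fst p)\<^sup>2 + 2 * (snd p)\<^sup>2)" by auto
  qed measurable
  have le: "\<bar>(sinc y)\<^sup>2 * x\<^sup>2 / 2\<bar> \<le> x\<^sup>2" for x y :: real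
  proof -
    have "(sinc y)\<^sup>2 \<le> 1" using abs_sinc_le[of y] by (simp add: abs_square_le_1)
    then have "(sinc y)\<^sup>2 * x\<^sup>2 \<le> 1 * x\<^sup>2" by (intro mult_right_mono) auto
    moreover have "0 \<le> (sinc y)\<^sup>2 * x\<^sup>2" by simp
    ultimately show ?thesis unfolding abs_le_iff by linarith
  qed
  have sinc_m[measurable (raw)]: "(\<lambda>x. sinc (f x)) \<in> borel_measurable N" if "f \<in> borel_measurable N" for f and N :: "'n measure"
    using measurable_compose[OF that borel_measurable_sinc] .
  have G_int: "integrable rho_square (\<lambda>p. (sinc (\<tau> * (fst p - snd p) / 2))\<^sup>2 * (fst p - snd p)\<^sup>2 / 2)" for \<tau>
  proof (rule Bochner_Integration.integrable_bound[OF x2])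
    show "AE p in rho_square. norm ((sinc (\<tau> * (fst p - snd p) / 2))\<^sup>2 * (fst p - snd p)\<^sup>2 / 2) \<le> norm ((fst p - snd p)\<^sup>2)"
      unfolding real_norm_def by (intro AE_I2 order_trans[OF le abs_ge_self])
  qed measurable
  \<comment> \<open>The half-angle formula turns 1 - cos into 2 sin^2; writing the sine through
    \<open>sinc\<close> extracts \<tau>^2 without a singularity at \<tau> = 0.\<close>
  have defect: "1 - (cmod (cov_r \<tau>))\<^sup>2 = \<tau>\<^sup>2 * G \<tau>" for \<tau>
  proof -
    have "complex_of_real ((cmod (cov_r \<tau>))\<^sup>2) = (\<integral>p. fourier_mode \<tau> (fst p - snd p) \<partial>rho_square)"
      unfolding cov_r_def norm_weighted_ft_sq(1)[OF one] by simp
    then have "(cmod (cov_r \<tau>))\<^sup>2 = Re (\<integral>p. fourier_mode \<tau> (fst p - snd p) \<partial>rho_square)"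
      by (metis Re_complex_of_real)
    also have "\<dots> = (\<integral>p. Re (fourier_mode \<tau> (fst p - snd p)) \<partial>rho_square)"
      using norm_weighted_ft_sq(2)[OF one, of \<tau>] by (subst integral_Re) auto
    also have "\<dots> = (\<integral>p. cos (\<tau> * (fst p - snd p)) \<partial>rho_square)"
      by (simp add: fourier_mode_def Re_exp)
    also have "1 - \<dots> = (\<integral>p. 1 - cos (\<tau> * (fst p - snd p)) \<partial>rho_square)"
      using RR.P.prob_space by (subst Bochner_Integration.integral_diff) (auto intro!: RR.P.integrable_const_bound[where B=1])
    also have "\<dots> = (\<integral>p. \<tau>\<^sup>2 * ((sinc (\<tau> * (fst p - snd p) / 2))\<^sup>2 * (fst p - snd p)\<^sup>2 / 2) \<partial>rho_square)"
    proof (intro Bochner_Integration.integral_cong refl)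
      fix p :: "real \<times> real"
      define x where "x = fst p - snd p"
      have "1 - cos (\<tau> * x) = 2 * (sin (\<tau> * x / 2))\<^sup>2"
        using cos_double_sin[of "\<tau> * x / 2"] by simp
      also have "sin (\<tau> * x / 2) = sinc (\<tau> * x / 2) * (\<tau> * x / 2)" by simp
      finally show "1 - cos (\<tau> * (fst p - snd p)) = \<tau>\<^sup>2 * ((sinc (\<tau> * (fst p - snd p) / 2))\<^sup>2 * (fst p - snd p)\<^sup>2 / 2)"
        unfolding x_def[symmetric] by (simp only: power_mult_distrib power_divide) (simp add: field_simps)
    qed
    also have "\<dots> = \<tau>\<^sup>2 * G \<tau>" unfolding G_def by (rule integral_mult_right_zero)
    finally show ?thesis .
  qed
  have "continuous_on {-T..T} G"
    unfolding continuous_on_sequentially comp_def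
  proof (intro allI impI ballI)
    fix x a assume "a \<in> {-T..T}" "(\<forall>n. x n \<in> {-T..T}) \<and> x \<longlonglongrightarrow> a"
    then have x: "x \<longlonglongrightarrow> a" by simp
    show "(\<lambda>n. G (x n)) \<longlonglongrightarrow> G a"
      unfolding G_def
    proof (rule integral_dominated_convergence[OF _ _ x2])
      have cs: "continuous_on UNIV sinc" by (intro continuous_at_imp_continuous_on ballI isCont_sinc)
      have "(\<lambda>n. (sinc (x n * y / 2))\<^sup>2 * y\<^sup>2 / 2) \<longlonglongrightarrow> (sinc (a * y / 2))\<^sup>2 * y\<^sup>2 / 2" for y
        by (intro tendsto_intros isCont_tendsto_compose[OF isCont_sinc] x) auto
      then show "AE p in rho_square. (\<lambda>n. (sinc (x n * (fst p - snd p) / 2))\<^sup>2 * (fst p - snd p)\<^sup>2 / 2) \<longlonglongrightarrow> (sinc (a * (fst p - snd p) / 2))\<^sup>2 * (fst p - snd p)\<^sup>2 / 2"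
        by (intro AE_I2)
      show "AE p in rho_square. norm ((sinc (x n * (fst p - snd p) / 2))\<^sup>2 * (fst p - snd p)\<^sup>2 / 2) \<le> (fst p - snd p)\<^sup>2" for n
        unfolding real_norm_def by (intro AE_I2 le)
    qed measurable
  qed
  then obtain \<tau>0 where \<tau>0: "\<And>\<tau>. \<tau> \<in> {-T..T} \<Longrightarrow> G \<tau>0 \<le> G \<tau>"
    using continuous_attains_inf[of "{-T..T}" G] assms by force
  have "G \<tau>0 > 0"
  proof (rule ccontr)
    have nn: "G \<tau>0 \<ge> 0" unfolding G_def by (intro Bochner_Integration.integral_nonneg) simp
    assume "\<not> G \<tau>0 > 0"
    then have "G \<tau>0 = 0" using nn by simp
    then have z: "AE p in rho_square. (sinc (\<tau>0 * (fst p - snd p) / 2))\<^sup>2 * (fst p - snd p)\<^sup>2 / 2 = 0"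
      unfolding G_def
      by (subst (asm) integral_nonneg_eq_0_iff_AE[OF G_int]) simp_all
    \<comment> \<open>All frequency differences at which the integrand vanishes. For \<tau>0 = 0 the
      quotients are 0 by convention and the set is just {0}, which is right since
      \<open>sinc 0 = 1\<close>.\<close>
    define C where "C = insert 0 (range (\<lambda>k::int. 2 * (of_int k * pi) / \<tau>0))"
    have "AE p in rho_square. fst p - snd p \<notin> C" by (rule AE_diff_notin_countable) (simp add: C_def)
    with z have "AE p in rho_square. False"
    proof eventually_elim
      case (elim p)
      define x where "x = fst p - snd p"
      have x: "x \<notin> C" "x \<noteq> 0" using elim by (auto simp: x_def C_def)
      then have "sinc (\<tau>0 * x / 2) = 0" using elim(1) unfolding x_def[symmetric] by simp
      then have "\<tau>0 * x / 2 \<noteq> 0" "sin (\<tau>0 * x / 2) = 0" by (auto split: if_splits)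
      then obtain k :: int where "\<tau>0 * x / 2 = of_int k * pi" "\<tau>0 \<noteq> 0" by (auto simp: sin_zero_iff_int2)
      then have "x = 2 * (of_int k * pi) / \<tau>0" by (simp add: field_simps)
      then show False using x by (auto simp: C_def)
    qed
    then show False using RR.P.not_empty by simp
  qed
  then show ?thesis using \<tau>0 defect
    by (intro exI[of _ "G \<tau>0"]) (auto simp: mult.commute[of "G \<tau>0"] abs_le_iff intro!: mult_left_mono)
qed

end

section \<open>The kernel of the winding rate\<close>

text \<open>Two applications of Young's inequality with y = x powr (-3/8). Conjugate exponents 9 and
  9/8 separate \<open>A\<close> from 1/x = y powr (8/3) and leave y^3; then y^3 \<le> k y^2 + y^4 /
  k. Later x is |F t F s| and s is the square root of the defect, a choice that makes the
  expectations of the last two terms equally large.\<close>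

lemma young_negative_power:
  fixes A x s :: real
  assumes A: "0 \<le> A" and x: "0 < x" and s: "0 < s"
  shows "A / x \<le> A ^ 9 + s powr (-3/4) * x powr (-3/4) + s powr (3/4) * x powr (-3/2)"
proof -
  define y where "y = x powr (-3/8)"
  have y: "0 < y" using x by (simp add: y_def)
  have y2: "y\<^sup>2 = x powr (-3/4)" "(y\<^sup>2)\<^sup>2 = x powr (-3/2)" using x by (simp_all add: y_def powr_powr flip: powr_numeral)
  have x1: "1 / x = y powr (8/3)"
  proof -
    have "y powr (8/3) = x powr (-3/8 * (8/3))" by (simp only: y_def powr_powr)
    also have "-3/8 * (8/3) = (-1::real)" by simp
    finally show ?thesis using x by (simp add: powr_minus_divide)
  qed
  have 1: "A / x \<le> A ^ 9 + y ^ 3"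
  proof (cases "A \<le> y powr (1/3)")
    case True
    have "A / x = A * (1 / x)" by simp
    also have "\<dots> = A * y powr (8/3)" by (simp only: x1)
    also have "\<dots> \<le> y powr (1/3) * y powr (8/3)" using True by (intro mult_right_mono) auto
    also have "\<dots> = y ^ 3" using y by (simp add: powr_add[symmetric] flip: powr_numeral)
    finally show ?thesis using A by (simp add: add_increasing)
  next
    case False
    then have "(y powr (1/3)) ^ 8 \<le> A ^ 8" by (intro power_mono) auto
    also have "(y powr (1/3)) ^ 8 = y powr (8/3)" using y by (simp add: powr_powr flip: powr_numeral)
    finally have "y powr (8/3) \<le> A ^ 8" .
    then have "A * y powr (8/3) \<le> A * A ^ 8" using A by (intro mult_left_mono)
    also have "A * y powr (8/3) = A / x" unfolding x1[symmetric] by simp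
    also have "A * A ^ 8 = A ^ 9" by (simp flip: power_Suc)
    finally have "A / x \<le> A ^ 9" .
    then show ?thesis using y by (simp add: add_increasing2)
  qed
  define k where "k = s powr (-3/4)"
  have k: "0 < k" "1 / k = s powr (3/4)" using s by (auto simp: k_def powr_minus_divide)
  \<comment> \<open>Expands to k y^2 + y^4 / k - y^3, the second application with weight k = s powr
    (-3/4).\<close>
  have "0 \<le> y\<^sup>2 * ((k - y)\<^sup>2 / k + y)" using k y by (intro mult_nonneg_nonneg add_nonneg_nonneg) auto
  also have "\<dots> = k * y\<^sup>2 + (1 / k) * (y\<^sup>2)\<^sup>2 - y ^ 3"
    using k by (simp add: power2_eq_square power3_eq_cube field_simps)
  finally show ?thesis using 1 unfolding y2(2) unfolding y2(1) k(2) unfolding k_def by linarith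
qed

text \<open>Compare \<open>x\<close> with the square root of 1/y: below it x/y is at most y powr
  (-3/2), above it x/y is at most x^3 \<le> 1 + x^4. Only moments already available appear.\<close>

lemma ratio_bound:
  fixes x y :: real
  assumes "0 \<le> x" "0 \<le> y"
  shows "x / y \<le> 1 + x ^ 4 + y powr (-3/2)"
proof (cases "y = 0")
  case False
  then have y: "0 < y" using assms by simp
  define z where "z = 1 / y"
  have z: "0 < z" "z powr (3/2) = y powr (-3/2)" using y by (auto simp: z_def powr_divide powr_minus_divide)
  have x3: "x ^ 3 \<le> 1 + x ^ 4"
  proof (cases "x \<le> 1")
    case True
    then have "x ^ 3 \<le> 1" using assms by (simp add: power_le_one)
    then show ?thesis using assms by (simp add: add_increasing2)
  next
    case False
    then have "x ^ 3 \<le> x ^ 4" by (intro power_increasing) auto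
    then show ?thesis by simp
  qed
  show ?thesis
  proof (cases "x \<le> sqrt z")
    case True
    have "x * z \<le> sqrt z * z" using True z by (intro mult_right_mono) auto
    also have "\<dots> = z powr (1/2) * z powr 1" using z by (simp add: powr_half_sqrt)
    also have "\<dots> = z powr (3/2)" by (simp only: powr_add[symmetric]) simp
    finally have "x / y \<le> y powr (-3/2)" using z by (simp add: z_def)
    moreover have "0 \<le> x ^ 4" by simp
    ultimately show ?thesis by linarith
  next
    case False
    then have "z \<le> x\<^sup>2" using z assms real_le_lsqrt[of z x] by (metis less_eq_real_def linorder_not_less real_sqrt_le_iff real_sqrt_unique)
    then have "x * z \<le> x ^ 3" using assms mult_left_mono[of z "x\<^sup>2" x] by (simp add: power2_eq_square power3_eq_cube mult.assoc)
    then have "x / y \<le> x ^ 3" using z by (simp add: z_def)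
    moreover have "0 \<le> y powr (-3/2)" by simp
    ultimately show ?thesis using x3 by linarith
  qed
qed (use assms in auto)

section \<open>The centred derivative and the kernel near the diagonal\<close>

context stationary_gaussian
begin

definition mean_frequency :: real where "mean_frequency = (\<integral>l. l \<partial>\<rho>)"
definition centered_freq :: "real \<Rightarrow> real" where "centered_freq l = l - mean_frequency"
definition centered_freq_sq :: "real \<Rightarrow> real" where "centered_freq_sq l = (l - mean_frequency)\<^sup>2"

text \<open>The residual of the derivative after regression on the process at the same time: the
  symbol of the derivative is -i l times the Fourier mode, so adding i times the mean frequency
  replaces l by a weight of mean 0.\<close>

definition centered :: "real \<Rightarrow> 'a \<Rightarrow> complex" where
  "centered t \<omega> = deriv_F t \<omega> + \<i> * complex_of_real mean_frequency * F t \<omega>"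

definition centered_mode :: "real \<Rightarrow> real \<Rightarrow> complex" where
  "centered_mode t l = - \<i> * complex_of_real (centered_freq l) * fourier_mode t l"

lemma centered_measurable[measurable (raw)]:
  assumes [measurable]: "f \<in> borel_measurable N" "g \<in> measurable N M"
  shows "(\<lambda>x. centered (f x) (g x)) \<in> borel_measurable N"
  unfolding centered_def by measurable

lemma represents_centered: "represents (centered t) (centered_mode t)"
  using represents_lincomb[OF represents_deriv_F[of t] represents_F[of t], of 1 "\<i> * complex_of_real mean_frequency"]
  by (simp add: centered_def[abs_def] centered_mode_def[abs_def] deriv_mode_def centered_freq_def algebra_simps)

lemma integrable_freq: "integrable \<rho> (\<lambda>l. l)"
proof (rule Bochner_Integration.integrable_bound)
  show "integrable \<rho> (\<lambda>l. 1 + l\<^sup>2)" using integrable_square by simp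
  have "\<bar>l\<bar> \<le> 1 + l\<^sup>2" for l :: real using zero_le_power2[of "\<bar>l\<bar> - 1"] by (simp add: power2_diff) 
  then show "AE l in \<rho>. norm l \<le> norm (1 + l\<^sup>2)" by auto
qed auto

lemma integrable_centered_freq: "integrable \<rho> centered_freq" "integrable \<rho> centered_freq_sq"
  using integrable_freq integrable_square
  by (auto simp: centered_freq_def[abs_def] centered_freq_sq_def[abs_def] power2_diff)

lemma centered_freq_measurable[measurable]: "centered_freq \<in> borel_measurable borel" "centered_freq_sq \<in> borel_measurable borel"
  unfolding centered_freq_def centered_freq_sq_def by measurable

lemma cov_r_0: "cov_r 0 = 1"
  using rho.prob_space by (simp add: cov_r_def weighted_ft_def fourier_mode_def)

lemma weighted_ft_centered_freq_0: "weighted_ft centered_freq 0 = 0"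
proof -
  have "weighted_ft centered_freq 0 = complex_of_real (\<integral>l. centered_freq l \<partial>\<rho>)"
    by (simp add: weighted_ft_def fourier_mode_def)
  also have "(\<integral>l. centered_freq l \<partial>\<rho>) = 0"
    using integrable_freq rho.prob_space by (simp add: centered_freq_def mean_frequency_def)
  finally show ?thesis by simp
qed

lemma weighted_ft_minus: "weighted_ft h (- t) = cnj (weighted_ft h t)"
  unfolding weighted_ft_def Bochner_Integration.integral_cnj[symmetric]
  by (simp add: fourier_mode_def exp_cnj)

lemma inner_modes:
  "(\<integral>l. fourier_mode t l * cnj (fourier_mode s l) \<partial>\<rho>) = cov_r (t - s)"
  "(\<integral>l. centered_mode t l * cnj (fourier_mode s l) \<partial>\<rho>) = - \<i> * weighted_ft centered_freq (t - s)"
  "(\<integral>l. fourier_mode t l * cnj (centered_mode s l) \<partial>\<rho>) = \<i> * weighted_ft centered_freq (t - s)"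
  "(\<integral>l. centered_mode t l * cnj (centered_mode s l) \<partial>\<rho>) = weighted_ft centered_freq_sq (t - s)"
proof -
  show "(\<integral>l. fourier_mode t l * cnj (fourier_mode s l) \<partial>\<rho>) = cov_r (t - s)"
    by (simp add: cov_r_def weighted_ft_def fourier_mode_mult_cnj)
  have "centered_mode t l * cnj (fourier_mode s l) = - \<i> * (complex_of_real (centered_freq l) * fourier_mode (t - s) l)" for l
    by (simp add: centered_mode_def fourier_mode_mult_cnj[symmetric])
  then show "(\<integral>l. centered_mode t l * cnj (fourier_mode s l) \<partial>\<rho>) = - \<i> * weighted_ft centered_freq (t - s)"
    by (simp add: weighted_ft_def)
  have "fourier_mode t l * cnj (centered_mode s l) = \<i> * (complex_of_real (centered_freq l) * fourier_mode (t - s) l)" for l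
    by (simp add: centered_mode_def fourier_mode_mult_cnj[symmetric])
  then show "(\<integral>l. fourier_mode t l * cnj (centered_mode s l) \<partial>\<rho>) = \<i> * weighted_ft centered_freq (t - s)"
    by (simp add: weighted_ft_def)
  have "centered_mode t l * cnj (centered_mode s l) = complex_of_real (centered_freq_sq l) * fourier_mode (t - s) l" for l
  proof -
    have "centered_freq_sq l = centered_freq l * centered_freq l" by (simp add: centered_freq_def centered_freq_sq_def power2_eq_square)
    then show ?thesis
      by (simp add: centered_mode_def fourier_mode_mult_cnj[symmetric] algebra_simps)
  qed
  then show "(\<integral>l. centered_mode t l * cnj (centered_mode s l) \<partial>\<rho>) = weighted_ft centered_freq_sq (t - s)"
    by (simp add: weighted_ft_def)
qed

lemma inner_lincomb:
  assumes "square_integrable \<rho> \<phi>" "square_integrable \<rho> \<psi>" "square_integrable \<rho> \<theta>"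
  shows "(\<integral>l. (a * \<phi> l + b * \<psi> l) * cnj (\<theta> l) \<partial>\<rho>) = a * (\<integral>l. \<phi> l * cnj (\<theta> l) \<partial>\<rho>) + b * (\<integral>l. \<psi> l * cnj (\<theta> l) \<partial>\<rho>)"
    "(\<integral>l. \<theta> l * cnj (a * \<phi> l + b * \<psi> l) \<partial>\<rho>) = cnj a * (\<integral>l. \<theta> l * cnj (\<phi> l) \<partial>\<rho>) + cnj b * (\<integral>l. \<theta> l * cnj (\<psi> l) \<partial>\<rho>)"
proof -
  note i = square_integrable_mult(2)[OF assms(1,3)] square_integrable_mult(2)[OF assms(2,3)]
    square_integrable_mult(2)[OF assms(3,1)] square_integrable_mult(2)[OF assms(3,2)]
  show "(\<integral>l. (a * \<phi> l + b * \<psi> l) * cnj (\<theta> l) \<partial>\<rho>) = a * (\<integral>l. \<phi> l * cnj (\<theta> l) \<partial>\<rho>) + b * (\<integral>l. \<psi> l * cnj (\<theta> l) \<partial>\<rho>)"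
    using i by (simp add: distrib_right mult.assoc)
  have "\<theta> l * cnj (a * \<phi> l + b * \<psi> l) = cnj a * (\<theta> l * cnj (\<phi> l)) + cnj b * (\<theta> l * cnj (\<psi> l))" for l
    by (simp add: algebra_simps)
  then show "(\<integral>l. \<theta> l * cnj (a * \<phi> l + b * \<psi> l) \<partial>\<rho>) = cnj a * (\<integral>l. \<theta> l * cnj (\<phi> l) \<partial>\<rho>) + cnj b * (\<integral>l. \<theta> l * cnj (\<psi> l) \<partial>\<rho>)"
    using i by simp
qed

text \<open>The conditional variance of the process at one time given its value at another, at lag
  \<open>t\<close>.\<close>

definition defect :: "real \<Rightarrow> real" where "defect t = 1 - (cmod (cov_r t))\<^sup>2"

lemma defect_minus: "defect (- t) = defect t"
  unfolding defect_def cov_r_def weighted_ft_minus by simp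

lemma defect_le_1: "defect t \<le> 1"
  by (simp add: defect_def)

lemma defect_pos:
  assumes "t \<noteq> 0"
  shows "0 < defect t"
proof -
  obtain c where c: "c > 0" "\<And>\<tau>. \<bar>\<tau>\<bar> \<le> \<bar>t\<bar> \<Longrightarrow> c * \<tau>\<^sup>2 \<le> 1 - (cmod (cov_r \<tau>))\<^sup>2"
    using cov_r_defect_lower_bound[of "\<bar>t\<bar>"] assms by auto
  have "0 < c * t\<^sup>2" using c(1) assms by simp
  also have "\<dots> \<le> defect t" unfolding defect_def by (rule c(2)) simp
  finally show ?thesis .
qed

lemma cov_r_minus: "cov_r (- t) = cnj (cov_r t)"
  unfolding cov_r_def by (rule weighted_ft_minus)

lemma cov_r_mult_minus: "cov_r t * cov_r (- t) = 1 - complex_of_real (defect t)"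
  unfolding cov_r_minus defect_def of_real_diff of_real_1 complex_norm_square by simp

lemma F_neg_moment: "(\<integral>\<^sup>+\<omega>. ennreal (cmod (F t \<omega>) powr (-3/2)) \<partial>M) \<le> 162"
proof -
  have "(\<integral>\<^sup>+\<omega>. ennreal (cmod (F t \<omega>) powr (-3/2)) \<partial>M) = (\<integral>\<^sup>+z. ennreal (cmod (0 + complex_of_real 1 * z) powr (-3/2)) \<partial>std_complex_normal)"
    using represents_nn_integral[OF represents_F[of t], of "\<lambda>z. ennreal (cmod z powr (-3/2))"] rho.prob_space by simp
  also have "\<dots> \<le> ennreal (162 * 1 powr (-3/2))" by (rule std_complex_normal_neg_moment) simp
  finally show ?thesis by simp
qed

text \<open>F s is c F t plus an independent Gaussian \<open>W\<close> of variance equal to the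
  defect. Integrating \<open>W\<close> out first, with the negative moment bound uniform in the
  shift c z, gives sqrt d powr (-3/2) = d powr (-3/4); the remaining factor is a one-point
  moment.\<close>

lemma F_pair_neg_moment:
  assumes ts: "t \<noteq> s"
  shows "(\<integral>\<^sup>+\<omega>. ennreal (cmod (F t \<omega>) powr (-3/2) * cmod (F s \<omega>) powr (-3/2)) \<partial>M) \<le>
    ennreal (162\<^sup>2 * defect (t - s) powr (-3/4))"
proof -
  define c where "c = cov_r (s - t)"
  define d where "d = defect (t - s)"
  have d: "0 < d" using ts defect_pos[of "t - s"] by (simp add: d_def)
  define W where "W \<omega> = 1 * F s \<omega> + (- c) * F t \<omega>" for \<omega>
  define \<psi> where "\<psi> l = 1 * fourier_mode s l + (- c) * fourier_mode t l" for l
  have W: "represents W \<psi>" unfolding W_def[abs_def] \<psi>_def[abs_def] by (intro represents_lincomb represents_F)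
  have [measurable]: "W \<in> borel_measurable M" using representsD(1)[OF W] .
  note sq = representsD(2)[OF represents_F]
  have o1: "(\<integral>l. fourier_mode t l * cnj (\<psi> l) \<partial>\<rho>) = 0"
    unfolding \<psi>_def inner_lincomb(2)[OF sq sq sq] inner_modes
    using cov_r_minus[of "s - t"] by (simp add: c_def cov_r_0)
  have "complex_of_real (\<integral>l. (cmod (\<psi> l))\<^sup>2 \<partial>\<rho>) = (\<integral>l. \<psi> l * cnj (\<psi> l) \<partial>\<rho>)"
    unfolding integral_complex_of_real[symmetric] complex_norm_square ..
  also have "\<dots> = (\<integral>l. fourier_mode s l * cnj (\<psi> l) \<partial>\<rho>)"
    by (subst (1) \<psi>_def) (simp only: inner_lincomb(1)[OF sq sq representsD(2)[OF W]] o1, simp)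
  also have "\<dots> = complex_of_real d"
    unfolding \<psi>_def inner_lincomb(2)[OF sq sq sq] inner_modes
    using cov_r_mult_minus[of "s - t"] cov_r_minus[of "s - t"] defect_minus[of "s - t"]
    by (simp add: c_def cov_r_0 d_def mult.commute)
  finally have nW: "(\<integral>l. (cmod (\<psi> l))\<^sup>2 \<partial>\<rho>) = d" by (simp only: of_real_eq_iff)
  have law: "distr M borel (\<lambda>\<omega>. (F t \<omega>, W \<omega>)) = distr M borel (F t) \<Otimes>\<^sub>M distr M borel W"
  proof (rule represents_independent[OF _ _ represents_scale[OF represents_F] _ represents_scale[OF W]])
    fix u v
    show "(\<integral>l. cnj u * fourier_mode t l * cnj (cnj v * \<psi> l) \<partial>\<rho>) = 0"
      using o1 square_integrable_mult(2)[OF sq representsD(2)[OF W]]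
      by (simp add: mult_ac)
  qed (auto simp: inner_complex_def)
  interpret DW: prob_space "distr M borel W" by (rule prob_space_distr) simp
  define G where "G z w = ennreal (cmod z powr (-3/2) * cmod (w + c * z) powr (-3/2))" for z w
  have G[measurable]: "(\<lambda>p. G (fst p) (snd p)) \<in> borel_measurable (borel \<Otimes>\<^sub>M borel)"
    unfolding G_def by measurable
  have "(\<integral>\<^sup>+\<omega>. ennreal (cmod (F t \<omega>) powr (-3/2) * cmod (F s \<omega>) powr (-3/2)) \<partial>M) = (\<integral>\<^sup>+\<omega>. G (F t \<omega>) (W \<omega>) \<partial>M)"
    by (simp add: G_def W_def)
  also have "\<dots> = (\<integral>\<^sup>+p. G (fst p) (snd p) \<partial>distr M borel (\<lambda>\<omega>. (F t \<omega>, W \<omega>)))"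
    using G by (subst nn_integral_distr) (auto simp: borel_prod)
  also have "\<dots> = (\<integral>\<^sup>+z. \<integral>\<^sup>+w. G z w \<partial>distr M borel W \<partial>distr M borel (F t))"
    unfolding law by (subst DW.nn_integral_fst[symmetric]) auto
  also have "\<dots> \<le> (\<integral>\<^sup>+z. ennreal (cmod z powr (-3/2)) * ennreal (162 * d powr (-3/4)) \<partial>distr M borel (F t))"
  proof (intro nn_integral_mono)
    fix z
    have "(\<integral>\<^sup>+w. G z w \<partial>distr M borel W) = ennreal (cmod z powr (-3/2)) * (\<integral>\<^sup>+w. ennreal (cmod (w + c * z) powr (-3/2)) \<partial>distr M borel W)"
      by (simp add: G_def ennreal_mult nn_integral_cmult)
    also have "(\<integral>\<^sup>+w. ennreal (cmod (w + c * z) powr (-3/2)) \<partial>distr M borel W) = (\<integral>\<^sup>+w. ennreal (cmod (c * z + complex_of_real (sqrt d) * w) powr (-3/2)) \<partial>std_complex_normal)"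
      unfolding represents_law[OF W] nW by (simp add: nn_integral_distr add.commute)
    also have "\<dots> \<le> ennreal (162 * sqrt d powr (-3/2))"
      using d by (intro std_complex_normal_neg_moment) simp
    also have "sqrt d powr (-3/2) = d powr (-3/4)"
      using d by (simp add: powr_half_sqrt[symmetric] powr_powr)
    finally show "(\<integral>\<^sup>+w. G z w \<partial>distr M borel W) \<le> ennreal (cmod z powr (-3/2)) * ennreal (162 * d powr (-3/4))"
      by (simp add: mult_left_mono)
  qed
  also have "\<dots> = (\<integral>\<^sup>+\<omega>. ennreal (cmod (F t \<omega>) powr (-3/2)) \<partial>M) * ennreal (162 * d powr (-3/4))"
    by (simp add: nn_integral_distr nn_integral_multc)
  also have "\<dots> \<le> 162 * ennreal (162 * d powr (-3/4))"
    by (intro mult_right_mono F_neg_moment) simp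
  finally show ?thesis by (simp add: d_def ennreal_mult mult.assoc[symmetric] ennreal_numeral[symmetric] del: ennreal_numeral flip: ennreal_mult)
qed

text \<open>Applies \<open>young_negative_power\<close> to |F t F s|. The term with exponent -3/4
  needs one-point moments only and the term with exponent -3/2 costs defect^(-3/4). Balancing them
  yields defect^(-3/8), which a quadratic lower bound on the defect turns into an integrable power
  of the lag.\<close>

lemma kernel_near:
  "\<exists>C>0. \<forall>t s. t \<noteq> s \<longrightarrow> (\<integral>\<^sup>+\<omega>. ennreal (cmod (centered t \<omega> / F t \<omega>) * cmod (centered s \<omega> / F s \<omega>)) \<partial>M) \<le> ennreal (C * defect (t - s) powr (-3/8))"
proof -
  define K where "K = (\<integral>l. (cmod (centered_mode 0 l))\<^sup>2 \<partial>\<rho>) ^ 9 * (\<integral>z. (cmod z) ^ (2 * 9) \<partial>std_complex_normal)"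
  have K0: "0 \<le> K" by (simp add: K_def)
  have K: "(\<integral>\<^sup>+\<omega>. ennreal ((cmod (centered t \<omega>)) ^ 18) \<partial>M) = ennreal K" for t
    using represents_moment[OF represents_centered[of t], of 9]
    by (subst nn_integral_eq_integral) (auto simp: K_def centered_mode_def norm_mult)
  \<comment> \<open>2 K from the 18th moments of the numerators, 2 * 162 from the one-point and
    162^2 from the two-point negative moments.\<close>
  define C where "C = 2 * K + (2 * 162 + 162\<^sup>2)"
  show ?thesis
  proof (intro exI[of _ C] conjI allI impI)
    show "0 < C" using K0 by (simp add: C_def)
    fix t s :: real assume ts: "t \<noteq> s"
    define d where "d = defect (t - s)"
    have d: "0 < d" "d \<le> 1" using ts defect_pos[of "t - s"] defect_le_1 by (auto simp: d_def)
    \<comment> \<open>With this weight, \<sigma> powr (-3/4) and \<sigma> powr (3/4) * d powr (-3/4)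
      both equal d powr (-3/8).\<close>
    define \<sigma> where "\<sigma> = sqrt d"
    have \<sigma>: "0 < \<sigma>" using d by (simp add: \<sigma>_def)
    have \<sigma>p: "\<sigma> powr a = d powr (a / 2)" for a using d by (simp add: \<sigma>_def powr_half_sqrt[symmetric] powr_powr)
    have pt: "cmod (centered t \<omega> / F t \<omega>) * cmod (centered s \<omega> / F s \<omega>) \<le>
       ((cmod (centered t \<omega>)) ^ 18 + (cmod (centered s \<omega>)) ^ 18)
       + \<sigma> powr (-3/4) * (cmod (F t \<omega>) powr (-3/2) + cmod (F s \<omega>) powr (-3/2))
       + \<sigma> powr (3/4) * (cmod (F t \<omega>) powr (-3/2) * cmod (F s \<omega>) powr (-3/2))" (is "?l \<le> ?r") for \<omega>
    proof (cases "F t \<omega> = 0 \<or> F s \<omega> = 0")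
      case True
      then show ?thesis by (auto intro!: add_nonneg_nonneg mult_nonneg_nonneg)
    next
      case False
      define x y A B where "x = cmod (F t \<omega>)" and "y = cmod (F s \<omega>)" and "A = cmod (centered t \<omega>)" and "B = cmod (centered s \<omega>)"
      have pos: "0 < x" "0 < y" "0 \<le> A" "0 \<le> B" using False by (auto simp: x_def y_def A_def B_def)
      have le2: "p * q \<le> p\<^sup>2 + q\<^sup>2" if "0 \<le> p" "0 \<le> q" for p q :: real
        using sum_squares_bound[of p q] mult_nonneg_nonneg[OF that] by linarith
      have "?l = (A * B) / (x * y)" by (simp add: norm_divide x_def y_def A_def B_def)
      also have "\<dots> \<le> (A * B) ^ 9 + \<sigma> powr (-3/4) * (x * y) powr (-3/4) + \<sigma> powr (3/4) * (x * y) powr (-3/2)"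
        using pos \<sigma> by (intro young_negative_power) auto
      also have "\<dots> \<le> (A ^ 18 + B ^ 18) + \<sigma> powr (-3/4) * (x powr (-3/2) + y powr (-3/2)) + \<sigma> powr (3/4) * (x powr (-3/2) * y powr (-3/2))"
      proof (intro add_mono mult_left_mono)
        show "(A * B) ^ 9 \<le> A ^ 18 + B ^ 18"
          using le2[of "A ^ 9" "B ^ 9"] pos by (simp add: power_mult_distrib flip: power_mult)
        show "(x * y) powr (-3/4) \<le> x powr (-3/2) + y powr (-3/2)"
          using le2[of "x powr (-3/4)" "y powr (-3/4)"] pos
          by (simp add: powr_mult powr_powr flip: powr_numeral)
        show "(x * y) powr (-3/2) \<le> x powr (-3/2) * y powr (-3/2)" using pos by (simp add: powr_mult)
      qed auto
      finally show ?thesis unfolding x_def y_def A_def B_def .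
    qed
    have "(\<integral>\<^sup>+\<omega>. ennreal (cmod (centered t \<omega> / F t \<omega>) * cmod (centered s \<omega> / F s \<omega>)) \<partial>M) \<le>
      (\<integral>\<^sup>+\<omega>. (ennreal ((cmod (centered t \<omega>)) ^ 18) + ennreal ((cmod (centered s \<omega>)) ^ 18))
       + ennreal (\<sigma> powr (-3/4)) * (ennreal (cmod (F t \<omega>) powr (-3/2)) + ennreal (cmod (F s \<omega>) powr (-3/2)))
       + ennreal (\<sigma> powr (3/4)) * ennreal (cmod (F t \<omega>) powr (-3/2) * cmod (F s \<omega>) powr (-3/2)) \<partial>M)"
      by (intro nn_integral_mono order_trans[OF ennreal_leI[OF pt]]) (simp flip: ennreal_mult ennreal_plus)
    also have "\<dots> = (ennreal K + ennreal K)
       + ennreal (\<sigma> powr (-3/4)) * ((\<integral>\<^sup>+\<omega>. ennreal (cmod (F t \<omega>) powr (-3/2)) \<partial>M) + (\<integral>\<^sup>+\<omega>. ennreal (cmod (F s \<omega>) powr (-3/2)) \<partial>M))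
       + ennreal (\<sigma> powr (3/4)) * (\<integral>\<^sup>+\<omega>. ennreal (cmod (F t \<omega>) powr (-3/2) * cmod (F s \<omega>) powr (-3/2)) \<partial>M)"
      by (simp add: nn_integral_add nn_integral_cmult K)
    also have "\<dots> \<le> (ennreal K + ennreal K) + ennreal (\<sigma> powr (-3/4)) * (162 + 162) + ennreal (\<sigma> powr (3/4)) * ennreal (162\<^sup>2 * d powr (-3/4))"
      unfolding d_def using ts by (intro add_mono mult_left_mono F_neg_moment F_pair_neg_moment) auto
    also have "\<dots> = ennreal (2 * K + \<sigma> powr (-3/4) * 324 + \<sigma> powr (3/4) * (162\<^sup>2 * d powr (-3/4)))"
    proof -
      have "(162::ennreal) + 162 = 324" by simp
      also have "\<dots> = ennreal 324" by simp
      finally have "(162::ennreal) + 162 = ennreal 324" .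
      then show ?thesis using K0 by (simp only: flip: ennreal_mult ennreal_plus) (simp add: ennreal_mult' ennreal_plus)
    qed
    also have "\<dots> \<le> ennreal (C * d powr (-3/8))"
    proof (rule ennreal_leI)
      have "1 \<le> d powr (-3/8)" using d powr_mono2'[of "-3/8" d 1] by simp
      then have "2 * K * 1 \<le> 2 * K * d powr (-3/8)" using K0 by (intro mult_left_mono) auto
      moreover have "\<sigma> powr (3/4) * (162\<^sup>2 * d powr (-3/4)) = 162\<^sup>2 * d powr (-3/8)"
        unfolding \<sigma>p by (simp add: powr_add[symmetric])
      ultimately show "2 * K + \<sigma> powr (-3/4) * 324 + \<sigma> powr (3/4) * (162\<^sup>2 * d powr (-3/4)) \<le> C * d powr (-3/8)"
        unfolding C_def \<sigma>p by (simp add: algebra_simps)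
    qed
    finally show "(\<integral>\<^sup>+\<omega>. ennreal (cmod (centered t \<omega> / F t \<omega>) * cmod (centered s \<omega> / F s \<omega>)) \<partial>M) \<le> ennreal (C * defect (t - s) powr (-3/8))"
      unfolding d_def .
  qed
qed

end

lemma integral_le_of_nn_integral_le:
  fixes g :: "'a \<Rightarrow> real"
  assumes [measurable]: "g \<in> borel_measurable M" and g: "\<And>x. 0 \<le> g x"
    and le: "(\<integral>\<^sup>+x. ennreal (g x) \<partial>M) \<le> ennreal B" and B: "0 \<le> B"
  shows "integrable M g" "(\<integral>x. g x \<partial>M) \<le> B"
proof -
  show i: "integrable M g"
    by (rule integrableI_nonneg) (use g le in \<open>auto intro: le_less_trans\<close>)
  have "ennreal (\<integral>x. g x \<partial>M) \<le> ennreal B"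
    using le nn_integral_eq_integral[OF i] g by simp
  then show "(\<integral>x. g x \<partial>M) \<le> B" using B by simp
qed

lemma norm_integral_le:
  fixes f :: "'a \<Rightarrow> complex"
  assumes [measurable]: "f \<in> borel_measurable M" and g: "integrable M g" and le: "\<And>x. cmod (f x) \<le> g x"
  shows "cmod (\<integral>x. f x \<partial>M) \<le> (\<integral>x. g x \<partial>M)"
proof -
  have "integrable M f"
    by (rule Bochner_Integration.integrable_bound[OF g]) (use le in \<open>auto intro!: AE_I2 order_trans[OF le abs_ge_self]\<close>)
  then have "(\<integral>x. cmod (f x) \<partial>M) \<le> (\<integral>x. g x \<partial>M)"
    by (intro integral_mono g le) simp
  then show ?thesis by (rule order_trans[OF integral_norm_bound])
qed

text \<open>Reduces the correlation of the rates to a conjugated and an unconjugated expectation,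
  which behave differently under circular symmetry.\<close>

lemma Im_mult_Im: "Im a * Im b = Re (a * cnj b - a * b) / 2"
  by simp

lemma ratio_sum_bound:
  fixes x y :: real
  assumes "0 \<le> x" "0 \<le> y"
  shows "(x + y) * (x + y) / (x * y) \<le> 4 + x ^ 4 + y ^ 4 + x powr (-3/2) + y powr (-3/2)"
proof (cases "x = 0 \<or> y = 0")
  case True
  then show ?thesis using assms by (auto intro!: add_nonneg_nonneg)
next
  case False
  then have "(x + y) * (x + y) / (x * y) = 2 + x / y + y / x"
    using assms by (simp add: field_simps)
  also have "\<dots> \<le> 2 + (1 + x ^ 4 + y powr (-3/2)) + (1 + y ^ 4 + x powr (-3/2))"
    using assms by (intro add_mono ratio_bound) auto
  finally show ?thesis by simp
qed

section \<open>The kernel at weakly correlated times\<close>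

context stationary_gaussian
begin

lemma inner_cnj: "(\<integral>l. \<phi> l * cnj (\<psi> l) \<partial>\<rho>) = cnj (\<integral>l. \<psi> l * cnj (\<phi> l) \<partial>\<rho>)"
  unfolding Bochner_Integration.integral_cnj[symmetric] by (simp add: mult.commute)

lemma F_neg_moment_integral:
  "integrable M (\<lambda>\<omega>. cmod (F t \<omega>) powr (-3/2))" "expectation (\<lambda>\<omega>. cmod (F t \<omega>) powr (-3/2)) \<le> 162"
  using integral_le_of_nn_integral_le[of "\<lambda>\<omega>. cmod (F t \<omega>) powr (-3/2)" M 162] F_neg_moment[of t] by auto

lemma F_pair_neg_moment_integral:
  assumes "t \<noteq> s"
  shows "integrable M (\<lambda>\<omega>. cmod (F t \<omega>) powr (-3/2) * cmod (F s \<omega>) powr (-3/2))"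
    "expectation (\<lambda>\<omega>. cmod (F t \<omega>) powr (-3/2) * cmod (F s \<omega>) powr (-3/2)) \<le> 162\<^sup>2 * defect (t - s) powr (-3/4)"
  by (rule integral_le_of_nn_integral_le[OF _ _ F_pair_neg_moment[OF assms]]; simp)+

text \<open>Conditional means grow linearly in |F t| + |F s|, which leads to this quotient. It
  expands to 2 + x/y + y/x, so \<open>ratio_bound\<close> needs one-point moments only and the
  constant is uniform in both times, coincident ones included.\<close>

lemma F_ratio_expectation:
  "\<exists>C\<ge>0. \<forall>t s. integrable M (\<lambda>\<omega>. (cmod (F t \<omega>) + cmod (F s \<omega>)) * (cmod (F t \<omega>) + cmod (F s \<omega>)) / (cmod (F t \<omega>) * cmod (F s \<omega>))) \<and>
     expectation (\<lambda>\<omega>. (cmod (F t \<omega>) + cmod (F s \<omega>)) * (cmod (F t \<omega>) + cmod (F s \<omega>)) / (cmod (F t \<omega>) * cmod (F s \<omega>))) \<le> C"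
proof -
  define m4 where "m4 = (\<integral>z. (cmod z) ^ (2 * 2) \<partial>std_complex_normal)"
  have m4: "0 \<le> m4" by (simp add: m4_def)
  have F4: "integrable M (\<lambda>\<omega>. (cmod (F t \<omega>)) ^ 4)" "expectation (\<lambda>\<omega>. (cmod (F t \<omega>)) ^ 4) = m4" for t
    using represents_moment[OF represents_F[of t], of 2] rho.prob_space by (auto simp: m4_def)
  show ?thesis
  proof (intro exI[of _ "4 + 2 * m4 + 324"] conjI allI)
    show "0 \<le> 4 + 2 * m4 + 324" using m4 by simp
    fix t s
    let ?R = "\<lambda>\<omega>. (cmod (F t \<omega>) + cmod (F s \<omega>)) * (cmod (F t \<omega>) + cmod (F s \<omega>)) / (cmod (F t \<omega>) * cmod (F s \<omega>))"
    let ?B = "\<lambda>\<omega>. 4 + (cmod (F t \<omega>)) ^ 4 + (cmod (F s \<omega>)) ^ 4 + cmod (F t \<omega>) powr (-3/2) + cmod (F s \<omega>) powr (-3/2)"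
    have B: "integrable M ?B"
      by (intro Bochner_Integration.integrable_add F4 F_neg_moment_integral) simp
    have le: "?R \<omega> \<le> ?B \<omega>" for \<omega> by (intro ratio_sum_bound) auto
    have nn: "0 \<le> ?R \<omega>" for \<omega> by auto
    show R: "integrable M ?R"
      by (rule Bochner_Integration.integrable_bound[OF B]) (use le nn in \<open>auto intro!: AE_I2 order_trans[OF le abs_ge_self]\<close>)
    have "expectation ?R \<le> expectation ?B" by (intro integral_mono R B le)
    also have "\<dots> = 4 + m4 + m4 + expectation (\<lambda>\<omega>. cmod (F t \<omega>) powr (-3/2)) + expectation (\<lambda>\<omega>. cmod (F s \<omega>) powr (-3/2))"
      using F4 F_neg_moment_integral(1) prob_space by simp
    also have "\<dots> \<le> 4 + 2 * m4 + 324"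
      using F_neg_moment_integral(2)[of t] F_neg_moment_integral(2)[of s] by simp
    finally show "expectation ?R \<le> 4 + 2 * m4 + 324" .
  qed
qed

text \<open>Here two-point moments are unavoidable, and the defect must stay away from 0: 3/4 is its
  lower bound when |r| \<le> 1/2, and (3/4) powr (-3/4) \<le> 2.\<close>

lemma F_inverse_expectation:
  assumes ts: "t \<noteq> s" and d: "3/4 \<le> defect (t - s)"
  shows "integrable M (\<lambda>\<omega>. 1 / (cmod (F t \<omega>) * cmod (F s \<omega>)))"
    "expectation (\<lambda>\<omega>. 1 / (cmod (F t \<omega>) * cmod (F s \<omega>))) \<le> 2 + 2 * 162\<^sup>2"
proof -
  let ?R = "\<lambda>\<omega>. 1 / (cmod (F t \<omega>) * cmod (F s \<omega>))"
  let ?B = "\<lambda>\<omega>. 2 + cmod (F t \<omega>) powr (-3/2) * cmod (F s \<omega>) powr (-3/2)"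
  have B: "integrable M ?B" by (intro Bochner_Integration.integrable_add F_pair_neg_moment_integral ts) simp
  have le: "?R \<omega> \<le> ?B \<omega>" for \<omega>
    using ratio_bound[of 1 "cmod (F t \<omega>) * cmod (F s \<omega>)"] by (simp add: powr_mult)
  show R: "integrable M ?R"
    by (rule Bochner_Integration.integrable_bound[OF B]) (use le in \<open>auto intro!: AE_I2 order_trans[OF le abs_ge_self]\<close>)
  have "expectation ?R \<le> expectation ?B" by (intro integral_mono R B le)
  also have "\<dots> = 2 + expectation (\<lambda>\<omega>. cmod (F t \<omega>) powr (-3/2) * cmod (F s \<omega>) powr (-3/2))"
    using F_pair_neg_moment_integral(1)[OF ts] prob_space by simp
  also have "\<dots> \<le> 2 + 162\<^sup>2 * defect (t - s) powr (-3/4)"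
    using F_pair_neg_moment_integral(2)[OF ts] by simp
  also have "\<dots> \<le> 2 + 162\<^sup>2 * 2"
  proof (intro add_left_mono mult_left_mono)
    have "defect (t - s) powr (-3/4) \<le> (3/4) powr (-3/4)" using d by (intro powr_mono2') auto
    also have "\<dots> \<le> (3/4) powr (-1)" by (intro powr_mono') auto
    also have "\<dots> \<le> 2" by (simp add: powr_minus_divide)
    finally show "defect (t - s) powr (-3/4) \<le> 2" .
  qed simp
  finally show "expectation ?R \<le> 2 + 2 * 162\<^sup>2" by simp
qed

text \<open>Regressing \<open>centered t\<close> and \<open>centered s\<close> on \<open>(F t, F s)\<close> leaves residuals that are independent
  of \<open>(F t, F s)\<close>; integrating them out first leaves only terms that are small with the covariances.\<close>

lemma kernel_far:
  "\<exists>C>0. \<forall>t s. t \<noteq> s \<longrightarrow> cmod (cov_r (t - s)) \<le> 1/2 \<longrightarrow>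
     \<bar>expectation (\<lambda>\<omega>. Im (centered t \<omega> / F t \<omega>) * Im (centered s \<omega> / F s \<omega>))\<bar> \<le>
     C * ((cmod (weighted_ft centered_freq (t - s)))\<^sup>2 + cmod (weighted_ft centered_freq_sq (t - s)))"
proof -
  obtain C1 where C1: "0 \<le> C1" "\<And>t s. integrable M (\<lambda>\<omega>. (cmod (F t \<omega>) + cmod (F s \<omega>)) * (cmod (F t \<omega>) + cmod (F s \<omega>)) / (cmod (F t \<omega>) * cmod (F s \<omega>)))"
     "\<And>t s. expectation (\<lambda>\<omega>. (cmod (F t \<omega>) + cmod (F s \<omega>)) * (cmod (F t \<omega>) + cmod (F s \<omega>)) / (cmod (F t \<omega>) * cmod (F s \<omega>))) \<le> C1"
    using F_ratio_expectation by blast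
  define C2 :: real where "C2 = 2 + 2 * 162\<^sup>2"
  have C2: "0 < C2" by (simp add: C2_def)
  obtain Cn where Cn: "0 < Cn" "\<And>t s. t \<noteq> s \<Longrightarrow> (\<integral>\<^sup>+\<omega>. ennreal (cmod (centered t \<omega> / F t \<omega>) * cmod (centered s \<omega> / F s \<omega>)) \<partial>M) \<le> ennreal (Cn * defect (t - s) powr (-3/8))"
    using kernel_near by blast
  define C where "C = 4 * C1 + 2 * C2"
  show ?thesis
  proof (intro exI[of _ C] conjI allI impI)
    show "0 < C" using C1(1) C2 by (simp add: C_def)
    fix t s assume ts: "t \<noteq> s" and small: "cmod (cov_r (t - s)) \<le> 1/2"
    define c where "c = cov_r (t - s)"
    have c': "cov_r (s - t) = cnj c" using cov_r_minus[of "t - s"] by (simp add: c_def)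
    define d where "d = defect (t - s)"
    have c1: "cmod c \<le> 1" using small by (simp add: c_def)
    have "(cmod c)\<^sup>2 \<le> (1/2)\<^sup>2" using small by (intro power_mono) (auto simp: c_def)
    then have d: "3/4 \<le> d" by (simp add: d_def defect_def c_def power2_eq_square)
    have cd: "cnj c * c = 1 - complex_of_real d" "c * cnj c = 1 - complex_of_real d"
      unfolding d_def defect_def c_def[symmetric] of_real_diff of_real_1 complex_norm_square by (simp_all add: mult.commute)
    define e where "e = weighted_ft centered_freq (t - s)"
    have e': "weighted_ft centered_freq (s - t) = cnj e" using weighted_ft_minus[of centered_freq "t - s"] by (simp add: e_def)
    \<comment> \<open>Regression coefficients. \<open>centered t\<close> is already orthogonal to F
      t, so only the part of F s orthogonal to F t enters; it has squared norm d and inner product -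
      i e with \<open>centered t\<close>. The other coefficient is obtained by exchanging t and
      s.\<close>
    define \<beta> where "\<beta> = - \<i> * e / complex_of_real d"
    define \<delta> where "\<delta> = - \<i> * cnj e / complex_of_real d"
    have \<beta>d: "\<beta> * complex_of_real d = - \<i> * e" "\<delta> * complex_of_real d = - \<i> * cnj e"
      using d by (auto simp: \<beta>_def \<delta>_def)
    have "cmod e / d \<le> cmod e * 2"
    proof -
      have "cmod e \<le> cmod e * 2 * (3/4)" by simp
      also have "\<dots> \<le> cmod e * 2 * d" using d by (intro mult_left_mono) auto
      finally show ?thesis using d by (simp add: divide_simps)
    qed
    then have \<beta>n: "cmod \<beta> \<le> 2 * cmod e" "cmod \<delta> \<le> 2 * cmod e"
      using d by (simp_all add: \<beta>_def \<delta>_def norm_divide norm_mult mult.commute)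
    \<comment> \<open>The residual of F s on F t, and that of F t on F s.\<close>
    define Wt Ws where "Wt \<omega> = 1 * F s \<omega> + (- cnj c) * F t \<omega>" and "Ws \<omega> = 1 * F t \<omega> + (- c) * F s \<omega>" for \<omega>
    define \<psi>t \<psi>s where "\<psi>t l = 1 * fourier_mode s l + (- cnj c) * fourier_mode t l" and "\<psi>s l = 1 * fourier_mode t l + (- c) * fourier_mode s l" for l
    have W: "represents Wt \<psi>t" "represents Ws \<psi>s"
      unfolding Wt_def[abs_def] Ws_def[abs_def] \<psi>t_def[abs_def] \<psi>s_def[abs_def] by (intro represents_lincomb represents_F)+
    define \<eta>t \<eta>s where "\<eta>t \<omega> = 1 * centered t \<omega> + (- \<beta>) * Wt \<omega>" and "\<eta>s \<omega> = 1 * centered s \<omega> + (- \<delta>) * Ws \<omega>" for \<omega>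
    define \<zeta>t \<zeta>s where "\<zeta>t l = 1 * centered_mode t l + (- \<beta>) * \<psi>t l" and "\<zeta>s l = 1 * centered_mode s l + (- \<delta>) * \<psi>s l" for l
    have \<eta>: "represents \<eta>t \<zeta>t" "represents \<eta>s \<zeta>s"
      unfolding \<eta>t_def[abs_def] \<eta>s_def[abs_def] \<zeta>t_def[abs_def] \<zeta>s_def[abs_def] by (intro represents_lincomb represents_centered W)+
    note [measurable] = representsD(1)[OF W(1)] representsD(1)[OF W(2)] representsD(1)[OF \<eta>(1)] representsD(1)[OF \<eta>(2)]
    note sF = representsD(2)[OF represents_F] and sC = representsD(2)[OF represents_centered]
      and sW = W[THEN representsD(2)] and s\<eta> = \<eta>[THEN representsD(2)]
    have \<psi>: "(\<integral>l. \<psi>t l * cnj (fourier_mode t l) \<partial>\<rho>) = 0" "(\<integral>l. \<psi>t l * cnj (fourier_mode s l) \<partial>\<rho>) = complex_of_real d"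
      "(\<integral>l. \<psi>s l * cnj (fourier_mode s l) \<partial>\<rho>) = 0" "(\<integral>l. \<psi>s l * cnj (fourier_mode t l) \<partial>\<rho>) = complex_of_real d"
      "(\<integral>l. \<psi>t l * cnj (centered_mode s l) \<partial>\<rho>) = - \<i> * cnj c * e"
      unfolding \<psi>t_def \<psi>s_def inner_lincomb(1)[OF sF sF sF] inner_lincomb(1)[OF sF sF sC] inner_modes
      using cd by (simp_all add: c' c_def[symmetric] cov_r_0 e_def[symmetric] weighted_ft_centered_freq_0)
    have \<zeta>: "(\<integral>l. \<zeta>t l * cnj (fourier_mode t l) \<partial>\<rho>) = 0" "(\<integral>l. \<zeta>t l * cnj (fourier_mode s l) \<partial>\<rho>) = 0"
      "(\<integral>l. \<zeta>s l * cnj (fourier_mode s l) \<partial>\<rho>) = 0" "(\<integral>l. \<zeta>s l * cnj (fourier_mode t l) \<partial>\<rho>) = 0"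
      unfolding \<zeta>t_def \<zeta>s_def inner_lincomb(1)[OF sC sW(1) sF] inner_lincomb(1)[OF sC sW(2) sF] inner_modes \<psi>
      using \<beta>d by (simp_all add: weighted_ft_centered_freq_0 e_def[symmetric] e')
    have \<zeta>\<psi>: "(\<integral>l. \<zeta>t l * cnj (\<psi>s l) \<partial>\<rho>) = 0"
      unfolding \<psi>s_def inner_lincomb(2)[OF sF sF s\<eta>(1)] \<zeta> by simp
    have \<zeta>c: "(\<integral>l. \<zeta>t l * cnj (centered_mode s l) \<partial>\<rho>) = weighted_ft centered_freq_sq (t - s) + \<beta> * \<i> * cnj c * e"
      unfolding \<zeta>t_def inner_lincomb(1)[OF sC sW(1) sC] inner_modes \<psi> by simp
    \<comment> \<open>The covariance of the two residuals. As \<zeta>t is orthogonal to \<psi>s, it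
      equals the inner product of \<zeta>t with the uncorrected
      \<open>centered_mode s\<close>.\<close>
    define \<kappa> where "\<kappa> = weighted_ft centered_freq_sq (t - s) + \<beta> * \<i> * cnj c * e"
    have \<zeta>\<zeta>: "(\<integral>l. \<zeta>t l * cnj (\<zeta>s l) \<partial>\<rho>) = \<kappa>"
      unfolding \<kappa>_def \<zeta>c[symmetric] by (subst \<zeta>s_def, subst inner_lincomb(2)[OF sC sW(2) s\<eta>(1)]) (simp add: \<zeta>\<psi>)
    have \<kappa>n: "cmod \<kappa> \<le> cmod (weighted_ft centered_freq_sq (t - s)) + 2 * (cmod e)\<^sup>2"
    proof -
      have "cmod (\<beta> * \<i> * cnj c * e) \<le> (2 * cmod e) * 1 * cmod e"
      proof -
        have "cmod (\<beta> * \<i> * cnj c * e) = cmod \<beta> * cmod c * cmod e" by (simp add: norm_mult)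
        also have "\<dots> \<le> (2 * cmod e) * 1 * cmod e" using \<beta>n c1 by (intro mult_mono) auto
        finally show ?thesis .
      qed
      then show ?thesis unfolding \<kappa>_def
        by (intro order_trans[OF norm_triangle_ineq]) (simp add: power2_eq_square)
    qed
    define U V where "U \<omega> = (F t \<omega>, F s \<omega>)" and "V \<omega> = (\<eta>t \<omega>, \<eta>s \<omega>)" for \<omega>
    have UV[measurable]: "U \<in> borel_measurable M" "V \<in> borel_measurable M" unfolding U_def V_def by measurable
    have law: "distr M borel (\<lambda>\<omega>. (U \<omega>, V \<omega>)) = distr M borel U \<Otimes>\<^sub>M distr M borel V"
    proof (rule represents_independent[OF UV])
      fix u v :: "complex \<times> complex"
      show "represents (\<lambda>\<omega>. cnj (fst u) * F t \<omega> + cnj (snd u) * F s \<omega>) (\<lambda>l. cnj (fst u) * fourier_mode t l + cnj (snd u) * fourier_mode s l)"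
        by (intro represents_lincomb represents_F)
      show "represents (\<lambda>\<omega>. cnj (fst v) * \<eta>t \<omega> + cnj (snd v) * \<eta>s \<omega>) (\<lambda>l. cnj (fst v) * \<zeta>t l + cnj (snd v) * \<zeta>s l)"
        by (intro represents_lincomb \<eta>)
      show "u \<bullet> U \<omega> = Re (cnj (fst u) * F t \<omega> + cnj (snd u) * F s \<omega>)"
        "v \<bullet> V \<omega> = Re (cnj (fst v) * \<eta>t \<omega> + cnj (snd v) * \<eta>s \<omega>)" for \<omega>
        by (simp_all add: U_def V_def inner_prod_def inner_complex_def)
      have sv: "square_integrable \<rho> (\<lambda>l. cnj (fst v) * \<zeta>t l + cnj (snd v) * \<zeta>s l)"
        by (rule square_integrable_lincomb(1)[OF s\<eta>])
      have z: "(\<integral>l. fourier_mode t l * cnj (\<zeta>t l) \<partial>\<rho>) = 0" "(\<integral>l. fourier_mode s l * cnj (\<zeta>t l) \<partial>\<rho>) = 0"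
        "(\<integral>l. fourier_mode s l * cnj (\<zeta>s l) \<partial>\<rho>) = 0" "(\<integral>l. fourier_mode t l * cnj (\<zeta>s l) \<partial>\<rho>) = 0"
        by (subst inner_cnj, simp only: \<zeta> complex_cnj_zero)+
      show "(\<integral>l. (cnj (fst u) * fourier_mode t l + cnj (snd u) * fourier_mode s l) * cnj (cnj (fst v) * \<zeta>t l + cnj (snd v) * \<zeta>s l) \<partial>\<rho>) = 0"
        unfolding inner_lincomb(1)[OF sF sF sv] inner_lincomb(2)[OF s\<eta> sF] z by simp
    qed
    interpret DU: prob_space "distr M borel U" by (rule prob_space_distr) simp
    interpret DV: prob_space "distr M borel V" by (rule prob_space_distr) simp
    interpret DD: pair_prob_space "distr M borel U" "distr M borel V" ..
    define a b where "a \<omega> = centered t \<omega> / F t \<omega>" and "b \<omega> = centered s \<omega> / F s \<omega>" for \<omega>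
    have [measurable]: "a \<in> borel_measurable M" "b \<in> borel_measurable M" unfolding a_def b_def by measurable
    \<comment> \<open>The conditional means of \<open>centered t\<close> and
      \<open>centered s\<close> given the pair \<open>U\<close>.\<close>
    define p q where "p f = \<beta> * (snd f - cnj c * fst f)" and "q f = \<delta> * (fst f - c * snd f)" for f :: "complex \<times> complex"
    have ab_int: "integrable M (\<lambda>\<omega>. cmod (a \<omega>) * cmod (b \<omega>))"
      by (rule integral_le_of_nn_integral_le(1)[OF _ _ Cn(2)[OF ts, folded a_def b_def]]) (use Cn(1) in auto)
    have fst_m[measurable (raw)]: "(\<lambda>x. fst (g x)) \<in> borel_measurable N"
      and snd_m[measurable (raw)]: "(\<lambda>x. snd (g x)) \<in> borel_measurable N"
      if "g \<in> borel_measurable N" for g :: "'n \<Rightarrow> complex \<times> complex" and N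
      by (rule measurable_compose[OF that]; intro borel_measurable_continuous_onI continuous_intros)+
    \<comment> \<open>Fubini for the product law of \<open>U\<close> and \<open>V\<close>: the
      residuals are averaged first, with \<open>U\<close> frozen in the denominators.\<close>
    have integrate_out: "expectation (\<lambda>\<omega>. G (U \<omega>) (V \<omega>)) = expectation (\<lambda>\<omega>. expectation (\<lambda>\<omega>'. G (U \<omega>) (V \<omega>')))"
      if [measurable]: "(\<lambda>x. G (fst x) (snd x)) \<in> borel_measurable (borel \<Otimes>\<^sub>M borel)" and int: "integrable M (\<lambda>\<omega>. G (U \<omega>) (V \<omega>))"
      for G :: "complex \<times> complex \<Rightarrow> complex \<times> complex \<Rightarrow> complex"
    proof -
      have Gb[measurable]: "(\<lambda>x. G (fst x) (snd x)) \<in> borel_measurable borel"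
        using that(1) by (simp add: borel_prod)
      have G1[measurable]: "G f \<in> borel_measurable borel" for f
        using measurable_compose[OF measurable_Pair1' that(1), of f] by simp
      have Gi[measurable]: "(\<lambda>f. \<integral>n. G f n \<partial>distr M borel V) \<in> borel_measurable borel"
        by (rule DV.borel_measurable_lebesgue_integral) (simp add: case_prod_beta')
      have i: "integrable (distr M borel U \<Otimes>\<^sub>M distr M borel V) (\<lambda>x. G (fst x) (snd x))"
        unfolding law[symmetric] using int by (subst integrable_distr_eq) auto
      have "expectation (\<lambda>\<omega>. G (U \<omega>) (V \<omega>)) = (\<integral>x. G (fst x) (snd x) \<partial>distr M borel (\<lambda>\<omega>. (U \<omega>, V \<omega>)))"
        by (subst integral_distr) auto
      also have "\<dots> = (\<integral>f. \<integral>n. G f n \<partial>distr M borel V \<partial>distr M borel U)"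
        unfolding law using DD.integral_fst'[OF i] by simp
      also have "\<dots> = expectation (\<lambda>\<omega>. expectation (\<lambda>\<omega>'. G (U \<omega>) (V \<omega>')))"
        by (subst integral_distr[OF UV(1) Gi]) (simp add: integral_distr)
      finally show ?thesis .
    qed
    note m\<eta> = represents_moments[OF \<eta>(1)] represents_moments[OF \<eta>(2)]
    have i\<eta>: "integrable M \<eta>t" "integrable M \<eta>s"
      using square_integrable_mult(1)[OF m\<eta>(1), of "\<lambda>_. 1"] square_integrable_mult(1)[OF m\<eta>(5), of "\<lambda>_. 1"]
      by (auto simp: square_integrable_def)
    \<comment> \<open>Without conjugation the residuals have covariance 0 and mean 0, so only the
      product of the shifts survives.\<close>
    have E1: "expectation (\<lambda>\<omega>'. (\<eta>t \<omega>' + x) * (\<eta>s \<omega>' + y)) = x * y" for x y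
    proof -
      have "expectation (\<lambda>\<omega>'. (\<eta>t \<omega>' + x) * (\<eta>s \<omega>' + y)) = expectation (\<lambda>\<omega>'. \<eta>t \<omega>' * \<eta>s \<omega>' + y * \<eta>t \<omega>' + x * \<eta>s \<omega>' + x * y)"
        by (simp add: algebra_simps)
      also have "\<dots> = x * y"
        using i\<eta> square_integrable_mult(1)[OF m\<eta>(1) m\<eta>(5)] m\<eta>(3,7) represents_covariance(2)[OF \<eta>] prob_space by simp
      finally show ?thesis .
    qed
    \<comment> \<open>With conjugation the residual covariance \<kappa> survives as well.\<close>
    have E2: "expectation (\<lambda>\<omega>'. (\<eta>t \<omega>' + x) * cnj (\<eta>s \<omega>' + y)) = \<kappa> + x * cnj y" for x y
    proof -
      have "expectation (\<lambda>\<omega>'. (\<eta>t \<omega>' + x) * cnj (\<eta>s \<omega>' + y)) = expectation (\<lambda>\<omega>'. \<eta>t \<omega>' * cnj (\<eta>s \<omega>') + cnj y * \<eta>t \<omega>' + x * cnj (\<eta>s \<omega>') + x * cnj y)"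
        by (simp add: algebra_simps)
      also have "\<dots> = \<kappa> + x * cnj y"
        using i\<eta> square_integrable_mult(2)[OF m\<eta>(1) m\<eta>(5)] m\<eta>(3,7) represents_covariance(1)[OF \<eta>] \<zeta>\<zeta> prob_space by simp
      finally show ?thesis .
    qed
    have a_eq: "a \<omega> = (\<eta>t \<omega> + p (U \<omega>)) / F t \<omega>" and b_eq: "b \<omega> = (\<eta>s \<omega> + q (U \<omega>)) / F s \<omega>" for \<omega>
      by (simp_all add: a_def b_def \<eta>t_def \<eta>s_def p_def q_def U_def Wt_def Ws_def)
    have ab: "expectation (\<lambda>\<omega>. a \<omega> * b \<omega>) = expectation (\<lambda>\<omega>. p (U \<omega>) * q (U \<omega>) / (F t \<omega> * F s \<omega>))"
    proof -
      define G where "G f n = ((fst n + p f) * (snd n + q f)) / (fst f * snd f)" for f n :: "complex \<times> complex"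
      have G: "a \<omega> * b \<omega> = G (U \<omega>) (V \<omega>)" for \<omega> by (simp add: a_eq b_eq G_def U_def V_def)
      have "integrable M (\<lambda>\<omega>. a \<omega> * b \<omega>)"
        by (rule Bochner_Integration.integrable_bound[OF ab_int]) (auto simp: norm_mult)
      then have "expectation (\<lambda>\<omega>. a \<omega> * b \<omega>) = expectation (\<lambda>\<omega>. expectation (\<lambda>\<omega>'. G (U \<omega>) (V \<omega>')))"
        unfolding G by (intro integrate_out) (auto simp: G_def p_def q_def)
      also have "\<dots> = expectation (\<lambda>\<omega>. p (U \<omega>) * q (U \<omega>) / (F t \<omega> * F s \<omega>))"
        by (intro Bochner_Integration.integral_cong refl) (simp add: G_def V_def U_def E1)
      finally show ?thesis .
    qed
    have acb: "expectation (\<lambda>\<omega>. a \<omega> * cnj (b \<omega>)) = expectation (\<lambda>\<omega>. (\<kappa> + p (U \<omega>) * cnj (q (U \<omega>))) / (F t \<omega> * cnj (F s \<omega>)))"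
    proof -
      define G where "G f n = ((fst n + p f) * cnj (snd n + q f)) / (fst f * cnj (snd f))" for f n :: "complex \<times> complex"
      have G: "a \<omega> * cnj (b \<omega>) = G (U \<omega>) (V \<omega>)" for \<omega> by (simp add: a_eq b_eq G_def U_def V_def)
      have "integrable M (\<lambda>\<omega>. a \<omega> * cnj (b \<omega>))"
        by (rule Bochner_Integration.integrable_bound[OF ab_int]) (auto simp: norm_mult)
      then have "expectation (\<lambda>\<omega>. a \<omega> * cnj (b \<omega>)) = expectation (\<lambda>\<omega>. expectation (\<lambda>\<omega>'. G (U \<omega>) (V \<omega>')))"
        unfolding G by (intro integrate_out) (auto simp: G_def p_def q_def)
      also have "\<dots> = expectation (\<lambda>\<omega>. (\<kappa> + p (U \<omega>) * cnj (q (U \<omega>))) / (F t \<omega> * cnj (F s \<omega>)))"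
        using E2 by (intro Bochner_Integration.integral_cong refl) (simp add: G_def V_def U_def)
      finally show ?thesis .
    qed
    define R where "R \<omega> = (cmod (F t \<omega>) + cmod (F s \<omega>)) * (cmod (F t \<omega>) + cmod (F s \<omega>)) / (cmod (F t \<omega>) * cmod (F s \<omega>))" for \<omega>
    define I where "I \<omega> = 1 / (cmod (F t \<omega>) * cmod (F s \<omega>))" for \<omega>
    have R: "integrable M R" "expectation R \<le> C1" using C1(2,3)[of t s] by (auto simp: R_def[abs_def])
    have I: "integrable M I" "expectation I \<le> C2" using F_inverse_expectation[OF ts d[unfolded d_def]] by (auto simp: I_def[abs_def] C2_def)
    \<comment> \<open>Each conditional mean is at most 2 |e| (|F t| + |F s|), so the product is of
      second order in e.\<close>
    have pq: "cmod (p (U \<omega>)) * cmod (q (U \<omega>)) / (cmod (F t \<omega>) * cmod (F s \<omega>)) \<le> (4 * (cmod e)\<^sup>2) * R \<omega>" for \<omega>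
    proof -
      have w: "cmod (x - k * y) \<le> cmod x + cmod y" if "cmod k \<le> 1" for x y k :: complex
        using norm_triangle_ineq4[of x "k * y"] mult_right_mono[OF that norm_ge_zero[of y]] by (simp add: norm_mult)
      have "cmod (p (U \<omega>)) \<le> (2 * cmod e) * (cmod (F t \<omega>) + cmod (F s \<omega>))"
        using w[of "cnj c" "F s \<omega>" "F t \<omega>"] c1 \<beta>n unfolding p_def U_def norm_mult by (intro mult_mono) auto
      moreover have "cmod (q (U \<omega>)) \<le> (2 * cmod e) * (cmod (F t \<omega>) + cmod (F s \<omega>))"
        using w[of c "F t \<omega>" "F s \<omega>"] c1 \<beta>n unfolding q_def U_def norm_mult by (intro mult_mono) auto
      ultimately have "cmod (p (U \<omega>)) * cmod (q (U \<omega>)) \<le> ((2 * cmod e) * (cmod (F t \<omega>) + cmod (F s \<omega>))) * ((2 * cmod e) * (cmod (F t \<omega>) + cmod (F s \<omega>)))"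
        by (intro mult_mono) auto
      then have "cmod (p (U \<omega>)) * cmod (q (U \<omega>)) / (cmod (F t \<omega>) * cmod (F s \<omega>)) \<le>
          ((2 * cmod e) * (cmod (F t \<omega>) + cmod (F s \<omega>))) * ((2 * cmod e) * (cmod (F t \<omega>) + cmod (F s \<omega>))) / (cmod (F t \<omega>) * cmod (F s \<omega>))"
        by (intro divide_right_mono) auto
      also have "((2 * x) * y) * ((2 * x) * y) / z = (4 * x\<^sup>2) * (y * y / z)" for x y z :: real
        by (simp add: power2_eq_square)
      finally show ?thesis unfolding R_def .
    qed
    have "cmod (expectation (\<lambda>\<omega>. a \<omega> * b \<omega>)) \<le> expectation (\<lambda>\<omega>. (4 * (cmod e)\<^sup>2) * R \<omega>)"
      unfolding ab
    proof (rule norm_integral_le)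
      show "cmod (p (U \<omega>) * q (U \<omega>) / (F t \<omega> * F s \<omega>)) \<le> (4 * (cmod e)\<^sup>2) * R \<omega>" for \<omega>
        using pq[of \<omega>] by (simp only: norm_mult norm_divide)
    qed (use R in \<open>auto simp: p_def q_def\<close>)
    also have "\<dots> \<le> 4 * (cmod e)\<^sup>2 * C1" using R by (simp add: mult_left_mono)
    finally have bound1: "cmod (expectation (\<lambda>\<omega>. a \<omega> * b \<omega>)) \<le> 4 * (cmod e)\<^sup>2 * C1" .
    have "cmod (expectation (\<lambda>\<omega>. a \<omega> * cnj (b \<omega>))) \<le> expectation (\<lambda>\<omega>. cmod \<kappa> * I \<omega> + (4 * (cmod e)\<^sup>2) * R \<omega>)"
      unfolding acb
    proof (rule norm_integral_le)
      show "cmod ((\<kappa> + p (U \<omega>) * cnj (q (U \<omega>))) / (F t \<omega> * cnj (F s \<omega>))) \<le> cmod \<kappa> * I \<omega> + (4 * (cmod e)\<^sup>2) * R \<omega>" for \<omega>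
      proof -
        have "cmod ((\<kappa> + p (U \<omega>) * cnj (q (U \<omega>))) / (F t \<omega> * cnj (F s \<omega>))) \<le>
            (cmod \<kappa> + cmod (p (U \<omega>)) * cmod (q (U \<omega>))) / (cmod (F t \<omega>) * cmod (F s \<omega>))"
          unfolding norm_divide norm_mult complex_mod_cnj
          by (intro divide_right_mono order_trans[OF norm_triangle_ineq]) (auto simp: norm_mult)
        then show ?thesis using pq[of \<omega>] by (simp add: add_divide_distrib I_def)
      qed
    qed (use R I in \<open>auto simp: p_def q_def\<close>)
    also have "\<dots> = cmod \<kappa> * expectation I + 4 * (cmod e)\<^sup>2 * expectation R" using R I by simp
    also have "\<dots> \<le> (cmod (weighted_ft centered_freq_sq (t - s)) + 2 * (cmod e)\<^sup>2) * C2 + 4 * (cmod e)\<^sup>2 * C1"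
    proof (intro add_mono mult_mono \<kappa>n I R order_refl)
      show "0 \<le> expectation I" by (intro Bochner_Integration.integral_nonneg) (simp add: I_def)
      show "0 \<le> expectation R" by (intro Bochner_Integration.integral_nonneg) (simp add: R_def)
    qed auto
    finally have bound2: "cmod (expectation (\<lambda>\<omega>. a \<omega> * cnj (b \<omega>))) \<le> (cmod (weighted_ft centered_freq_sq (t - s)) + 2 * (cmod e)\<^sup>2) * C2 + 4 * (cmod e)\<^sup>2 * C1" .
    have i: "integrable M (\<lambda>\<omega>. a \<omega> * b \<omega>)" "integrable M (\<lambda>\<omega>. a \<omega> * cnj (b \<omega>))"
      by (rule Bochner_Integration.integrable_bound[OF ab_int]; simp add: norm_mult)+
    have "expectation (\<lambda>\<omega>. Im (a \<omega>) * Im (b \<omega>)) = Re (expectation (\<lambda>\<omega>. a \<omega> * cnj (b \<omega>)) - expectation (\<lambda>\<omega>. a \<omega> * b \<omega>)) / 2"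
      unfolding Im_mult_Im using i by (simp only: integral_divide_zero integral_Re Bochner_Integration.integrable_diff Bochner_Integration.integral_diff)
    also have "\<bar>\<dots>\<bar> \<le> (cmod (expectation (\<lambda>\<omega>. a \<omega> * cnj (b \<omega>))) + cmod (expectation (\<lambda>\<omega>. a \<omega> * b \<omega>))) / 2"
      using order_trans[OF abs_Re_le_cmod norm_triangle_ineq4] by (simp add: divide_right_mono)
    also have "\<dots> \<le> ((cmod (weighted_ft centered_freq_sq (t - s)) + 2 * (cmod e)\<^sup>2) * C2 + 4 * (cmod e)\<^sup>2 * C1 + 4 * (cmod e)\<^sup>2 * C1) / 2"
      by (rule divide_right_mono[OF add_mono[OF bound2 bound1]]) simp
    also have "\<dots> = (C2 / 2) * cmod (weighted_ft centered_freq_sq (t - s)) + (C2 + 4 * C1) * (cmod e)\<^sup>2"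
      by (simp add: field_simps)
    also have "\<dots> \<le> C * cmod (weighted_ft centered_freq_sq (t - s)) + C * (cmod e)\<^sup>2"
      using C1(1) C2 by (intro add_mono mult_right_mono) (auto simp: C_def)
    finally show "\<bar>expectation (\<lambda>\<omega>. Im (centered t \<omega> / F t \<omega>) * Im (centered s \<omega> / F s \<omega>))\<bar> \<le>
      C * ((cmod (weighted_ft centered_freq (t - s)))\<^sup>2 + cmod (weighted_ft centered_freq_sq (t - s)))"
      by (simp add: a_def b_def e_def algebra_simps)
  qed
qed

end

section \<open>Block decomposition of the variance\<close>

lemma (in prob_space) expectation_le_sqrt:
  fixes X :: "'a \<Rightarrow> real"
  assumes "integrable M X" "integrable M (\<lambda>x. (X x)\<^sup>2)"
  shows "expectation X \<le> sqrt (expectation (\<lambda>x. (X x)\<^sup>2))"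
proof -
  have "(expectation X)\<^sup>2 \<le> expectation (\<lambda>x. (X x)\<^sup>2)"
    using variance_eq[OF assms] variance_positive[of X] by simp
  then show ?thesis by (rule real_le_rsqrt)
qed

interpretation UU: pair_prob_space unit_lebesgue unit_lebesgue ..

lemma AE_unit_lebesgue_neq: "AE u in unit_lebesgue. u \<noteq> c"
  unfolding unit_lebesgue_def using AE_lborel_singleton[of c] by (subst AE_density) auto

lemma AE_UU_neq: "AE p in unit_square. fst p \<noteq> snd p"
proof (rule UU.AE_pair_measure)
  show "AE x in unit_lebesgue. AE y in unit_lebesgue. fst (x, y) \<noteq> snd (x, y)"
    using AE_unit_lebesgue_neq by (simp add: eq_commute)
qed measurable

lemma nn_integral_powr_neg_scaled:
  assumes h: "h > 0"
  shows "(\<integral>\<^sup>+x. ennreal (\<bar>x\<bar> powr (-3/4)) * indicator {-h..h} x \<partial>lborel) \<le> ennreal (8 * h powr (1/4))"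
proof -
  have "(\<integral>\<^sup>+x. ennreal (\<bar>x\<bar> powr (-3/4)) * indicator {-h..h} x \<partial>lborel) =
    ennreal h * (\<integral>\<^sup>+x. ennreal (\<bar>h * x\<bar> powr (-3/4)) * indicator {-h..h} (h * x) \<partial>lborel)"
    using nn_integral_real_affine[of "\<lambda>x. ennreal (\<bar>x\<bar> powr (-3/4)) * indicator {-h..h} x" h 0] h by simp
  also have "(\<integral>\<^sup>+x. ennreal (\<bar>h * x\<bar> powr (-3/4)) * indicator {-h..h} (h * x) \<partial>lborel) =
    (\<integral>\<^sup>+x. ennreal (h powr (-3/4)) * (ennreal (\<bar>x\<bar> powr (-3/4)) * indicator {-1..1} x) \<partial>lborel)"
  proof (intro nn_integral_cong)
    fix x :: real
    have "\<bar>h * x\<bar> powr (-3/4) = h powr (-3/4) * \<bar>x\<bar> powr (-3/4)"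
      using h by (simp add: abs_mult powr_mult)
    moreover have "-h \<le> h * x \<longleftrightarrow> -1 \<le> x" "h * x \<le> h \<longleftrightarrow> x \<le> 1"
      using h mult_le_cancel_left_pos[of h "-1" x] by auto
    ultimately show "ennreal (\<bar>h * x\<bar> powr (-3/4)) * indicator {-h..h} (h * x) = ennreal (h powr (-3/4)) * (ennreal (\<bar>x\<bar> powr (-3/4)) * indicator {-1..1} x)"
      by (simp add: ennreal_mult indicator_def)
  qed
  also have "\<dots> = ennreal (h powr (-3/4)) * (\<integral>\<^sup>+x. ennreal (\<bar>x\<bar> powr (-3/4)) * indicator {-1..1} x \<partial>lborel)"
    by (rule nn_integral_cmult) measurable
  also have "ennreal h * \<dots> \<le> ennreal h * (ennreal (h powr (-3/4)) * 8)"
    by (intro mult_left_mono nn_integral_powr_neg) auto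
  also have "\<dots> = ennreal (h * h powr (-3/4) * 8)"
    using h by (simp add: mult.assoc ennreal_mult)
  also have "h * h powr (-3/4) * 8 = 8 * h powr (1/4)"
  proof -
    have "h * h powr (-3/4) = h powr 1 * h powr (-3/4)" using h by simp
    also have "\<dots> = h powr (1/4)" by (simp only: powr_add[symmetric]) simp
    finally show ?thesis by simp
  qed
  finally show ?thesis .
qed

lemma nn_integral_unit_lebesgue:
  assumes [measurable]: "g \<in> borel_measurable borel"
  shows "(\<integral>\<^sup>+u. g u \<partial>unit_lebesgue) = (\<integral>\<^sup>+u. g u * indicator {0..1} u \<partial>lborel)"
  unfolding unit_lebesgue_def by (subst nn_integral_density) (auto simp: mult.commute)

text \<open>The inner integral runs over a window of half-width h around the singularity and costs
  h^(1/4); the outer variable contributes the side length h.\<close>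

lemma nn_integral_UU_square_powr:
  assumes h: "h > 0" and m: "a \<le> b" "b - a \<le> h"
  shows "(\<integral>\<^sup>+p. ennreal (\<bar>fst p - snd p\<bar> powr (-3/4)) * (indicator {a..b} (fst p) * indicator {a..b} (snd p)) \<partial>unit_square)
    \<le> ennreal (8 * h powr (1/4) * h)"
proof -
  have inner: "(\<integral>\<^sup>+v. ennreal (\<bar>u - v\<bar> powr (-3/4)) * indicator {a..b} v \<partial>unit_lebesgue) \<le> ennreal (8 * h powr (1/4))"
    if u: "u \<in> {a..b}" for u
  proof -
    have "(\<integral>\<^sup>+v. ennreal (\<bar>u - v\<bar> powr (-3/4)) * indicator {a..b} v \<partial>unit_lebesgue) \<le> (\<integral>\<^sup>+v. ennreal (\<bar>u - v\<bar> powr (-3/4)) * indicator {-h..h} (u - v) \<partial>lborel)"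
      using u m by (subst nn_integral_unit_lebesgue) (auto intro!: nn_integral_mono simp: indicator_def)
    also have "\<dots> = (\<integral>\<^sup>+x. ennreal (\<bar>x\<bar> powr (-3/4)) * indicator {-h..h} x \<partial>lborel)"
      using nn_integral_real_affine[of "\<lambda>x. ennreal (\<bar>x\<bar> powr (-3/4)) * indicator {-h..h} x" "-1" u] by simp
    also have "\<dots> \<le> ennreal (8 * h powr (1/4))" by (rule nn_integral_powr_neg_scaled[OF h])
    finally show ?thesis .
  qed
  have "(\<integral>\<^sup>+p. ennreal (\<bar>fst p - snd p\<bar> powr (-3/4)) * (indicator {a..b} (fst p) * indicator {a..b} (snd p)) \<partial>unit_square)
     = (\<integral>\<^sup>+u. (\<integral>\<^sup>+v. ennreal (\<bar>u - v\<bar> powr (-3/4)) * (indicator {a..b} u * indicator {a..b} v) \<partial>unit_lebesgue) \<partial>unit_lebesgue)"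
    by (subst unitL.nn_integral_fst[symmetric]) auto
  also have "\<dots> \<le> (\<integral>\<^sup>+u. ennreal (8 * h powr (1/4)) * indicator {a..b} u \<partial>unit_lebesgue)"
    using inner by (intro nn_integral_mono) (auto simp: indicator_def cong: if_cong)
  also have "\<dots> = ennreal (8 * h powr (1/4)) * emeasure unit_lebesgue {a..b}"
    by (rule nn_integral_cmult_indicator) simp
  also have "\<dots> \<le> ennreal (8 * h powr (1/4)) * ennreal h"
  proof (intro mult_left_mono)
    have "emeasure unit_lebesgue {a..b} = (\<integral>\<^sup>+u. indicator {a..b} u * indicator {0..1} u \<partial>lborel)"
      by (subst nn_integral_indicator[symmetric], simp, subst nn_integral_unit_lebesgue) auto
    also have "\<dots> \<le> (\<integral>\<^sup>+u. indicator {a..b} u \<partial>lborel)" by (intro nn_integral_mono) (auto simp: indicator_def)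
    also have "\<dots> = ennreal (b - a)" using m by simp
    also have "\<dots> \<le> ennreal h" using m by (intro ennreal_leI) auto
    finally show "emeasure unit_lebesgue {a..b} \<le> ennreal h" .
  qed simp
  finally show ?thesis using h by (simp add: ennreal_mult)
qed

section \<open>Second moments of time integrals of the winding rate\<close>

context stationary_gaussian
begin

definition winding_rate :: "real \<Rightarrow> 'a \<Rightarrow> real" where
  "winding_rate t \<omega> = Im (centered t \<omega> / F t \<omega>)"

lemma winding_rate_measurable[measurable (raw)]:
  assumes [measurable]: "f \<in> borel_measurable N" "g \<in> measurable N M"
  shows "(\<lambda>x. winding_rate (f x) (g x)) \<in> borel_measurable N"
  unfolding winding_rate_def by measurable

text \<open>For t = s the product is a square without finite expectation, and the integral takes its
  default value 0. Only almost every pair of times matters.\<close>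

definition kernel :: "real \<Rightarrow> real \<Rightarrow> real" where
  "kernel t s = expectation (\<lambda>\<omega>. winding_rate t \<omega> * winding_rate s \<omega>)"

text \<open>Time is measured in units of T, so a block of width h has true length T h. For
  \<open>UNIV\<close> the measure \<open>unit_lebesgue\<close> restricts the integral to
  [0, 1].\<close>

definition block_integral :: "real \<Rightarrow> real set \<Rightarrow> 'a \<Rightarrow> real" where
  "block_integral T A \<omega> = (\<integral>u. indicator A u * winding_rate (T * u) \<omega> \<partial>unit_lebesgue)"

sublocale UUM: pair_prob_space "unit_square" M ..
sublocale UM: pair_prob_space unit_lebesgue M ..

lemma kernel_near':
  "\<exists>C>0. \<forall>t s. t \<noteq> s \<longrightarrow> (\<integral>\<^sup>+\<omega>. ennreal \<bar>winding_rate t \<omega> * winding_rate s \<omega>\<bar> \<partial>M) \<le> ennreal (C * defect (t - s) powr (-3/8))"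
proof -
  obtain C where C: "0 < C" "\<And>t s. t \<noteq> s \<Longrightarrow> (\<integral>\<^sup>+\<omega>. ennreal (cmod (centered t \<omega> / F t \<omega>) * cmod (centered s \<omega> / F s \<omega>)) \<partial>M) \<le> ennreal (C * defect (t - s) powr (-3/8))"
    using kernel_near by blast
  have "(\<integral>\<^sup>+\<omega>. ennreal \<bar>winding_rate t \<omega> * winding_rate s \<omega>\<bar> \<partial>M) \<le> (\<integral>\<^sup>+\<omega>. ennreal (cmod (centered t \<omega> / F t \<omega>) * cmod (centered s \<omega> / F s \<omega>)) \<partial>M)" for t s
    unfolding winding_rate_def abs_mult by (intro nn_integral_mono ennreal_leI mult_mono abs_Im_le_cmod) auto
  then show ?thesis using C by (meson order_trans)
qed

text \<open>The quadratic lower bound makes defect^(-3/8) comparable to lag^(-3/4), whose exponent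
  above -1 is integrable. The constant depends on the range \<open>l\<close> of lags.\<close>

lemma defect_powr_bound:
  assumes "l > 0"
  shows "\<exists>c>0. \<forall>\<tau>. \<tau> \<noteq> 0 \<longrightarrow> \<bar>\<tau>\<bar> \<le> l \<longrightarrow> defect \<tau> powr (-3/8) \<le> c * \<bar>\<tau>\<bar> powr (-3/4)"
proof -
  obtain c where c: "c > 0" "\<And>\<tau>. \<bar>\<tau>\<bar> \<le> l \<Longrightarrow> c * \<tau>\<^sup>2 \<le> 1 - (cmod (cov_r \<tau>))\<^sup>2"
    using cov_r_defect_lower_bound[OF assms] by blast
  show ?thesis
  proof (intro exI[of _ "c powr (-3/8)"] conjI allI impI)
    show "0 < c powr (-3/8)" using c by simp
    fix \<tau> :: real assume \<tau>: "\<tau> \<noteq> 0" "\<bar>\<tau>\<bar> \<le> l"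
    have "defect \<tau> powr (-3/8) \<le> (c * \<bar>\<tau>\<bar>\<^sup>2) powr (-3/8)"
      using c \<tau> by (intro powr_mono2') (auto simp: defect_def)
    also have "\<dots> = c powr (-3/8) * \<bar>\<tau>\<bar> powr (-3/4)"
    proof -
      have "(\<bar>\<tau>\<bar>\<^sup>2) powr (-3/8) = (\<bar>\<tau>\<bar> powr 2) powr (-3/8)" using \<tau> by (subst powr_numeral) auto
      also have "\<dots> = \<bar>\<tau>\<bar> powr (-3/4)" by (simp only: powr_powr) simp
      finally show ?thesis by (simp only: powr_mult)
    qed
    finally show "defect \<tau> powr (-3/8) \<le> c powr (-3/8) * \<bar>\<tau>\<bar> powr (-3/4)" .
  qed
qed

text \<open>Within a block the true lags are at most T h \<le> l, so a single constant bounds the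
  singularity for all positions and all T. Rescaling the lag gives T^(-3/4), and integration over
  the square gives h^(5/4).\<close>

lemma nn_integral_rate_product:
  assumes "l > 0"
  shows "\<exists>C>0. \<forall>T>0. \<forall>h>0. \<forall>a b. a \<le> b \<longrightarrow> b - a \<le> h \<longrightarrow> T * h \<le> l \<longrightarrow>
    (\<integral>\<^sup>+p. indicator {a..b} (fst p) * indicator {a..b} (snd p) * (\<integral>\<^sup>+\<omega>. ennreal \<bar>winding_rate (T * fst p) \<omega> * winding_rate (T * snd p) \<omega>\<bar> \<partial>M) \<partial>unit_square)
    \<le> ennreal (C * T powr (-3/4) * h powr (5/4))"
proof -
  obtain C where C: "0 < C" "\<And>t s. t \<noteq> s \<Longrightarrow> (\<integral>\<^sup>+\<omega>. ennreal \<bar>winding_rate t \<omega> * winding_rate s \<omega>\<bar> \<partial>M) \<le> ennreal (C * defect (t - s) powr (-3/8))"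
    using kernel_near' by blast
  obtain c where c: "0 < c" "\<And>\<tau>. \<tau> \<noteq> 0 \<Longrightarrow> \<bar>\<tau>\<bar> \<le> l \<Longrightarrow> defect \<tau> powr (-3/8) \<le> c * \<bar>\<tau>\<bar> powr (-3/4)"
    using defect_powr_bound[OF assms] by blast
  show ?thesis
  proof (intro exI[of _ "8 * C * c"] conjI allI impI)
    show "0 < 8 * C * c" using C c by simp
    fix T h a b :: real assume T: "0 < T" "0 < h" "a \<le> b" "b - a \<le> h" "T * h \<le> l"
    let ?k = "\<lambda>p. (\<integral>\<^sup>+\<omega>. ennreal \<bar>winding_rate (T * fst p) \<omega> * winding_rate (T * snd p) \<omega>\<bar> \<partial>M)"
    let ?i = "\<lambda>p. indicator {a..b} (fst p) * indicator {a..b} (snd p) :: ennreal"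
    have "(\<integral>\<^sup>+p. ?i p * ?k p \<partial>unit_square) \<le>
      (\<integral>\<^sup>+p. ennreal (C * c * T powr (-3/4)) * (ennreal (\<bar>fst p - snd p\<bar> powr (-3/4)) * ?i p) \<partial>unit_square)"
    proof (rule nn_integral_mono_AE)
      show "AE p in unit_square. ?i p * ?k p \<le> ennreal (C * c * T powr (-3/4)) * (ennreal (\<bar>fst p - snd p\<bar> powr (-3/4)) * ?i p)"
        using AE_UU_neq
      proof eventually_elim
        case (elim p)
        show ?case
        proof (cases "fst p \<in> {a..b} \<and> snd p \<in> {a..b}")
          case True
          have ne: "T * fst p \<noteq> T * snd p" using elim T by simp
          have "\<bar>T * fst p - T * snd p\<bar> = T * \<bar>fst p - snd p\<bar>" using T by (simp add: abs_mult flip: right_diff_distrib)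
          moreover have "\<bar>fst p - snd p\<bar> \<le> h" using True T by auto
          then have "T * \<bar>fst p - snd p\<bar> \<le> l" using T mult_left_mono[of "\<bar>fst p - snd p\<bar>" h T] by linarith
          ultimately have *: "\<bar>T * fst p - T * snd p\<bar> \<le> l" "\<bar>T * fst p - T * snd p\<bar> = T * \<bar>fst p - snd p\<bar>" using T by auto
          have "?k p \<le> ennreal (C * defect (T * fst p - T * snd p) powr (-3/8))" by (rule C(2)[OF ne])
          also have "\<dots> \<le> ennreal (C * (c * \<bar>T * fst p - T * snd p\<bar> powr (-3/4)))"
            using C(1) c(2)[of "T * fst p - T * snd p"] ne * by (intro ennreal_leI mult_left_mono) auto
          also have "\<dots> = ennreal (C * c * T powr (-3/4)) * ennreal (\<bar>fst p - snd p\<bar> powr (-3/4))"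
            unfolding *(2) using C c T by (simp add: powr_mult mult_ac flip: ennreal_mult)
          finally show ?thesis using True by simp
        qed (auto simp: indicator_def)
      qed
    qed
    also have "\<dots> = ennreal (C * c * T powr (-3/4)) * (\<integral>\<^sup>+p. ennreal (\<bar>fst p - snd p\<bar> powr (-3/4)) * ?i p \<partial>unit_square)"
      by (rule nn_integral_cmult) measurable
    also have "\<dots> \<le> ennreal (C * c * T powr (-3/4)) * ennreal (8 * h powr (1/4) * h)"
      using T by (intro mult_left_mono nn_integral_UU_square_powr) auto
    also have "\<dots> = ennreal (8 * C * c * T powr (-3/4) * h powr (5/4))"
    proof -
      have "h powr (1/4) * h = h powr (1/4) * h powr 1" using T by simp
      also have "\<dots> = h powr (5/4)" by (simp only: powr_add[symmetric]) simp
      finally have e: "8 * h powr (1/4) * h = 8 * h powr (5/4)" by simp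
      show ?thesis unfolding e using C c by (simp add: mult_ac flip: ennreal_mult)
    qed
    finally show "(\<integral>\<^sup>+p. ?i p * ?k p \<partial>unit_square) \<le> ennreal (8 * C * c * T powr (-3/4) * h powr (5/4))" .
  qed
qed

text \<open>The whole interval is one block of width h = 1 with lag range T. The resulting constant
  depends on T, which is harmless for integrability.\<close>

lemma integrable_rate_product:
  assumes T: "T > 0"
  shows "integrable (unit_square \<Otimes>\<^sub>M M) (\<lambda>(p, \<omega>). winding_rate (T * fst p) \<omega> * winding_rate (T * snd p) \<omega>)"
proof (rule integrableI_bounded)
  obtain C where C: "C > 0 \<and> (\<forall>S>0. \<forall>h>0. \<forall>a b. a \<le> b \<longrightarrow> b - a \<le> h \<longrightarrow> S * h \<le> T \<longrightarrow>
    (\<integral>\<^sup>+p. indicator {a..b} (fst p) * indicator {a..b} (snd p) * (\<integral>\<^sup>+\<omega>. ennreal \<bar>winding_rate (S * fst p) \<omega> * winding_rate (S * snd p) \<omega>\<bar> \<partial>M) \<partial>unit_square)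
    \<le> ennreal (C * S powr (-3/4) * h powr (5/4)))"
    using nn_integral_rate_product[OF T] by (rule exE)
  have ind: "AE p in unit_square. fst p \<in> {0..1} \<and> snd p \<in> {0..1}"
  proof (rule UU.AE_pair_measure)
    have "AE u in unit_lebesgue. u \<in> {0..1}" unfolding unit_lebesgue_def by (subst AE_density) (auto simp: indicator_def)
    then show "AE x in unit_lebesgue. AE y in unit_lebesgue. fst (x, y) \<in> {0..1} \<and> snd (x, y) \<in> {0..1}"
      by auto
  qed measurable
  have "(\<integral>\<^sup>+x. ennreal (norm (case x of (p, \<omega>) \<Rightarrow> winding_rate (T * fst p) \<omega> * winding_rate (T * snd p) \<omega>)) \<partial>(unit_square \<Otimes>\<^sub>M M))
    = (\<integral>\<^sup>+p. (\<integral>\<^sup>+\<omega>. ennreal \<bar>winding_rate (T * fst p) \<omega> * winding_rate (T * snd p) \<omega>\<bar> \<partial>M) \<partial>unit_square)"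
    by (subst nn_integral_fst[symmetric]) (auto simp: case_prod_beta')
  also have "\<dots> = (\<integral>\<^sup>+p. indicator {0..1} (fst p) * indicator {0..1} (snd p) * (\<integral>\<^sup>+\<omega>. ennreal \<bar>winding_rate (T * fst p) \<omega> * winding_rate (T * snd p) \<omega>\<bar> \<partial>M) \<partial>unit_square)"
    by (rule nn_integral_cong_AE) (use ind in \<open>eventually_elim, auto\<close>)
  also have "\<dots> \<le> ennreal (C * T powr (-3/4) * 1 powr (5/4))"
    by (rule C[THEN conjunct2, rule_format]) (use T in auto)
  also have "\<dots> < \<infinity>" by simp
  finally show "(\<integral>\<^sup>+x. ennreal (norm (case x of (p, \<omega>) \<Rightarrow> winding_rate (T * fst p) \<omega> * winding_rate (T * snd p) \<omega>)) \<partial>(unit_square \<Otimes>\<^sub>M M)) < \<infinity>" .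
qed measurable

text \<open>By Tonelli the square of the path integral of |rate| is the integral of the product over
  the unit square, which is almost surely finite.\<close>

lemma AE_integrable_rate:
  assumes T: "T > 0"
  shows "AE \<omega> in M. integrable unit_lebesgue (\<lambda>u. winding_rate (T * u) \<omega>)"
proof -
  have "AE \<omega> in M. integrable unit_square (\<lambda>p. winding_rate (T * fst p) \<omega> * winding_rate (T * snd p) \<omega>)"
    using UUM.AE_integrable_snd[OF integrable_rate_product[OF T]] by simp
  then show ?thesis
  proof (rule AE_mp, intro AE_I2 impI)
    fix \<omega> assume \<omega>: "\<omega> \<in> space M" and i: "integrable unit_square (\<lambda>p. winding_rate (T * fst p) \<omega> * winding_rate (T * snd p) \<omega>)"
    have [measurable]: "(\<lambda>u. winding_rate (T * u) \<omega>) \<in> borel_measurable borel" using \<omega> by measurable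
    define S where "S = (\<integral>\<^sup>+u. ennreal \<bar>winding_rate (T * u) \<omega>\<bar> \<partial>unit_lebesgue)"
    have "S * S = (\<integral>\<^sup>+p. ennreal (norm (winding_rate (T * fst p) \<omega> * winding_rate (T * snd p) \<omega>)) \<partial>unit_square)"
      by (subst unitL.nn_integral_fst[symmetric]) (auto simp: abs_mult ennreal_mult nn_integral_cmult nn_integral_multc S_def)
    also have "\<dots> < \<infinity>" using i unfolding integrable_iff_bounded by simp
    finally have "S < \<infinity>" by (cases S) (auto simp: ennreal_top_mult)
    then show "integrable unit_lebesgue (\<lambda>u. winding_rate (T * u) \<omega>)"
      by (intro integrableI_bounded) (auto simp: S_def)
  qed
qed

end

context stationary_gaussian
begin

lemma kernel_integrable:
  assumes T: "T > 0"
  shows "integrable unit_square (\<lambda>p. kernel (T * fst p) (T * snd p))"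
  using UUM.integrable_fst'[OF integrable_rate_product[OF T]] by (simp add: kernel_def)

lemma block_integral_measurable:
  assumes [measurable]: "A \<in> sets borel"
  shows "block_integral T A \<in> borel_measurable M"
  unfolding block_integral_def by measurable

text \<open>For almost every path the product of two block integrals is a double integral over the
  square; Fubini then brings the expectation inside and produces the kernel.\<close>

lemma block_integral_product:
  assumes T: "T > 0" and [measurable]: "A \<in> sets borel" "B \<in> sets borel"
  shows "integrable M (\<lambda>\<omega>. block_integral T A \<omega> * block_integral T B \<omega>)"
    and "expectation (\<lambda>\<omega>. block_integral T A \<omega> * block_integral T B \<omega>) =
      (\<integral>p. indicator A (fst p) * indicator B (snd p) * kernel (T * fst p) (T * snd p) \<partial>unit_square)"
proof -
  define G where "G p \<omega> = indicator A (fst p) * indicator B (snd p) * (winding_rate (T * fst p) \<omega> * winding_rate (T * snd p) \<omega>)" for p \<omega>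
  have Gm[measurable]: "(\<lambda>x. G (fst x) (snd x)) \<in> borel_measurable ((borel \<Otimes>\<^sub>M borel) \<Otimes>\<^sub>M M)"
    unfolding G_def by measurable
  have G: "integrable (unit_square \<Otimes>\<^sub>M M) (\<lambda>(p, \<omega>). G p \<omega>)"
  proof (rule Bochner_Integration.integrable_bound[OF integrable_rate_product[OF T]])
    show "AE x in unit_square \<Otimes>\<^sub>M M. norm (case x of (p, \<omega>) \<Rightarrow> G p \<omega>)
       \<le> norm (case x of (p, \<omega>) \<Rightarrow> winding_rate (T * fst p) \<omega> * winding_rate (T * snd p) \<omega>)"
      by (intro AE_I2) (auto simp: G_def indicator_def split: prod.split)
  qed (simp add: case_prod_beta')
  note [measurable] = block_integral_measurable[OF assms(2), of T] block_integral_measurable[OF assms(3), of T]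
  have eq: "AE \<omega> in M. block_integral T A \<omega> * block_integral T B \<omega> = (\<integral>p. G p \<omega> \<partial>unit_square)"
    using AE_integrable_rate[OF T]
  proof (rule AE_mp, intro AE_I2 impI)
    fix \<omega> assume \<omega>: "\<omega> \<in> space M" and i: "integrable unit_lebesgue (\<lambda>u. winding_rate (T * u) \<omega>)"
    have [measurable]: "(\<lambda>u. winding_rate (T * u) \<omega>) \<in> borel_measurable borel" using \<omega> by measurable
    have iA: "integrable unit_lebesgue (\<lambda>u. indicator A u * winding_rate (T * u) \<omega>)" if [measurable]: "A \<in> sets borel" for A
      by (rule Bochner_Integration.integrable_bound[OF i]) (auto simp: indicator_def)
    have i2: "integrable unit_square (\<lambda>p. (indicator A (fst p) * winding_rate (T * fst p) \<omega>) * (indicator B (snd p) * winding_rate (T * snd p) \<omega>))"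
      using iA[of A] iA[of B] integrable_abs[OF iA[of A]] by (intro UU.Fubini_integrable) (auto simp: abs_mult)
    have "(\<integral>p. G p \<omega> \<partial>unit_square) = (\<integral>p. (indicator A (fst p) * winding_rate (T * fst p) \<omega>) * (indicator B (snd p) * winding_rate (T * snd p) \<omega>) \<partial>unit_square)"
      by (simp add: G_def mult_ac)
    also have "\<dots> = block_integral T A \<omega> * block_integral T B \<omega>"
      using UU.integral_fst'[OF i2] by (simp add: block_integral_def)
    finally show "block_integral T A \<omega> * block_integral T B \<omega> = (\<integral>p. G p \<omega> \<partial>unit_square)" ..
  qed
  have mI: "(\<lambda>\<omega>. \<integral>p. G p \<omega> \<partial>unit_square) \<in> borel_measurable M"
    using UUM.integrable_snd[OF G] by (rule borel_measurable_integrable)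
  have i: "integrable M (\<lambda>\<omega>. \<integral>p. G p \<omega> \<partial>unit_square)"
    using UUM.integrable_snd[OF G] .
  show "integrable M (\<lambda>\<omega>. block_integral T A \<omega> * block_integral T B \<omega>)"
    using i by (subst integrable_cong_AE[OF _ mI eq]) auto
  have "expectation (\<lambda>\<omega>. block_integral T A \<omega> * block_integral T B \<omega>) = expectation (\<lambda>\<omega>. \<integral>p. G p \<omega> \<partial>unit_square)"
    by (rule integral_cong_AE[OF _ mI eq]) auto
  also have "\<dots> = (\<integral>p. expectation (\<lambda>\<omega>. G p \<omega>) \<partial>unit_square)"
    by (rule UUM.Fubini_integral[OF G])
  also have "\<dots> = (\<integral>p. indicator A (fst p) * indicator B (snd p) * kernel (T * fst p) (T * snd p) \<partial>unit_square)"
    by (simp add: G_def kernel_def)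
  finally show "expectation (\<lambda>\<omega>. block_integral T A \<omega> * block_integral T B \<omega>) =
      (\<integral>p. indicator A (fst p) * indicator B (snd p) * kernel (T * fst p) (T * snd p) \<partial>unit_square)" .
qed

text \<open>The quantity every pair of blocks is charged to. The last two terms are those of
  \<open>kernel_far\<close>; the first is bounded below on strongly correlated pairs. All three have
  vanishing averages.\<close>

definition cov_energy :: "real \<Rightarrow> real" where
  "cov_energy t = (cmod (cov_r t))\<^sup>2 + (cmod (weighted_ft centered_freq t))\<^sup>2 + cmod (weighted_ft centered_freq_sq t)"

lemma cov_energy_measurable[measurable]: "cov_energy \<in> borel_measurable borel"
  unfolding cov_energy_def cov_r_def by measurable

lemma cov_energy_nonneg: "0 \<le> cov_energy t"
  by (simp add: cov_energy_def)

lemma cov_energy_integrable: "integrable unit_square (\<lambda>p. cov_energy (T * (fst p - snd p)))"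
proof (rule UU.P.integrable_const_bound[where B="(\<integral>l. \<bar>1\<bar> \<partial>\<rho>)\<^sup>2 + (\<integral>l. \<bar>centered_freq l\<bar> \<partial>\<rho>)\<^sup>2 + (\<integral>l. \<bar>centered_freq_sq l\<bar> \<partial>\<rho>)"])
  have "cov_energy t \<le> (\<integral>l. \<bar>1\<bar> \<partial>\<rho>)\<^sup>2 + (\<integral>l. \<bar>centered_freq l\<bar> \<partial>\<rho>)\<^sup>2 + (\<integral>l. \<bar>centered_freq_sq l\<bar> \<partial>\<rho>)" for t
    unfolding cov_energy_def cov_r_def by (intro add_mono power_mono norm_weighted_ft_le integrable_centered_freq) auto
  then show "AE p in unit_square. norm (cov_energy (T * (fst p - snd p))) \<le> (\<integral>l. \<bar>1\<bar> \<partial>\<rho>)\<^sup>2 + (\<integral>l. \<bar>centered_freq l\<bar> \<partial>\<rho>)\<^sup>2 + (\<integral>l. \<bar>centered_freq_sq l\<bar> \<partial>\<rho>)"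
    using cov_energy_nonneg by (intro AE_I2) simp
qed measurable

text \<open>Wiener's lemma handles the squared terms; the unsquared one is at most the square root
  of a Wiener average by Jensen's inequality.\<close>

lemma cov_energy_mean_tendsto:
  "((\<lambda>T. \<integral>p. cov_energy (T * (fst p - snd p)) \<partial>unit_square) \<longlongrightarrow> 0) at_top"
proof -
  define W where "W h T = (\<integral>p. (cmod (weighted_ft h (T * (fst p - snd p))))\<^sup>2 \<partial>unit_square)" for h T
  have Wi: "integrable unit_square (\<lambda>p. (cmod (weighted_ft h (T * (fst p - snd p))))\<^sup>2)" if h: "integrable \<rho> h" for h T
  proof -
    have [measurable]: "h \<in> borel_measurable borel" using borel_measurable_integrable[OF h] by simp
    show ?thesis
      by (rule UU.P.integrable_const_bound[where B="(\<integral>l. \<bar>h l\<bar> \<partial>\<rho>)\<^sup>2"]) (auto intro!: power_mono norm_weighted_ft_le h)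
  qed
  have W: "(W h \<longlongrightarrow> 0) at_top" if h: "integrable \<rho> h" for h
    using wiener[OF h] UU.integral_fst'[OF Wi[OF h]] by (simp add: W_def[abs_def])
  have one: "integrable \<rho> (\<lambda>_. 1::real)" by simp
  have A2: "integrable unit_square (\<lambda>p. cmod (weighted_ft centered_freq_sq (T * (fst p - snd p))))" for T
    by (rule UU.P.integrable_const_bound[where B="\<integral>l. \<bar>centered_freq_sq l\<bar> \<partial>\<rho>"]) (auto intro!: norm_weighted_ft_le integrable_centered_freq)
  have le: "(\<integral>p. cov_energy (T * (fst p - snd p)) \<partial>unit_square) \<le> W (\<lambda>_. 1) T + W centered_freq T + sqrt (W centered_freq_sq T)" for T
  proof -
    have "(\<integral>p. cov_energy (T * (fst p - snd p)) \<partial>unit_square) =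
      W (\<lambda>_. 1) T + W centered_freq T + (\<integral>p. cmod (weighted_ft centered_freq_sq (T * (fst p - snd p))) \<partial>unit_square)"
      unfolding cov_energy_def cov_r_def W_def using Wi[OF one] Wi[OF integrable_centered_freq(1)] A2 by simp
    then show ?thesis using UU.P.expectation_le_sqrt[OF A2 Wi[OF integrable_centered_freq(2)]] by (simp add: W_def)
  qed
  have "((\<lambda>T. W (\<lambda>_. 1) T + W centered_freq T + sqrt (W centered_freq_sq T)) \<longlongrightarrow> 0 + 0 + sqrt 0) at_top"
    by (intro tendsto_intros W one integrable_centered_freq)
  then have lim: "((\<lambda>T. W (\<lambda>_. 1) T + W centered_freq T + sqrt (W centered_freq_sq T)) \<longlongrightarrow> 0) at_top" by simp
  show ?thesis
  proof (rule tendsto_sandwich[OF _ _ tendsto_const lim])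
    show "\<forall>\<^sub>F T in at_top. 0 \<le> (\<integral>p. cov_energy (T * (fst p - snd p)) \<partial>unit_square)"
      by (intro always_eventually allI Bochner_Integration.integral_nonneg cov_energy_nonneg)
    show "\<forall>\<^sub>F T in at_top. (\<integral>p. cov_energy (T * (fst p - snd p)) \<partial>unit_square) \<le> W (\<lambda>_. 1) T + W centered_freq T + sqrt (W centered_freq_sq T)"
      by (intro always_eventually allI le)
  qed
qed

lemma cov_r_lipschitz: "cmod (cov_r t - cov_r s) \<le> (\<integral>l. \<bar>l\<bar> \<partial>\<rho>) * \<bar>t - s\<bar>"
proof -
  have one: "integrable \<rho> (\<lambda>_. 1::real)" by simp
  have i: "integrable \<rho> (\<lambda>l. fourier_mode t l)" for t using weighted_ft_integrable[OF one, of t] by simp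
  have "cov_r t - cov_r s = (\<integral>l. fourier_mode t l - fourier_mode s l \<partial>\<rho>)"
    using i by (simp add: cov_r_def weighted_ft_def)
  also have "cmod \<dots> \<le> (\<integral>l. \<bar>l\<bar> * \<bar>t - s\<bar> \<partial>\<rho>)"
  proof (rule norm_integral_le)
    show "integrable \<rho> (\<lambda>l. \<bar>l\<bar> * \<bar>t - s\<bar>)" using integrable_freq by simp
    fix l
    have "fourier_mode t l - fourier_mode s l = fourier_mode s l * (iexp (- ((t - s) * l)) - 1)"
      using fourier_mode_add[of s "t - s" l] by (simp add: algebra_simps)
    then show "cmod (fourier_mode t l - fourier_mode s l) \<le> \<bar>l\<bar> * \<bar>t - s\<bar>"
      using iexp_bounds(2)[of "- ((t - s) * l)"] by (simp add: norm_mult abs_mult mult.commute)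
  qed simp
  finally show ?thesis by simp
qed

end

lemma measure_unit_lebesgue_Ico:
  assumes "0 \<le> a" "a \<le> b" "b \<le> 1"
  shows "measure unit_lebesgue {a..<b} = b - a"
proof -
  have "emeasure unit_lebesgue {a..<b} = (\<integral>\<^sup>+u. indicator {a..<b} u * indicator {0..1} u \<partial>lborel)"
    by (subst nn_integral_indicator[symmetric], simp, subst nn_integral_unit_lebesgue) auto
  also have "\<dots> = (\<integral>\<^sup>+u. indicator {a..<b} u \<partial>lborel)"
    using assms by (intro nn_integral_cong) (auto simp: indicator_def)
  also have "\<dots> = ennreal (b - a)" using assms by simp
  finally show ?thesis using assms by (simp add: measure_def)
qed

text \<open>Half-open blocks contain each point of [0, 1) exactly once; the endpoint 1 is missed and
  is a null set.\<close>

lemma AE_sum_blocks: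
  assumes n: "n > 0"
  shows "AE u in unit_lebesgue. (\<Sum>j<n. indicator {real j / real n..<real (Suc j) / real n} u) = (1::real)"
proof -
  have "AE u in unit_lebesgue. u \<in> {0..1}"
    unfolding unit_lebesgue_def by (subst AE_density) (auto simp: indicator_def)
  with AE_unit_lebesgue_neq[of 1] show ?thesis
  proof eventually_elim
    case (elim u)
    then have u: "0 \<le> u" "u < 1" by auto
    define k where "k = nat \<lfloor>u * real n\<rfloor>"
    have k0: "real k \<le> u * real n" "u * real n < real k + 1"
      using u by (auto simp: k_def)
    have "u * real n < 1 * real n" using n by (intro mult_strict_right_mono u(2)) simp
    then have "real k < real n" using k0(1) by linarith
    then have k: "k < n" by simp
    have eq: "indicator {real j / real n..<real (Suc j) / real n} u = (if j = k then 1 else (0::real))" for j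
    proof -
      have "u \<in> {real j / real n..<real (Suc j) / real n} \<longleftrightarrow> real j \<le> u * real n \<and> u * real n < real j + 1"
        using n by (simp add: divide_le_eq less_divide_eq add.commute)
      also have "\<dots> \<longleftrightarrow> j = k"
      proof
        assume "real j \<le> u * real n \<and> u * real n < real j + 1"
        then have "real j < real k + 1" "real k < real j + 1" using k0 by linarith+
        then show "j = k" by linarith
      qed (use k0 in auto)
      finally show ?thesis by (simp add: indicator_def)
    qed
    show ?case unfolding eq using k by simp
  qed
qed

section \<open>Comparison of block pairs with the averaged covariance energy\<close>

context stationary_gaussian
begin

text \<open>The bound T^(-3/4) h^(5/4) equals (T h)^(-3/4) h^2. Keeping the true length T h above l
  / 2 leaves a constant times h^2, the area of a pair of blocks, so that Cauchy-Schwarz estimates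
  can be charged to an integral over the pair.\<close>

lemma block_second_moment:
  assumes l: "l > 0"
  shows "\<exists>C>0. \<forall>T>0. \<forall>h>0. \<forall>a b. a \<le> b \<longrightarrow> b - a \<le> h \<longrightarrow> l / 2 \<le> T * h \<longrightarrow> T * h \<le> l \<longrightarrow>
    expectation (\<lambda>\<omega>. (block_integral T {a..<b} \<omega>)\<^sup>2) \<le> C * h\<^sup>2"
proof -
  have "\<exists>C. C > 0 \<and> (\<forall>T>0. \<forall>h>0. \<forall>a b. a \<le> b \<longrightarrow> b - a \<le> h \<longrightarrow> T * h \<le> l \<longrightarrow>
    (\<integral>\<^sup>+p. indicator {a..b} (fst p) * indicator {a..b} (snd p) * (\<integral>\<^sup>+\<omega>. ennreal \<bar>winding_rate (T * fst p) \<omega> * winding_rate (T * snd p) \<omega>\<bar> \<partial>M) \<partial>unit_square)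
    \<le> ennreal (C * T powr (-3/4) * h powr (5/4)))"
    using nn_integral_rate_product[OF l] .
  then obtain C where "C > 0 \<and> (\<forall>T>0. \<forall>h>0. \<forall>a b. a \<le> b \<longrightarrow> b - a \<le> h \<longrightarrow> T * h \<le> l \<longrightarrow>
    (\<integral>\<^sup>+p. indicator {a..b} (fst p) * indicator {a..b} (snd p) * (\<integral>\<^sup>+\<omega>. ennreal \<bar>winding_rate (T * fst p) \<omega> * winding_rate (T * snd p) \<omega>\<bar> \<partial>M) \<partial>unit_square)
    \<le> ennreal (C * T powr (-3/4) * h powr (5/4)))" by (rule exE)
  note C = this[THEN conjunct1] this[THEN conjunct2, rule_format]
  show ?thesis
  proof (intro exI[of _ "C * (l / 2) powr (-3/4)"] conjI allI impI)
    show "0 < C * (l / 2) powr (-3/4)" using C(1) l by simp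
    fix T h a b :: real assume T: "0 < T" "0 < h" "a \<le> b" "b - a \<le> h" "l / 2 \<le> T * h" "T * h \<le> l"
    let ?i = "\<lambda>p. indicator {a..<b} (fst p) * indicator {a..<b} (snd p) :: real"
    have ki: "integrable unit_square (\<lambda>p. ?i p * kernel (T * fst p) (T * snd p))"
    proof (rule Bochner_Integration.integrable_bound[OF kernel_integrable[OF T(1)]])
      show "(\<lambda>p. ?i p * kernel (T * fst p) (T * snd p)) \<in> borel_measurable unit_square"
        by (rule borel_measurable_times[OF _ borel_measurable_integrable[OF kernel_integrable[OF T(1)]]]) measurable
    qed (auto simp: indicator_def)
    have "ennreal (expectation (\<lambda>\<omega>. (block_integral T {a..<b} \<omega>)\<^sup>2)) = ennreal (norm (\<integral>p. ?i p * kernel (T * fst p) (T * snd p) \<partial>unit_square))"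
      using block_integral_product(2)[OF T(1), of "{a..<b}" "{a..<b}"] Bochner_Integration.integral_nonneg[of M "\<lambda>\<omega>. (block_integral T {a..<b} \<omega>)\<^sup>2"]
      by (simp add: power2_eq_square)
    also have "\<dots> \<le> (\<integral>\<^sup>+p. ennreal (norm (?i p * kernel (T * fst p) (T * snd p))) \<partial>unit_square)"
      by (rule integral_norm_bound_ennreal[OF ki])
    also have "\<dots> \<le> (\<integral>\<^sup>+p. indicator {a..b} (fst p) * indicator {a..b} (snd p) * (\<integral>\<^sup>+\<omega>. ennreal \<bar>winding_rate (T * fst p) \<omega> * winding_rate (T * snd p) \<omega>\<bar> \<partial>M) \<partial>unit_square)"
    proof (intro nn_integral_mono)
      fix p :: "real \<times> real"
      have "ennreal \<bar>kernel (T * fst p) (T * snd p)\<bar> \<le> (\<integral>\<^sup>+\<omega>. ennreal \<bar>winding_rate (T * fst p) \<omega> * winding_rate (T * snd p) \<omega>\<bar> \<partial>M)"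
      proof (cases "integrable M (\<lambda>\<omega>. winding_rate (T * fst p) \<omega> * winding_rate (T * snd p) \<omega>)")
        case True
        then show ?thesis using integral_norm_bound_ennreal[OF True] by (simp add: kernel_def)
      qed (simp add: kernel_def not_integrable_integral_eq)
      then show "ennreal (norm (?i p * kernel (T * fst p) (T * snd p))) \<le> indicator {a..b} (fst p) * indicator {a..b} (snd p) * (\<integral>\<^sup>+\<omega>. ennreal \<bar>winding_rate (T * fst p) \<omega> * winding_rate (T * snd p) \<omega>\<bar> \<partial>M)"
        by (auto simp: indicator_def)
    qed
    also have "\<dots> \<le> ennreal (C * T powr (-3/4) * h powr (5/4))" by (rule C(2)) (use T in auto)
    finally have "expectation (\<lambda>\<omega>. (block_integral T {a..<b} \<omega>)\<^sup>2) \<le> C * T powr (-3/4) * h powr (5/4)"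
      using C(1) by simp
    also have "\<dots> \<le> C * ((l / 2) powr (-3/4) * h powr (3/4)) * h powr (5/4)"
    proof (intro mult_right_mono mult_left_mono)
      have "T powr (-3/4) = (T * h) powr (-3/4) * h powr (3/4)"
        using T by (simp add: powr_mult powr_minus_divide)
      also have "\<dots> \<le> (l / 2) powr (-3/4) * h powr (3/4)"
        using T l by (intro mult_right_mono powr_mono2') auto
      finally show "T powr (-3/4) \<le> (l / 2) powr (-3/4) * h powr (3/4)" .
    qed (use C in auto)
    also have "\<dots> = C * (l / 2) powr (-3/4) * (h powr (3/4) * h powr (5/4))" by (simp only: mult_ac)
    also have "h powr (3/4) * h powr (5/4) = h powr 2" by (simp only: powr_add[symmetric]) simp
    also have "h powr 2 = h\<^sup>2" using T by (simp add: powr_numeral)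
    finally show "expectation (\<lambda>\<omega>. (block_integral T {a..<b} \<omega>)\<^sup>2) \<le> C * (l / 2) powr (-3/4) * h\<^sup>2" .
  qed
qed

text \<open>The unit interval is cut into blocks on which \<open>cov_r\<close> varies by at most \<open>1/4\<close>. Two blocks are either
  weakly correlated throughout, or \<open>\<bar>cov_r\<bar> \<ge> 1/4\<close> throughout, in which case Cauchy--Schwarz suffices.\<close>

lemma block_integral_variance_bound:
  "\<exists>C T0. \<forall>T\<ge>T0. T > 0 \<longrightarrow> expectation (\<lambda>\<omega>. (block_integral T UNIV \<omega>)\<^sup>2) \<le>
     C * (\<integral>p. cov_energy (T * (fst p - snd p)) \<partial>unit_square)"
proof -
  define L where "L = (\<integral>l. \<bar>l\<bar> \<partial>\<rho>)"
  have L: "0 \<le> L" by (simp add: L_def)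
  \<comment> \<open>\<open>L\<close> is a Lipschitz constant of \<open>cov_r\<close>. Lags within
    one pair of blocks differ by at most 2 l in true time, so \<open>cov_r\<close> varies there by
    at most 2 L l \<le> 1/4.\<close>
  define l where "l = 1 / (8 * (L + 1))"
  have l: "0 < l" "2 * L * l \<le> 1/4" using L by (auto simp: l_def field_simps)
  obtain Cf where Cf: "0 < Cf" "\<And>t s. t \<noteq> s \<Longrightarrow> cmod (cov_r (t - s)) \<le> 1/2 \<Longrightarrow>
      \<bar>kernel t s\<bar> \<le> Cf * ((cmod (weighted_ft centered_freq (t - s)))\<^sup>2 + cmod (weighted_ft centered_freq_sq (t - s)))"
    using kernel_far unfolding kernel_def winding_rate_def by blast
  have "\<exists>C. C > 0 \<and> (\<forall>T>0. \<forall>h>0. \<forall>a b. a \<le> b \<longrightarrow> b - a \<le> h \<longrightarrow> l / 2 \<le> T * h \<longrightarrow> T * h \<le> l \<longrightarrow>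
    expectation (\<lambda>\<omega>. (block_integral T {a..<b} \<omega>)\<^sup>2) \<le> C * h\<^sup>2)"
    using block_second_moment[OF l(1)] .
  then obtain C0 where "C0 > 0 \<and> (\<forall>T>0. \<forall>h>0. \<forall>a b. a \<le> b \<longrightarrow> b - a \<le> h \<longrightarrow> l / 2 \<le> T * h \<longrightarrow> T * h \<le> l \<longrightarrow>
    expectation (\<lambda>\<omega>. (block_integral T {a..<b} \<omega>)\<^sup>2) \<le> C0 * h\<^sup>2)" by (rule exE)
  note C0 = this[THEN conjunct1] this[THEN conjunct2, rule_format]
  \<comment> \<open>\<open>Cf\<close> covers weakly correlated pairs. On the others the energy is at
    least (1/4)^2, which explains 16 C0.\<close>
  define C where "C = Cf + 16 * C0"
  show ?thesis
  proof (rule exI[of _ C], rule exI[of _ l], intro allI impI)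
    fix T assume T: "l \<le> T" "0 < T"
    \<comment> \<open>Rounding T / l up ensures T h \<le> l, and T \<ge> l keeps the rounding below
      a factor 2, so T h \<ge> l / 2.\<close>
    define n where "n = nat \<lceil>T / l\<rceil>"
    have "T / l \<le> real n" "real n < T / l + 1" using T l by (auto simp: n_def) linarith+
    moreover have "1 \<le> T / l" using T l by simp
    ultimately have n': "0 < real n" "T / l \<le> real n" "real n < 2 * (T / l)" by linarith+
    then have n0: "n > 0" by simp
    from n'(2,3) have "T \<le> real n * l" "real n * l \<le> 2 * T" using l(1) by (auto simp: field_simps)
    with n'(1) have n: "0 < real n" "T \<le> real n * l" "real n * l \<le> 2 * T" by blast+
    define h where "h = 1 / real n"
    have h: "0 < h" "l / 2 \<le> T * h" "T * h \<le> l" using n by (auto simp: h_def field_simps)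
    define I where "I j = {real j / real n..<real (Suc j) / real n}" for j :: nat
    have [measurable]: "I j \<in> sets borel" for j by (simp add: I_def)
    have Ih: "real j / real n \<le> real (Suc j) / real n" "real (Suc j) / real n - real j / real n \<le> h" for j
      using n by (auto simp: h_def field_simps)
    define Z where "Z j = block_integral T (I j)" for j
    let ?UU = "unit_square"
    let ?k = "\<lambda>p. kernel (T * fst p) (T * snd p)"
    let ?q = "\<lambda>p. cov_energy (T * (fst p - snd p))"
    let ?i = "\<lambda>j k p. indicator (I j) (fst p) * indicator (I k) (snd p) :: real"
    have km[measurable]: "?k \<in> borel_measurable ?UU" using borel_measurable_integrable[OF kernel_integrable[OF T(2)]] .
    have ik: "integrable ?UU (\<lambda>p. ?i j k p * ?k p)" for j k
    proof (rule Bochner_Integration.integrable_bound[OF kernel_integrable[OF T(2)]])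
      show "(\<lambda>p. ?i j k p * ?k p) \<in> borel_measurable ?UU" by (rule borel_measurable_times[OF _ km]) measurable
    qed (auto simp: indicator_def)
    have iq: "integrable ?UU (\<lambda>p. ?i j k p * ?q p)" for j k
      by (rule Bochner_Integration.integrable_bound[OF cov_energy_integrable[of T]]) (auto simp: indicator_def)
    have ii: "integrable ?UU (?i j k)" for j k
      by (rule UU.P.integrable_const_bound[where B=1]) (auto simp: indicator_def)
    have Zsq: "expectation (\<lambda>\<omega>. (Z j \<omega>)\<^sup>2) \<le> C0 * h\<^sup>2" for j
      unfolding Z_def I_def by (rule C0(2)[OF T(2) h(1) Ih h(2,3)])
    have ZZ: "expectation (\<lambda>\<omega>. Z j \<omega> * Z k \<omega>) = (\<integral>p. ?i j k p * ?k p \<partial>?UU)" for j k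
      unfolding Z_def by (rule block_integral_product(2)[OF T(2)]) auto
    have bound: "(\<integral>p. ?i j k p * ?k p \<partial>?UU) \<le> C * (\<integral>p. ?i j k p * ?q p \<partial>?UU)" if jk: "j < n" "k < n" for j k
    proof (cases "\<forall>u\<in>I j. \<forall>v\<in>I k. cmod (cov_r (T * (u - v))) \<le> 1/2")
      case True
      have "(\<integral>p. ?i j k p * ?k p \<partial>?UU) \<le> (\<integral>p. C * (?i j k p * ?q p) \<partial>?UU)"
      proof (rule integral_mono_AE[OF ik])
        show "integrable ?UU (\<lambda>p. C * (?i j k p * ?q p))" using iq by simp
        show "AE p in ?UU. ?i j k p * ?k p \<le> C * (?i j k p * ?q p)"
          using AE_UU_neq
        proof eventually_elim
          case (elim p)
          show ?case
          proof (cases "fst p \<in> I j \<and> snd p \<in> I k")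
            case True': True
            have ne: "T * fst p \<noteq> T * snd p" using elim T by simp
            have "cmod (cov_r (T * fst p - T * snd p)) \<le> 1/2" using True True' by (simp add: right_diff_distrib)
            then have "\<bar>?k p\<bar> \<le> Cf * ((cmod (weighted_ft centered_freq (T * fst p - T * snd p)))\<^sup>2 + cmod (weighted_ft centered_freq_sq (T * fst p - T * snd p)))"
              by (rule Cf(2)[OF ne])
            also have "\<dots> \<le> C * ?q p"
              using Cf(1) C0(1) by (intro mult_mono) (auto simp: C_def cov_energy_def right_diff_distrib)
            finally show ?thesis using True' by simp
          qed (auto simp: indicator_def)
        qed
      qed
      then show ?thesis by simp
    next
      case False
      then obtain u0 v0 where uv0: "u0 \<in> I j" "v0 \<in> I k" "1/2 < cmod (cov_r (T * (u0 - v0)))" by force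
      \<comment> \<open>One lag with |cov_r| > 1/2 and a variation of at most 1/4 leave |cov_r|
        \<ge> 1/4 on the whole pair.\<close>
      have low: "1/16 \<le> cov_energy (T * (u - v))" if uv: "u \<in> I j" "v \<in> I k" for u v
      proof -
        have "\<bar>u - u0\<bar> \<le> h" "\<bar>v - v0\<bar> \<le> h" using uv uv0 Ih(2)[of j] Ih(2)[of k] by (auto simp: I_def)
        then have "\<bar>(u0 - v0) - (u - v)\<bar> \<le> 2 * h" by linarith
        then have "T * \<bar>(u0 - v0) - (u - v)\<bar> \<le> T * (2 * h)" using T by (intro mult_left_mono) auto
        also have "\<dots> \<le> 2 * l" using h by simp
        finally have "\<bar>T * (u0 - v0) - T * (u - v)\<bar> \<le> 2 * l"
          using T by (simp add: abs_mult flip: right_diff_distrib)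
        then have "L * \<bar>T * (u0 - v0) - T * (u - v)\<bar> \<le> L * (2 * l)" using L by (intro mult_left_mono)
        then have "cmod (cov_r (T * (u0 - v0)) - cov_r (T * (u - v))) \<le> 1/4"
          using cov_r_lipschitz[of "T * (u0 - v0)" "T * (u - v)"] l(2) unfolding L_def[symmetric] by simp
        then have "1/4 \<le> cmod (cov_r (T * (u - v)))"
          using uv0(3) norm_triangle_ineq2[of "cov_r (T * (u0 - v0))" "cov_r (T * (u - v))"] by linarith
        then have "(1/4)\<^sup>2 \<le> (cmod (cov_r (T * (u - v))))\<^sup>2" by (intro power_mono) auto
        also have "\<dots> \<le> cov_energy (T * (u - v))" by (simp add: cov_energy_def)
        finally show ?thesis by (simp add: power2_eq_square)
      qed
      \<comment> \<open>Only blocks with index below n lie inside [0, 1] and have the full mass h;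
        the pair then has area exactly h^2.\<close>
      have meas: "measure unit_lebesgue (I j) = h" if "j < n" for j
      proof -
        have "real (Suc j) / real n \<le> 1" using that by (simp add: divide_le_eq)
        then show ?thesis unfolding I_def using n by (subst measure_unit_lebesgue_Ico) (auto simp: h_def field_simps)
      qed
      have "h\<^sup>2 = (\<integral>p. ?i j k p \<partial>?UU)"
        using UU.integral_fst'[OF ii[of j k]] meas jk by (simp add: power2_eq_square)
      then have "C0 * h\<^sup>2 = 16 * C0 * (\<integral>p. ?i j k p * (1/16) \<partial>?UU)" by simp
      also have "\<dots> \<le> 16 * C0 * (\<integral>p. ?i j k p * ?q p \<partial>?UU)"
      proof (rule mult_left_mono)
        have pt: "?i j k p * (1/16) \<le> ?i j k p * ?q p" for p using low by (auto simp: indicator_def)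
        have "integrable ?UU (\<lambda>p. ?i j k p * (1/16))" using ii by simp
        then show "(\<integral>p. ?i j k p * (1/16) \<partial>?UU) \<le> (\<integral>p. ?i j k p * ?q p \<partial>?UU)"
          by (rule integral_mono[OF _ iq pt])
      qed (use C0(1) in simp)
      also have "\<dots> \<le> C * (\<integral>p. ?i j k p * ?q p \<partial>?UU)"
        using Cf(1) by (intro mult_right_mono Bochner_Integration.integral_nonneg mult_nonneg_nonneg cov_energy_nonneg) (auto simp: C_def)
      finally have *: "C0 * h\<^sup>2 \<le> C * (\<integral>p. ?i j k p * ?q p \<partial>?UU)" .
      have iZ: "integrable M (\<lambda>\<omega>. Z j \<omega> * Z k \<omega>)" for j k
        unfolding Z_def by (rule block_integral_product(1)[OF T(2)]) auto
      \<comment> \<open>Cauchy-Schwarz in arithmetic-mean form, which loses nothing since both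
        blocks share the bound C0 h^2.\<close>
      have "expectation (\<lambda>\<omega>. Z j \<omega> * Z k \<omega>) \<le> expectation (\<lambda>\<omega>. ((Z j \<omega>)\<^sup>2 + (Z k \<omega>)\<^sup>2) / 2)"
      proof (rule integral_mono[OF iZ])
        show "integrable M (\<lambda>\<omega>. ((Z j \<omega>)\<^sup>2 + (Z k \<omega>)\<^sup>2) / 2)" using iZ by (simp add: power2_eq_square)
        show "Z j \<omega> * Z k \<omega> \<le> ((Z j \<omega>)\<^sup>2 + (Z k \<omega>)\<^sup>2) / 2" for \<omega>
          using sum_squares_bound[of "Z j \<omega>" "Z k \<omega>"] by simp
      qed
      also have "\<dots> = (expectation (\<lambda>\<omega>. (Z j \<omega>)\<^sup>2) + expectation (\<lambda>\<omega>. (Z k \<omega>)\<^sup>2)) / 2"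
        using iZ by (simp add: power2_eq_square)
      also have "\<dots> \<le> C0 * h\<^sup>2" using Zsq[of j] Zsq[of k] by simp
      finally show ?thesis using * unfolding ZZ by linarith
    qed
    have AE1: "AE p in ?UU. (\<Sum>j<n. \<Sum>k<n. ?i j k p) = 1"
    proof (rule UU.AE_pair_measure)
      show "AE x in unit_lebesgue. AE y in unit_lebesgue. (\<Sum>j<n. \<Sum>k<n. ?i j k (x, y)) = 1"
        using AE_sum_blocks[OF n0]
      proof eventually_elim
        case (elim x)
        show ?case using AE_sum_blocks[OF n0]
        proof eventually_elim
          case (elim y)
          then show ?case using \<open>(\<Sum>j<n. indicator {real j / real n..<real (Suc j) / real n} x) = (1::real)\<close>
            by (simp only: fst_conv snd_conv I_def sum_product[symmetric])
        qed
      qed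
    qed measurable
    have decomp: "(\<integral>p. g p \<partial>?UU) = (\<Sum>j<n. \<Sum>k<n. (\<integral>p. ?i j k p * g p \<partial>?UU))"
      if [measurable]: "g \<in> borel_measurable ?UU" and "\<And>j k. integrable ?UU (\<lambda>p. ?i j k p * g p)" for g :: "real \<times> real \<Rightarrow> real"
    proof -
      have "(\<integral>p. g p \<partial>?UU) = (\<integral>p. (\<Sum>j<n. \<Sum>k<n. ?i j k p * g p) \<partial>?UU)"
      proof (rule integral_cong_AE)
        show "AE p in ?UU. g p = (\<Sum>j<n. \<Sum>k<n. ?i j k p * g p)"
          using AE1
        proof eventually_elim
          case (elim p)
          have "(\<Sum>j<n. \<Sum>k<n. ?i j k p) * g p = g p" unfolding elim by simp
          then show ?case by (simp only: sum_distrib_right)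
        qed
      qed measurable
      also have "\<dots> = (\<Sum>j<n. \<Sum>k<n. (\<integral>p. ?i j k p * g p \<partial>?UU))"
        using that(2) by (simp add: Bochner_Integration.integral_sum)
      finally show ?thesis .
    qed
    have "expectation (\<lambda>\<omega>. (block_integral T UNIV \<omega>)\<^sup>2) = (\<integral>p. ?k p \<partial>?UU)"
      using block_integral_product(2)[OF T(2), of UNIV UNIV] by (simp add: power2_eq_square)
    also have "\<dots> = (\<Sum>j<n. \<Sum>k<n. (\<integral>p. ?i j k p * ?k p \<partial>?UU))" by (rule decomp[OF km ik])
    also have "\<dots> \<le> (\<Sum>j<n. \<Sum>k<n. C * (\<integral>p. ?i j k p * ?q p \<partial>?UU))"
      by (intro sum_mono bound) auto
    also have "\<dots> = C * (\<integral>p. ?q p \<partial>?UU)"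
      by (subst decomp[of ?q]) (auto intro: iq simp: sum_distrib_left)
    finally show "expectation (\<lambda>\<omega>. (block_integral T UNIV \<omega>)\<^sup>2) \<le> C * (\<integral>p. ?q p \<partial>?UU)" .
  qed
qed

lemma block_integral_square_tendsto:
  "((\<lambda>T. expectation (\<lambda>\<omega>. (block_integral T UNIV \<omega>)\<^sup>2)) \<longlongrightarrow> 0) at_top"
proof -
  obtain C T0 where C: "\<And>T. T \<ge> T0 \<Longrightarrow> T > 0 \<Longrightarrow> expectation (\<lambda>\<omega>. (block_integral T UNIV \<omega>)\<^sup>2) \<le>
     C * (\<integral>p. cov_energy (T * (fst p - snd p)) \<partial>unit_square)"
    using block_integral_variance_bound by blast
  have lim: "((\<lambda>T. C * (\<integral>p. cov_energy (T * (fst p - snd p)) \<partial>unit_square)) \<longlongrightarrow> 0) at_top"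
    using tendsto_mult_right_zero[OF cov_energy_mean_tendsto] .
  show ?thesis
  proof (rule tendsto_sandwich[OF _ _ tendsto_const lim])
    show "\<forall>\<^sub>F T in at_top. expectation (\<lambda>\<omega>. (block_integral T UNIV \<omega>)\<^sup>2) \<le> C * (\<integral>p. cov_energy (T * (fst p - snd p)) \<partial>unit_square)"
      using eventually_ge_at_top[of T0] eventually_gt_at_top[of 0] by eventually_elim (rule C)
  qed (auto intro!: always_eventually)
qed

section \<open>From block integrals back to the winding\<close>

lemma AE_F_nonzero: "AE \<omega> in M. AE t in lborel. F t \<omega> \<noteq> 0"
proof -
  have "AE \<omega> in M. F t \<omega> \<noteq> 0" for t
  proof -
    have "emeasure std_complex_normal {0} = 0"
    proof -
      have "(\<integral>\<^sup>+z. ennreal (exp (- (cmod z)\<^sup>2) / pi) * indicator {0} z \<partial>lborel) = 0"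
        by (subst nn_integral_0_iff_AE) (use AE_lborel_singleton[of "0::complex"] in \<open>auto simp: indicator_def\<close>)
      then show ?thesis by (simp add: std_complex_normal_def emeasure_density)
    qed
    then have "(\<integral>\<^sup>+\<omega>. indicator {0} (F t \<omega>) \<partial>M) = 0"
      using represents_nn_integral[OF represents_F[of t], of "indicator {0}"] rho.prob_space by simp
    then show ?thesis by (subst (asm) nn_integral_0_iff_AE) (auto simp: indicator_def)
  qed
  then have "AE t in lborel. AE \<omega> in M. F t \<omega> \<noteq> 0" by simp
  then show ?thesis by (subst (asm) LM.AE_commute) measurable
qed

text \<open>Substitute t = T u. Where F is nonzero, centring adds i times the mean frequency to the
  logarithmic derivative, so the rate exceeds the true angular speed by that constant. The
  correction - T * \<open>mean_frequency\<close> is deterministic and drops out of the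
  variance.\<close>

lemma AE_winding_block:
  assumes T: "T > 0"
  shows "AE \<omega> in M. winding (\<lambda>t. F t \<omega>) T = complex_of_real (T * (block_integral T UNIV \<omega> - mean_frequency))"
proof -
  note both = eventually_conj[OF AE_winding_eq eventually_conj[OF AE_F_nonzero AE_integrable_rate[OF T]]]
  show ?thesis
  proof (rule AE_mp[OF both], rule AE_I2, rule impI, elim conjE)
    fix \<omega> assume \<omega>: "\<omega> \<in> space M"
      and w: "\<forall>T. winding (\<lambda>t. F t \<omega>) T = complex_of_real (LBINT t:{0..T}. Im (deriv_F t \<omega> / F t \<omega>))"
      and nz: "AE t in lborel. F t \<omega> \<noteq> 0" and i: "integrable unit_lebesgue (\<lambda>u. winding_rate (T * u) \<omega>)"
    have [measurable]: "(\<lambda>s. deriv_F s \<omega>) \<in> borel_measurable borel" "(\<lambda>s. F s \<omega>) \<in> borel_measurable borel"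
      "(\<lambda>s. winding_rate s \<omega>) \<in> borel_measurable borel"
      using \<omega> by measurable
    have "(LBINT t:{0..T}. Im (deriv_F t \<omega> / F t \<omega>)) = (LBINT t:{0..T}. winding_rate t \<omega> - mean_frequency)"
      unfolding set_lebesgue_integral_def
    proof (rule integral_cong_AE)
      show "AE t in lborel. indicat_real {0..T} t *\<^sub>R Im (deriv_F t \<omega> / F t \<omega>) = indicat_real {0..T} t *\<^sub>R (winding_rate t \<omega> - mean_frequency)"
        using nz
      proof eventually_elim
        case (elim t)
        have "centered t \<omega> / F t \<omega> = deriv_F t \<omega> / F t \<omega> + \<i> * complex_of_real mean_frequency"
          using elim by (simp add: centered_def add_divide_distrib)
        then show ?case by (simp add: winding_rate_def)
      qed
    qed measurable
    also have "\<dots> = T * (\<integral>u. indicator {0..T} (T * u) *\<^sub>R (winding_rate (T * u) \<omega> - mean_frequency) \<partial>lborel)"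
      unfolding set_lebesgue_integral_def using lborel_integral_real_affine[of T "\<lambda>t. indicat_real {0..T} t *\<^sub>R (winding_rate t \<omega> - mean_frequency)" 0] T by simp
    also have "(\<integral>u. indicator {0..T} (T * u) *\<^sub>R (winding_rate (T * u) \<omega> - mean_frequency) \<partial>lborel) =
       (LBINT u:{0..1}. winding_rate (T * u) \<omega> - mean_frequency)"
      unfolding set_lebesgue_integral_def using T
      by (intro Bochner_Integration.integral_cong) (auto simp: indicator_def zero_le_mult_iff)
    also have "\<dots> = (\<integral>u. winding_rate (T * u) \<omega> - mean_frequency \<partial>unit_lebesgue)"
      by (rule integral_unit_lebesgue(1)[symmetric]) measurable
    also have "\<dots> = block_integral T UNIV \<omega> - mean_frequency"
      using i unitL.prob_space by (simp add: block_integral_def)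
    finally show "winding (\<lambda>t. F t \<omega>) T = complex_of_real (T * (block_integral T UNIV \<omega> - mean_frequency))"
      using w by simp
  qed
qed

lemma winding_variance_limit:
  fixes \<Delta> :: "real \<Rightarrow> 'a \<Rightarrow> real"
  assumes meas: "\<And>T. T > 0 \<Longrightarrow> \<Delta> T \<in> borel_measurable M"
    and AE: "\<And>T. T > 0 \<Longrightarrow> AE \<omega> in M. complex_of_real (\<Delta> T \<omega>) = winding (\<lambda>t. F t \<omega>) T"
  shows "\<And>T. T > 0 \<Longrightarrow> integrable M (\<lambda>\<omega>. (\<Delta> T \<omega>)\<^sup>2)"
    "((\<lambda>T. variance (\<Delta> T) / T\<^sup>2) \<longlongrightarrow> 0) at_top"
proof -
  define Z where "Z T = block_integral T UNIV" for T
  have [measurable]: "Z T \<in> borel_measurable M" for T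
    unfolding Z_def by (rule block_integral_measurable) simp
  have Z2: "integrable M (\<lambda>\<omega>. (Z T \<omega>)\<^sup>2)" if "T > 0" for T
    using block_integral_product(1)[OF that, of UNIV UNIV] by (simp add: Z_def power2_eq_square)
  have Z1: "integrable M (Z T)" if "T > 0" for T
    by (rule square_integrable_imp_integrable[OF _ Z2[OF that]]) simp
  have eq: "AE \<omega> in M. \<Delta> T \<omega> = T * (Z T \<omega> - mean_frequency)" if "T > 0" for T
    using AE[OF that] AE_winding_block[OF that]
  proof eventually_elim
    case (elim \<omega>)
    then have "complex_of_real (\<Delta> T \<omega>) = complex_of_real (T * (Z T \<omega> - mean_frequency))"
      unfolding Z_def by (rule trans)
    then show ?case by (simp only: of_real_eq_iff)
  qed
  show int: "integrable M (\<lambda>\<omega>. (\<Delta> T \<omega>)\<^sup>2)" if T: "T > 0" for T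
  proof -
    note [measurable] = meas[OF T]
    have "integrable M (\<lambda>\<omega>. (T * (Z T \<omega> - mean_frequency))\<^sup>2)"
      using Z1[OF T] Z2[OF T] by (simp add: power_mult_distrib power2_diff)
    moreover have "AE \<omega> in M. (\<Delta> T \<omega>)\<^sup>2 = (T * (Z T \<omega> - mean_frequency))\<^sup>2"
      using eq[OF T] by eventually_elim simp
    ultimately show ?thesis by (subst integrable_cong_AE) auto
  qed
  \<comment> \<open>The shift cancels against the mean and the scale T against T^2; the variance of
    \<open>Z T\<close> is then bounded by its second moment.\<close>
  have le: "variance (\<Delta> T) / T\<^sup>2 \<le> expectation (\<lambda>\<omega>. (Z T \<omega>)\<^sup>2)" if T: "T > 0" for T
  proof -
    note [measurable] = meas[OF T]
    have e: "expectation (\<Delta> T) = T * (expectation (Z T) - mean_frequency)"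
    proof -
      have "expectation (\<Delta> T) = expectation (\<lambda>\<omega>. T * (Z T \<omega> - mean_frequency))"
        by (rule integral_cong_AE[OF _ _ eq[OF T]]) auto
      then show ?thesis using Z1[OF T] prob_space by simp
    qed
    have "variance (\<Delta> T) = expectation (\<lambda>\<omega>. T\<^sup>2 * (Z T \<omega> - expectation (Z T))\<^sup>2)"
    proof (rule integral_cong_AE)
      show "AE \<omega> in M. (\<Delta> T \<omega> - expectation (\<Delta> T))\<^sup>2 = T\<^sup>2 * (Z T \<omega> - expectation (Z T))\<^sup>2"
        using eq[OF T]
      proof eventually_elim
        case (elim \<omega>)
        have "\<Delta> T \<omega> - expectation (\<Delta> T) = T * (Z T \<omega> - expectation (Z T))"
          unfolding e elim by (simp add: algebra_simps)
        then show ?case by (simp only: power_mult_distrib)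
      qed
    qed auto
    also have "\<dots> = T\<^sup>2 * variance (Z T)" by simp
    finally have "variance (\<Delta> T) / T\<^sup>2 = variance (Z T)" using T by simp
    also have "\<dots> \<le> expectation (\<lambda>\<omega>. (Z T \<omega>)\<^sup>2)" using variance_eq[OF Z1[OF T] Z2[OF T]] by simp
    finally show ?thesis .
  qed
  show "((\<lambda>T. variance (\<Delta> T) / T\<^sup>2) \<longlongrightarrow> 0) at_top"
  proof (rule tendsto_sandwich[OF _ _ tendsto_const block_integral_square_tendsto])
    show "\<forall>\<^sub>F T in at_top. variance (\<Delta> T) / T\<^sup>2 \<le> expectation (\<lambda>\<omega>. (block_integral T UNIV \<omega>)\<^sup>2)"
      using eventually_gt_at_top[of 0] by eventually_elim (use le in \<open>simp add: Z_def\<close>)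
  qed (auto intro!: always_eventually)
qed

end

section \<open>Reduction of the original hypotheses to the locale\<close>

lemma log_moment_bound:
  fixes \<rho> :: "real measure"
  assumes "real_distribution \<rho>" "\<alpha> > 0" "integrable \<rho> (\<lambda>l. l\<^sup>2 * ln (1 + \<bar>l\<bar>) powr (1 + \<alpha>))"
  shows "integrable \<rho> (\<lambda>l. l\<^sup>2 * (1 + ln (1 + \<bar>l\<bar>)))"
proof -
  interpret real_distribution \<rho> by fact
  have "l\<^sup>2 * (1 + ln (1 + \<bar>l\<bar>)) \<le> 8 + 2 * (l\<^sup>2 * ln (1 + \<bar>l\<bar>) powr (1 + \<alpha>))" for l :: real
  proof (cases "ln (1 + \<bar>l\<bar>) \<le> 1")
    case True
    \<comment> \<open>A logarithm at most 1 forces |l| \<le> e - 1 \<le> 2, whence the constant 8 =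
      4 * 2.\<close>
    have "1 + \<bar>l\<bar> = exp (ln (1 + \<bar>l\<bar>))" by simp
    also have "\<dots> \<le> exp 1" using True by (subst exp_le_cancel_iff)
    also have "exp (1::real) \<le> 3" by (rule exp_le)
    finally have "\<bar>l\<bar> \<le> \<bar>2\<bar>" by simp
    then have "l\<^sup>2 \<le> 2\<^sup>2" by (simp only: abs_le_square_iff)
    then have "l\<^sup>2 * (1 + ln (1 + \<bar>l\<bar>)) \<le> 4 * 2" using True by (intro mult_mono) auto
    then show ?thesis by (simp add: add_increasing2)
  next
    case False
    define L where "L = ln (1 + \<bar>l\<bar>)"
    have L: "1 < L" using False by (simp add: L_def)
    \<comment> \<open>Above 1 the higher power of the logarithm dominates both L and 1.\<close>
    have "L powr 1 \<le> L powr (1 + \<alpha>)" using L assms by (intro powr_mono) auto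
    then have "1 + L \<le> 2 * L powr (1 + \<alpha>)" using L by simp
    then have "l\<^sup>2 * (1 + L) \<le> l\<^sup>2 * (2 * L powr (1 + \<alpha>))" by (intro mult_left_mono) auto
    then show ?thesis by (simp add: L_def)
  qed
  moreover have "0 \<le> l\<^sup>2 * (1 + ln (1 + \<bar>l\<bar>))" for l :: real by simp
  moreover have "integrable \<rho> (\<lambda>l. 8 + 2 * (l\<^sup>2 * ln (1 + \<bar>l\<bar>) powr (1 + \<alpha>)))" using assms(3) by simp
  ultimately show ?thesis
    by (elim Bochner_Integration.integrable_bound) (auto intro!: AE_I2 order_trans[OF _ abs_ge_self])
qed

text \<open>Square integrability is part of the conclusion because the Bochner integral of a
  non-integrable function is 0, so the limit alone could hold for an infinite variance.\<close>

theorem theorem4: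
  fixes M :: "'a measure"
    and f :: "real \<Rightarrow> 'a \<Rightarrow> complex"
    and r :: "real \<Rightarrow> complex"
    and \<rho> :: "real measure"
    and \<alpha> :: real
    and \<Delta> :: "real \<Rightarrow> 'a \<Rightarrow> real"
  assumes "complex_gaussian_process M f"
    and "stationary_process M f"
    and "AE \<omega> in M. continuous_on UNIV (\<lambda>t. f t \<omega>)"
    and "r = covariance_kernel M f"
    and "continuous_on UNIV r"
    and "r 0 = 1"
    and "spectral_measure \<rho> r"
    and "\<not> degenerate \<rho>"
    and "\<alpha> > 0"
    and "integrable \<rho> (\<lambda>l. l\<^sup>2 * ln (1 + \<bar>l\<bar>) powr (1 + \<alpha>))"
    and "winding_of_process M f \<Delta>"
    and "has_no_atoms \<rho>"
  shows "(\<forall>T>0. integrable M (\<lambda>\<omega>. (\<Delta> T \<omega>)\<^sup>2)) \<and>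
    ((\<lambda>T. prob_space.variance M (\<Delta> T) / T\<^sup>2) \<longlongrightarrow> 0) at_top"
proof -
  interpret prob_space M using assms(1) by (simp add: complex_gaussian_process_def)
  interpret rho: real_distribution \<rho> using assms(7) by (simp add: spectral_measure_def)
  note [measurable] = gaussian_process_measurable[OF assms(1,2,4,7)]
  \<comment> \<open>The exceptional set need not be measurable, so it is enclosed in a measurable
    null set.\<close>
  obtain N where N: "{\<omega> \<in> space M. \<not> continuous_on UNIV (\<lambda>t. f t \<omega>)} \<subseteq> N" "N \<in> null_sets M"
    using assms(3) by (auto simp: eventually_ae_filter)
  have [measurable]: "N \<in> sets M" using N by auto
  \<comment> \<open>A modification with every path continuous and every marginal still measurable;
    almost surely it agrees with \<open>f\<close> at all times at once, so characteristic functions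
    and winding are unchanged.\<close>
  define F where "F t \<omega> = (if \<omega> \<in> space M - N then f t \<omega> else 0)" for t \<omega>
  have Fm: "F t \<in> borel_measurable M" for t unfolding F_def by measurable
  have Fc: "continuous_on UNIV (\<lambda>t. F t \<omega>)" for \<omega>
    using N(1) by (cases "\<omega> \<in> space M - N") (auto simp: F_def)
  have eq: "AE \<omega> in M. \<forall>t. F t \<omega> = f t \<omega>"
    using AE_not_in[OF N(2)] by (rule AE_mp) (auto intro!: AE_I2 simp: F_def)
  interpret stationary_gaussian M \<rho> F
  proof unfold_locales
    show "(\<lambda>p. F (fst p) (snd p)) \<in> borel_measurable (borel \<Otimes>\<^sub>M M)"
      by (rule continuous_paths_measurable[OF Fm Fc])
    show "integrable \<rho> (\<lambda>l. l\<^sup>2 * (1 + ln (1 + \<bar>l\<bar>)))"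
      by (rule log_moment_bound[OF rho.real_distribution_axioms assms(9,10)])
    show "measure \<rho> {x} = 0" for x using assms(12) by (simp add: has_no_atoms_def)
    fix S :: "real set" and c assume S: "finite S"
    note [measurable] = Fm
    have "expectation (\<lambda>\<omega>. iexp (Re (\<Sum>t\<in>S. c t * F t \<omega>))) = expectation (\<lambda>\<omega>. iexp (Re (\<Sum>t\<in>S. c t * f t \<omega>)))"
      by (rule integral_cong_AE) (use eq in \<open>auto elim!: eventually_mono\<close>)
    also have "\<dots> = complex_of_real (exp (- (\<integral>l. (cmod (\<Sum>t\<in>S. c t * fourier_mode t l))\<^sup>2 \<partial>\<rho>) / 4))"
      by (rule gaussian_process_char[OF assms(1,2,4,7) S])
    finally show "expectation (\<lambda>\<omega>. iexp (Re (\<Sum>t\<in>S. c t * F t \<omega>))) = complex_of_real (exp (- (\<integral>l. (cmod (\<Sum>t\<in>S. c t * fourier_mode t l))\<^sup>2 \<partial>\<rho>) / 4))" .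
  qed (rule Fc)
  have "AE \<omega> in M. complex_of_real (\<Delta> T \<omega>) = winding (\<lambda>t. F t \<omega>) T" if "T > 0" for T
  proof -
    have "AE \<omega> in M. complex_of_real (\<Delta> T \<omega>) = winding (\<lambda>t. f t \<omega>) T"
      using assms(11) that by (simp add: winding_of_process_def)
    then show ?thesis using eq by eventually_elim (simp add: fun_eq_iff[symmetric])
  qed
  moreover have "\<Delta> T \<in> borel_measurable M" if "T > 0" for T
    using assms(11) that by (simp add: winding_of_process_def)
  ultimately show ?thesis using winding_variance_limit[of \<Delta>] by blast
qed

end
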